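(* Let $\mathcal{F}$ be a finite class of graphs that is leaf-reducible and wonderful. If $\mathcal{F}$ is generalized nice, then $\mathcal{F}$ has the Erdős–Hajnal property.
   Context: All graphs are finite and simple; $|G|$ is the number of vertices of $G$, and $\overline{G}$ is the complement of $G$. A clique (stable set) is a set of pairwise adjacent (nonadjacent) vertices. For a set of graphs $\mathcal{F}$, $\overline{\mathcal{F}}=\{\overline{F}:F\in\mathcal{F}\}$, and $G$ is $\mathcal{F}$-free if no induced subgraph of $G$ is isomorphic to a member of $\mathcal{F}$. A nonempty set $\mathcal{H}$ of graphs has the Erdős–Hajnal property if there is $c>0$ such that every $n$-vertex $\mathcal{H}$-free graph has a clique or stable set of size at least $n^c$. For disjoint $X,Y\subseteq V(G)$, $X$ is complete (anti-complete) to $Y$ if every vertex of $X$ is adjacent (nonadjacent) to every vertex of $Y$. A set $X$ (or the induced subgraph on $X$, or a graph with vertex set $X$) is $c$-sparse if every vertex in $X$ has at most $c|X|$ neighbors in $X$; it is $c$-restricted if it or its complement is $c$-sparse. Two disjoint sets $X,Y$ are $c$-sparse if every vertex of $X$ has at most $c|Y|$ neighbors in $Y$ and every vertex of $Y$ has at most $c|X|$ neighbors in $X$; they are weakly $c$-sparse if the number of edges between them is at most $c|X||Y|$. A set of vertices is anti-connected if the complement of its induced subgraph is connected. An $(\ell,w)$-blockade in $G$ (where $\ell,w$ are nonnegative reals, not necessarily integers) is a sequence $(B_1,\ldots,B_k)$ of disjoint subsets (blocks) of $V(G)$ with $k\ge \ell$ and $|B_i|\ge w$ for all $i$. It is complete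 (anti-complete) if its blocks are pairwise complete (anti-complete). $V(\mathcal{B})$ is the union of the blocks of $\mathcal{B}$, and $N(v)$ is the set of neighbors of $v$. Leaf-reducible: a finite class $\mathcal{F}$ is leaf-reducible if there is $H\in\mathcal{F}$ with a vertex $v$ of degree 1 such that $(\mathcal{F}\setminus\{H\})\cup\{H-v\}$ has the Erdős–Hajnal property. Wonderful: a finite class $\mathcal{F}$ is wonderful if there is a constant $a\ge 6$ such that for every $y\in(0,1/2)$ and every $\overline{\mathcal{F}}$-free graph $G$ the following holds. If $\mathcal{B}=(B_1,\ldots,B_\ell)$ is an $(\ell,w)$-blockade in $G$, where $\ell$ is an integer at least $y^{-a}$, each block of $\mathcal{B}$ is anti-connected, all blocks have the same size, and every two blocks are complete to each other or $y^a$-sparse, then one of the following holds: (i) $G$ has a $y^4$-restricted induced subgraph of size at least $w$; (ii) there exists $i\in\{1,\ldots,\ell\}$ such that there are at most $y|G|$ vertices $v\in V(G)\setminus V(\mathcal{B})$ with $0<|N(v)\cap B_i|<\frac12|B_i|$. Generalized nice: a finite class $\mathcal{F}$ is generalized nice if there exist $c_1\ge 3$, $c_2\ge 8$, $c_3,c_4,c_5,c_8>0$, $c_6\ge 1$ and $c_7\ge 4$ such that for every $\overline{\mathcal{F}}$-free graph $G$ and every $0<\epsilon<\frac12$, one of the following holds: (i) $G$ has an $(\epsilon^{-1},\epsilon^{c_1}|G|)$-blockade whose blocks are pairwise complete or weakly $\epsilon^{c_2}$-sparse (each pair of blocks is complete or weakly $\epsilon^{c_2}$-sparse); (ii) $G$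 has a clique or stable set of size at least $(\epsilon^{c_3}|G|)^{c_4}$; (iii) $G$ has a complete or anti-complete $(k,|G|/k^{c_5})$-blockade for some $k\ge\epsilon^{-c_6}$; (iv) $G$ has an $\epsilon^{c_7}$-restricted induced subgraph of size at least $\epsilon^{c_8}|G|$. *)

theory Defs
  imports Complex_Main
begin

text \<open>
  A graph is a vertex set together with a set of two-element edges.  All notions concerning classes
  of graphs quantify over graphs whose vertices are natural numbers; since every finite graph is
  isomorphic to one of these, and all the notions below are invariant under isomorphism, this
  loses no generality.
\<close>

record 'a graph =
  verts :: "'a set"
  edges :: "'a set set"

definition simple_graph :: "'a graph \<Rightarrow> bool" where
  "simple_graph G \<longleftrightarrow> finite (verts G) \<and> (\<forall>e\<in>edges G. e \<subseteq> verts G \<and> card e = 2)"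

definition order :: "'a graph \<Rightarrow> nat" where
  "order G = card (verts G)"

definition adj :: "'a graph \<Rightarrow> 'a \<Rightarrow> 'a \<Rightarrow> bool" where
  "adj G u v \<longleftrightarrow> {u, v} \<in> edges G"

definition nbrs :: "'a graph \<Rightarrow> 'a \<Rightarrow> 'a set" where
  "nbrs G v = {u \<in> verts G. adj G v u}"

definition complement :: "'a graph \<Rightarrow> 'a graph" where
  "complement G =
     \<lparr>verts = verts G, edges = {e. e \<subseteq> verts G \<and> card e = 2 \<and> e \<notin> edges G}\<rparr>"

definition induced :: "'a graph \<Rightarrow> 'a set \<Rightarrow> 'a graph" where
  "induced G X = \<lparr>verts = X, edges = {e \<in> edges G. e \<subseteq> X}\<rparr>"

definition del_vertex :: "'a graph \<Rightarrow> 'a \<Rightarrow> 'a graph" where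
  "del_vertex G v = induced G (verts G - {v})"

definition isomorphic :: "'a graph \<Rightarrow> 'b graph \<Rightarrow> bool" where
  "isomorphic G H \<longleftrightarrow>
     (\<exists>f. bij_betw f (verts G) (verts H) \<and>
          (\<forall>u\<in>verts G. \<forall>v\<in>verts G. adj G u v \<longleftrightarrow> adj H (f u) (f v)))"

definition free :: "'b graph set \<Rightarrow> 'a graph \<Rightarrow> bool" where
  "free \<F> G \<longleftrightarrow> \<not> (\<exists>X\<subseteq>verts G. \<exists>F\<in>\<F>. isomorphic (induced G X) F)"

definition clique :: "'a graph \<Rightarrow> 'a set \<Rightarrow> bool" where
  "clique G X \<longleftrightarrow> X \<subseteq> verts G \<and> (\<forall>u\<in>X. \<forall>v\<in>X. u \<noteq> v \<longrightarrow> adj G u v)"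

definition stable :: "'a graph \<Rightarrow> 'a set \<Rightarrow> bool" where
  "stable G X \<longleftrightarrow> X \<subseteq> verts G \<and> (\<forall>u\<in>X. \<forall>v\<in>X. u \<noteq> v \<longrightarrow> \<not> adj G u v)"

definition connected_graph :: "'a graph \<Rightarrow> bool" where
  "connected_graph G \<longleftrightarrow>
     verts G \<noteq> {} \<and> (\<forall>u\<in>verts G. \<forall>v\<in>verts G. (adj G)\<^sup>*\<^sup>* u v)"

definition anti_connected :: "'a graph \<Rightarrow> 'a set \<Rightarrow> bool" where
  "anti_connected G X \<longleftrightarrow> connected_graph (complement (induced G X))"

definition complete_to :: "'a graph \<Rightarrow> 'a set \<Rightarrow> 'a set \<Rightarrow> bool" where
  "complete_to G X Y \<longleftrightarrow> (\<forall>x\<in>X. \<forall>y\<in>Y. adj G x y)"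

definition anti_complete_to :: "'a graph \<Rightarrow> 'a set \<Rightarrow> 'a set \<Rightarrow> bool" where
  "anti_complete_to G X Y \<longleftrightarrow> (\<forall>x\<in>X. \<forall>y\<in>Y. \<not> adj G x y)"

definition sparse :: "'a graph \<Rightarrow> real \<Rightarrow> 'a set \<Rightarrow> bool" where
  "sparse G c X \<longleftrightarrow> (\<forall>v\<in>X. real (card (nbrs G v \<inter> X)) \<le> c * real (card X))"

definition restricted :: "'a graph \<Rightarrow> real \<Rightarrow> 'a set \<Rightarrow> bool" where
  "restricted G c X \<longleftrightarrow> sparse G c X \<or> sparse (complement G) c X"

text \<open>The following two notions are only used for disjoint sets.\<close>

definition sparse_pair :: "'a graph \<Rightarrow> real \<Rightarrow> 'a set \<Rightarrow> 'a set \<Rightarrow> bool" where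
  "sparse_pair G c X Y \<longleftrightarrow>
     (\<forall>x\<in>X. real (card (nbrs G x \<inter> Y)) \<le> c * real (card Y)) \<and>
     (\<forall>y\<in>Y. real (card (nbrs G y \<inter> X)) \<le> c * real (card X))"

definition weakly_sparse_pair :: "'a graph \<Rightarrow> real \<Rightarrow> 'a set \<Rightarrow> 'a set \<Rightarrow> bool" where
  "weakly_sparse_pair G c X Y \<longleftrightarrow>
     real (card {e \<in> edges G. \<exists>x\<in>X. \<exists>y\<in>Y. e = {x, y}}) \<le> c * real (card X) * real (card Y)"

definition blockade :: "'a graph \<Rightarrow> real \<Rightarrow> real \<Rightarrow> 'a set list \<Rightarrow> bool" where
  "blockade G l w \<B> \<longleftrightarrow>
     0 \<le> l \<and> 0 \<le> w \<and> l \<le> real (length \<B>) \<and>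
     (\<forall>i<length \<B>. \<B> ! i \<subseteq> verts G \<and> w \<le> real (card (\<B> ! i))) \<and>
     (\<forall>i<length \<B>. \<forall>j<length \<B>. i \<noteq> j \<longrightarrow> \<B> ! i \<inter> \<B> ! j = {})"

definition pairwise_blocks :: "('a set \<Rightarrow> 'a set \<Rightarrow> bool) \<Rightarrow> 'a set list \<Rightarrow> bool" where
  "pairwise_blocks P \<B> \<longleftrightarrow>
     (\<forall>i<length \<B>. \<forall>j<length \<B>. i \<noteq> j \<longrightarrow> P (\<B> ! i) (\<B> ! j))"

definition complete_blockade :: "'a graph \<Rightarrow> 'a set list \<Rightarrow> bool" where
  "complete_blockade G \<B> \<longleftrightarrow> pairwise_blocks (complete_to G) \<B>"

definition anti_complete_blockade :: "'a graph \<Rightarrow> 'a set list \<Rightarrow> bool" where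
  "anti_complete_blockade G \<B> \<longleftrightarrow> pairwise_blocks (anti_complete_to G) \<B>"

definition erdos_hajnal :: "nat graph set \<Rightarrow> bool" where
  "erdos_hajnal \<H> \<longleftrightarrow>
     \<H> \<noteq> {} \<and>
     (\<exists>c>0. \<forall>G :: nat graph. simple_graph G \<and> free \<H> G \<longrightarrow>
        (\<exists>X. (clique G X \<or> stable G X) \<and> real (order G) powr c \<le> real (card X)))"

definition leaf_reducible :: "nat graph set \<Rightarrow> bool" where
  "leaf_reducible \<F> \<longleftrightarrow>
     (\<exists>H\<in>\<F>. \<exists>v\<in>verts H. card (nbrs H v) = 1 \<and>
        erdos_hajnal ((\<F> - {H}) \<union> {del_vertex H v}))"

definition wonderful :: "nat graph set \<Rightarrow> bool" where
  "wonderful \<F> \<longleftrightarrow>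
     (\<exists>a\<ge>6. \<forall>y :: real. \<forall>G :: nat graph.
        0 < y \<and> y < 1/2 \<and> simple_graph G \<and> free (complement ` \<F>) G \<longrightarrow>
        (\<forall>(\<B> :: nat set list) (l :: nat) (w :: real).
           length \<B> = l \<and> y powr (-a) \<le> real l \<and> blockade G (real l) w \<B> \<and>
           (\<forall>B\<in>set \<B>. anti_connected G B) \<and>
           (\<forall>B\<in>set \<B>. \<forall>C\<in>set \<B>. card B = card C) \<and>
           pairwise_blocks (\<lambda>B C. complete_to G B C \<or> sparse_pair G (y powr a) B C) \<B> \<longrightarrow>
           (\<exists>X\<subseteq>verts G. restricted G (y ^ 4) X \<and> w \<le> real (card X)) \<or>
           (\<exists>i<l.
              real (card {v \<in> verts G - \<Union> (set \<B>).
                 0 < card (nbrs G v \<inter> \<B> ! i) \<and>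
                 real (card (nbrs G v \<inter> \<B> ! i)) < 1/2 * real (card (\<B> ! i))})
              \<le> y * real (order G))))"

definition generalized_nice :: "nat graph set \<Rightarrow> bool" where
  "generalized_nice \<F> \<longleftrightarrow>
     (\<exists>c1 c2 c3 c4 c5 c6 c7 c8 :: real.
        c1 \<ge> 3 \<and> c2 \<ge> 8 \<and> c3 > 0 \<and> c4 > 0 \<and> c5 > 0 \<and> c6 \<ge> 1 \<and> c7 \<ge> 4 \<and> c8 > 0 \<and>
        (\<forall>(G :: nat graph) (\<epsilon> :: real).
           simple_graph G \<and> free (complement ` \<F>) G \<and> 0 < \<epsilon> \<and> \<epsilon> < 1/2 \<longrightarrow>
           (\<exists>\<B>. blockade G (1 / \<epsilon>) (\<epsilon> powr c1 * real (order G)) \<B> \<and>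
              pairwise_blocks
                (\<lambda>B C. complete_to G B C \<or> weakly_sparse_pair G (\<epsilon> powr c2) B C) \<B>) \<or>
           (\<exists>X. (clique G X \<or> stable G X) \<and>
              (\<epsilon> powr c3 * real (order G)) powr c4 \<le> real (card X)) \<or>
           (\<exists>k\<ge>\<epsilon> powr (-c6). \<exists>\<B>. blockade G k (real (order G) / k powr c5) \<B> \<and>
              (complete_blockade G \<B> \<or> anti_complete_blockade G \<B>)) \<or>
           (\<exists>X\<subseteq>verts G. restricted G (\<epsilon> powr c7) X \<and>
              \<epsilon> powr c8 * real (order G) \<le> real (card X))))"

end

theory Submission
  imports Defs
begin

text \<open>
  Write \<open>homog\<close> for the product of clique number and stability number, and let \<open>G\<close> be a minimal
  counterexample to \<open>|G| powr c \<le> homog G\<close> among the graphs whose complement is \<open>\<F>\<close>-free, with \<open>c\<close>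
  tiny. Since \<open>homog\<close> is superadditive over complete and over anti-complete blocks, \<open>G\<close> contains no
  such family of \<open>k\<close> blocks of size \<open>|G| / k powr O(1)\<close>, and, peeling repeatedly, no \<open>y\<close>-restricted
  set of polynomial size can keep splitting off small sets that are complete or anti-complete to all
  but an \<open>O(y)\<close> fraction of the rest.

  Starting from a constant, \<open>y\<close> is squared again and again, keeping a \<open>y\<close>-restricted set of size at
  least \<open>y powr D * |G|\<close>. If the set is \<open>y\<close>-sparse, niceness with parameter \<open>y powr a\<close> yields a
  blockade, whose blocks can be made equal, pairwise sparse and anti-connected; by wonderfulness some
  block has few mixed vertices, few vertices see half of it by sparsity, and so it is anti-complete to
  almost everything. If the complement is \<open>y\<close>-sparse, then it either has a sparser
  subset or polynomially many copies of \<open>H - v\<close> (the Erdos--Hajnal property of the smaller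
  class self-improves by a Kleitman--Winston count); fixing all vertices of a copy except the
  neighbour of the leaf \<open>v\<close> gives many candidates for that neighbour, and none of them has a
  neighbour outside the few vertices seen by the fixed part. Once \<open>y < |G| powr (- 2 * c)\<close>, Turan's
  bound gives a homogeneous set that is too large.
\<close>

section \<open>Homogeneous sets and minimal counterexamples\<close>

text \<open>The graphs whose complement is \<open>\<F>\<close>-free are in general not closed under
  complementation, so sparse and cosparse sets need two unrelated arguments: wonderfulness serves
  only the first, the leaf only the second. Both end in the same contradiction: a set at which
  peeling is stuck is shown to admit one more peeling step. Squaring \<open>y\<close> turns the size
  bound \<open>y powr D\<close> into \<open>y powr (2 * D)\<close>, which is again the
  \<open>D\<close>-th power of the new parameter. One \<open>D\<close> therefore serves all rounds,
  however many there are, and a round may pay any fixed power of \<open>y\<close> once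
  \<open>D\<close> is large. All constants (\<open>D\<close>, then \<open>e\<close>, then
  \<open>c\<close>) are fixed before the graph. Largeness of the graph is not assumed separately:
  every counterexample satisfies \<open>|G| powr c > 2\<close>, so a small \<open>c\<close> makes
  \<open>|G|\<close> exceed any constant. As long as \<open>y \<ge> |G| powr (- 2 * c)\<close>, the
  choice \<open>c \<le> 1 / (4 * e)\<close> gives \<open>y powr e \<ge> |G| powr (-1/2)\<close>.
  Hence roundings and fixed powers of \<open>y\<close> are harmless, and the remaining square root
  of \<open>|G|\<close> is what refutes the homogeneous outcome of niceness.\<close>

definition co :: "('a \<Rightarrow> 'a \<Rightarrow> bool) \<Rightarrow> 'a \<Rightarrow> 'a \<Rightarrow> bool" where
  "co E u v \<longleftrightarrow> u \<noteq> v \<and> \<not> E u v"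

text \<open>Bare relations with an explicit vertex set replace \<open>graph\<close> records: passing
  to a subset or to the complement then needs no induced graph, and stable sets are the cliques of
  \<open>co E\<close>.\<close>

definition clique_in :: "('a \<Rightarrow> 'a \<Rightarrow> bool) \<Rightarrow> 'a set \<Rightarrow> bool" where
  "clique_in E X \<longleftrightarrow> (\<forall>u\<in>X. \<forall>v\<in>X. u \<noteq> v \<longrightarrow> E u v)"

definition deg :: "('a \<Rightarrow> 'a \<Rightarrow> bool) \<Rightarrow> 'a \<Rightarrow> 'a set \<Rightarrow> nat" where
  "deg E v X = card {u \<in> X. E v u}"

definition sparse_in :: "('a \<Rightarrow> 'a \<Rightarrow> bool) \<Rightarrow> real \<Rightarrow> 'a set \<Rightarrow> bool" where
  "sparse_in E d X \<longleftrightarrow> (\<forall>v\<in>X. real (deg E v X) \<le> d * real (card X))"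

definition restricted_in :: "('a \<Rightarrow> 'a \<Rightarrow> bool) \<Rightarrow> real \<Rightarrow> 'a set \<Rightarrow> bool" where
  "restricted_in E d X \<longleftrightarrow> sparse_in E d X \<or> sparse_in (co E) d X"

definition clique_num :: "('a \<Rightarrow> 'a \<Rightarrow> bool) \<Rightarrow> 'a set \<Rightarrow> nat" where
  "clique_num E S = Max (card ` {X. X \<subseteq> S \<and> clique_in E X})"

text \<open>The product rather than the maximum: over complete blocks the clique numbers add up
  while each stability number is at most that of the union, and dually over anti-complete blocks.
  Returning to a single homogeneous set costs only a square root.\<close>

definition homog :: "('a \<Rightarrow> 'a \<Rightarrow> bool) \<Rightarrow> 'a set \<Rightarrow> nat" where
  "homog E S = clique_num E S * clique_num (co E) S"

text \<open>Disjointness of the blocks is left implicit: a common vertex \<open>x\<close> would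
  satisfy \<open>Q x x\<close>, impossible for the relations \<open>E\<close> and
  \<open>co E\<close> used as \<open>Q\<close>.\<close>

definition pairwise_to :: "('a \<Rightarrow> 'a \<Rightarrow> bool) \<Rightarrow> nat \<Rightarrow> (nat \<Rightarrow> 'a set) \<Rightarrow> bool" where
  "pairwise_to Q k B \<longleftrightarrow> (\<forall>i<k. \<forall>j<k. i \<noteq> j \<longrightarrow> (\<forall>x\<in>B i. \<forall>y\<in>B j. Q x y))"

lemma co_co: "irreflp E \<Longrightarrow> co (co E) = E"
  by (auto simp: co_def fun_eq_iff irreflp_def)

lemma symp_co: "symp E \<Longrightarrow> symp (co E)"
  by (auto simp: co_def symp_def)

lemma irreflp_co: "irreflp (co E)"
  by (auto simp: co_def irreflp_def)

lemma restricted_in_co: "irreflp E \<Longrightarrow> restricted_in (co E) d X \<longleftrightarrow> restricted_in E d X"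
  by (auto simp: restricted_in_def co_co)

lemma deg_mono: "finite Y \<Longrightarrow> X \<subseteq> Y \<Longrightarrow> deg E v X \<le> deg E v Y"
  unfolding deg_def by (rule card_mono) auto

lemma sparse_in_mono: "sparse_in E d X \<Longrightarrow> d \<le> d' \<Longrightarrow> sparse_in E d' X"
  unfolding sparse_in_def by (meson mult_right_mono of_nat_0_le_iff order_trans)

lemma restricted_in_mono: "restricted_in E d X \<Longrightarrow> d \<le> d' \<Longrightarrow> restricted_in E d' X"
  unfolding restricted_in_def using sparse_in_mono by blast

lemma
  assumes "finite S"
  shows clique_num_attained: "\<exists>X\<subseteq>S. clique_in E X \<and> card X = clique_num E S"
    and clique_num_upper: "X \<subseteq> S \<Longrightarrow> clique_in E X \<Longrightarrow> card X \<le> clique_num E S"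
proof -
  have fin: "finite (card ` {X. X \<subseteq> S \<and> clique_in E X})"
    using assms by simp
  have "{} \<in> {X. X \<subseteq> S \<and> clique_in E X}" by (simp add: clique_in_def)
  then have "card ` {X. X \<subseteq> S \<and> clique_in E X} \<noteq> {}" by blast
  from Max_in[OF fin this] show "\<exists>X\<subseteq>S. clique_in E X \<and> card X = clique_num E S"
    unfolding clique_num_def by auto
  show "card X \<le> clique_num E S" if "X \<subseteq> S" "clique_in E X"
    unfolding clique_num_def using fin that by (intro Max_ge) auto
qed

lemma clique_num_mono: "finite T \<Longrightarrow> S \<subseteq> T \<Longrightarrow> clique_num E S \<le> clique_num E T"
  by (metis finite_subset clique_num_attained clique_num_upper order_trans)

lemma clique_num_pos: "finite S \<Longrightarrow> S \<noteq> {} \<Longrightarrow> 1 \<le> clique_num E S"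
proof -
  assume "finite S" "S \<noteq> {}"
  then obtain x where "x \<in> S" by blast
  then show ?thesis
    using clique_num_upper[OF \<open>finite S\<close>, of "{x}" E] by (simp add: clique_in_def)
qed

lemma homog_co: "irreflp E \<Longrightarrow> homog (co E) S = homog E S"
  by (simp add: homog_def co_co mult.commute)

lemma clique_in_card_le_homog:
  assumes "finite S" "X \<subseteq> S" "clique_in E X \<or> clique_in (co E) X"
  shows "card X \<le> homog E S"
proof (cases "S = {}")
  case True
  then show ?thesis using assms by simp
next
  case False
  have "card X \<le> clique_num E S \<or> card X \<le> clique_num (co E) S"
    using assms clique_num_upper by blast
  moreover have "clique_num E S * 1 \<le> homog E S" "1 * clique_num (co E) S \<le> homog E S"
    unfolding homog_def using clique_num_pos[OF assms(1) False] by (intro mult_le_mono; simp)+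
  ultimately show ?thesis by linarith
qed

lemma clique_in_ge_homog:
  assumes "finite S"
  shows "\<exists>X\<subseteq>S. (clique_in E X \<or> clique_in (co E) X) \<and> homog E S \<le> card X ^ 2"
proof -
  obtain X Y where X: "X \<subseteq> S" "clique_in E X" "card X = clique_num E S"
    and Y: "Y \<subseteq> S" "clique_in (co E) Y" "card Y = clique_num (co E) S"
    using clique_num_attained[OF assms] by metis
  show ?thesis
  proof (cases "clique_num E S \<le> clique_num (co E) S")
    case True
    then have "homog E S \<le> card Y ^ 2"
      unfolding homog_def Y(3) power2_eq_square by simp
    then show ?thesis using Y by blast
  next
    case False
    then have "homog E S \<le> card X ^ 2"
      unfolding homog_def X(3) power2_eq_square by simp
    then show ?thesis using X by blast
  qed
qed

lemma two_le_homog: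
  assumes "finite S" "2 \<le> card S" "symp E"
  shows "2 \<le> homog E S"
proof -
  obtain x y where xy: "x \<in> S" "y \<in> S" "x \<noteq> y"
    using assms(2) by (metis card_2_iff' obtain_subset_with_card_n subset_iff)
  have "clique_in E {x, y} \<or> clique_in (co E) {x, y}"
    using assms(3) by (auto simp: clique_in_def co_def symp_def)
  then show ?thesis
    using clique_in_card_le_homog[OF assms(1), of "{x,y}" E] xy by simp
qed

section \<open>Superadditivity of \<open>homog\<close> and peeling\<close>

lemma clique_num_sum:
  assumes fin: "finite V" and B: "\<And>i. i < k \<Longrightarrow> B i \<subseteq> V"
    and irr: "irreflp E" and pw: "pairwise_to E k B"
  shows "(\<Sum>i<k. clique_num E (B i)) \<le> clique_num E V"
proof -
  have "\<forall>i. \<exists>X. i < k \<longrightarrow> X \<subseteq> B i \<and> clique_in E X \<and> card X = clique_num E (B i)"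
    using clique_num_attained[OF finite_subset[OF B fin]] by blast
  then obtain X where X: "\<And>i. i < k \<Longrightarrow> X i \<subseteq> B i \<and> clique_in E (X i) \<and> card (X i) = clique_num E (B i)"
    by metis
  have disj: "B i \<inter> B j = {}" if "i < k" "j < k" "i \<noteq> j" for i j
    using pw irr that unfolding pairwise_to_def irreflp_def by blast
  have "card (\<Union>i<k. X i) = (\<Sum>i<k. card (X i))"
  proof (rule card_UN_disjoint)
    show "\<forall>i\<in>{..<k}. finite (X i)"
      using X B fin by (meson finite_subset lessThan_iff)
    show "\<forall>i\<in>{..<k}. \<forall>j\<in>{..<k}. i \<noteq> j \<longrightarrow> X i \<inter> X j = {}"
      using X disj by (metis Int_mono lessThan_iff subset_empty)
  qed simp
  also have "\<dots> = (\<Sum>i<k. clique_num E (B i))" using X by simp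
  finally have eq: "card (\<Union>i<k. X i) = (\<Sum>i<k. clique_num E (B i))" .
  have "clique_in E (\<Union>i<k. X i)"
    unfolding clique_in_def
  proof (intro ballI impI)
    fix u v assume "u \<in> (\<Union>i<k. X i)" "v \<in> (\<Union>i<k. X i)" "u \<noteq> v"
    then obtain i j where ij: "i < k" "j < k" "u \<in> X i" "v \<in> X j" by auto
    show "E u v"
    proof (cases "i = j")
      case True
      then show ?thesis using X ij \<open>u \<noteq> v\<close> unfolding clique_in_def by blast
    next
      case False
      then show ?thesis using X ij pw unfolding pairwise_to_def by blast
    qed
  qed
  moreover have "(\<Union>i<k. X i) \<subseteq> V" using X B by blast
  ultimately show ?thesis using clique_num_upper[OF fin] eq by metis
qed

lemma homog_sum:
  assumes fin: "finite V" and B: "\<And>i. i < k \<Longrightarrow> B i \<subseteq> V"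
    and irr: "irreflp E" and pw: "pairwise_to E k B"
  shows "(\<Sum>i<k. homog E (B i)) \<le> homog E V"
proof -
  have "(\<Sum>i<k. homog E (B i)) \<le> (\<Sum>i<k. clique_num E (B i) * clique_num (co E) V)"
    unfolding homog_def by (intro sum_mono mult_left_mono clique_num_mono fin B) auto
  also have "\<dots> = (\<Sum>i<k. clique_num E (B i)) * clique_num (co E) V"
    by (simp add: sum_distrib_right)
  also have "\<dots> \<le> homog E V"
    unfolding homog_def by (intro mult_right_mono clique_num_sum assms) auto
  finally show ?thesis .
qed

text \<open>Greedy extraction: \<open>T\<close> keeps the vertices that are \<open>Q\<close>-related
  to all earlier blocks, so every block found inside \<open>T\<close> fits. A round costs at most
  \<open>\<delta> * card S\<close> vertices, and \<open>k * \<delta> \<le> 1/2\<close> keeps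
  \<open>T\<close> above half of \<open>S\<close>, where \<open>step\<close> still applies.\<close>

lemma peel:
  fixes w \<delta> :: real
  assumes fin: "finite S" and sym: "symp Q"
    and step: "\<And>T. T \<subseteq> S \<Longrightarrow> card S \<le> 2 * card T \<Longrightarrow>
      \<exists>A B. A \<subseteq> T \<and> B \<subseteq> T \<and> (\<forall>x\<in>A. \<forall>y\<in>B. Q x y) \<and> w \<le> card A \<and>
        real (card (T - B)) \<le> \<delta> * card S"
    and k: "real k * \<delta> \<le> 1/2" and \<delta>: "0 \<le> \<delta>"
  shows "\<exists>B. (\<forall>i<k. B i \<subseteq> S \<and> w \<le> card (B i)) \<and> pairwise_to Q k B"
proof -
  have "j \<le> k \<Longrightarrow> \<exists>B T. T \<subseteq> S \<and> (1 - real j * \<delta>) * card S \<le> card T \<and>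
      (\<forall>i<j. B i \<subseteq> S \<and> w \<le> card (B i)) \<and> pairwise_to Q j B \<and>
      (\<forall>i<j. \<forall>x\<in>B i. \<forall>y\<in>T. Q x y)" for j
  proof (induction j)
    case 0
    show ?case
      by (intro exI[of _ "\<lambda>_. {}"] exI[of _ S]) (simp add: pairwise_to_def)
  next
    case (Suc j)
    then have "j \<le> k" by simp
    from Suc.IH[OF this] obtain B T where BT: "T \<subseteq> S" "(1 - real j * \<delta>) * card S \<le> card T"
      "\<forall>i<j. B i \<subseteq> S \<and> w \<le> card (B i)" "pairwise_to Q j B"
      "\<forall>i<j. \<forall>x\<in>B i. \<forall>y\<in>T. Q x y" by metis
    have "real j * \<delta> \<le> real k * \<delta>"
      using Suc.prems \<delta> by (intro mult_right_mono) auto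
    then have "1/2 * real (card S) \<le> (1 - real j * \<delta>) * card S"
      using k by (intro mult_right_mono) auto
    then have "card S \<le> 2 * card T" using BT(2) by linarith
    then obtain A C where AC: "A \<subseteq> T" "C \<subseteq> T" "\<forall>x\<in>A. \<forall>y\<in>C. Q x y" "w \<le> card A"
      "real (card (T - C)) \<le> \<delta> * card S" using step BT(1) by meson
    have finT: "finite T" using fin BT(1) finite_subset by blast
    have "card T \<le> card C + card (T - C)"
      using AC(2) finT by (metis card_Diff_subset finite_subset le_add_diff_inverse nle_le card_mono)
    then have cC: "(1 - real (Suc j) * \<delta>) * card S \<le> card C"
      using BT(2) AC(5) by (simp add: algebra_simps)
    define B' where "B' = B(j := A)"
    have "pairwise_to Q (Suc j) B'"
      unfolding pairwise_to_def
    proof (intro allI impI ballI)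
      fix i l x y assume il: "i < Suc j" "l < Suc j" "i \<noteq> l" and xy: "x \<in> B' i" "y \<in> B' l"
      consider "i < j" "l < j" | "i = j" "l < j" | "i < j" "l = j"
        using il by linarith
      then show "Q x y"
      proof cases
        case 1
        then show ?thesis using BT(4) il xy unfolding B'_def pairwise_to_def by auto
      next
        case 2
        then have "Q y x" using BT(5) AC(1) xy unfolding B'_def by auto
        then show ?thesis using sym by (meson sympD)
      next
        case 3
        then show ?thesis using BT(5) AC(1) xy unfolding B'_def by auto
      qed
    qed
    moreover have "\<forall>i<Suc j. B' i \<subseteq> S \<and> w \<le> card (B' i)"
      using BT(1,3) AC(1,4) unfolding B'_def by (auto simp: less_Suc_eq)
    moreover have "\<forall>i<Suc j. \<forall>x\<in>B' i. \<forall>y\<in>C. Q x y"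
      using BT(5) AC(2,3) unfolding B'_def by (auto simp: less_Suc_eq)
    moreover have "C \<subseteq> S" using AC(2) BT(1) by blast
    ultimately show ?case using cC by (intro exI[of _ B'] exI[of _ C] conjI)
  qed
  from this[of k] show ?thesis by blast
qed

text \<open>A minimal counterexample to \<open>homog E V \<ge> |V| powr c\<close>.\<close>

locale critical =
  fixes E :: "'a \<Rightarrow> 'a \<Rightarrow> bool" and V :: "'a set" and c :: real
  assumes fin: "finite V" and sym: "symp E" and irr: "irreflp E" and c_pos: "0 < c"
    and homog_less: "real (homog E V) < real (card V) powr c"
    and homog_ge: "\<And>S. S \<subset> V \<Longrightarrow> real (card S) powr c \<le> real (homog E S)"
begin

lemma critical_co: "critical (co E) V c"
  by unfold_locales
    (use fin sym irr c_pos homog_less homog_ge in \<open>auto simp: symp_co irreflp_co homog_co\<close>)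

lemma card_V_pos: "0 < card V"
  using homog_less by (metis card_gt_0_iff fin of_nat_0_le_iff powr_eq_0_iff card_eq_0_iff not_less of_nat_eq_0_iff)

lemma card_V_powr_gt: "2 < real (card V) powr c"
proof -
  have "card V \<noteq> 1"
  proof
    assume "card V = 1"
    moreover have "1 \<le> homog E V"
      unfolding homog_def using clique_num_pos[OF fin] card_V_pos
      by (metis card_gt_0_iff less_numeral_extra(1) mult_le_mono nat_mult_1)
    ultimately show False using homog_less by simp
  qed
  then have "2 \<le> card V" using card_V_pos by linarith
  then have "2 \<le> homog E V" by (rule two_le_homog[OF fin _ sym])
  then show ?thesis using homog_less by linarith
qed

lemma clique_in_less:
  assumes "X \<subseteq> V" "clique_in E X \<or> clique_in (co E) X"
  shows "real (card X) < real (card V) powr c"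
  using clique_in_card_le_homog[OF fin assms] homog_less by linarith

text \<open>Superadditivity against minimality. With at least two nonempty disjoint blocks each
  block is a proper subset of \<open>V\<close>, so \<open>homog_ge\<close> applies to it.\<close>

lemma complete_blocks_bound:
  assumes k: "2 \<le> k" and w: "0 < w" and B: "\<And>i. i < k \<Longrightarrow> B i \<subseteq> V \<and> w \<le> real (card (B i))"
    and pw: "pairwise_to E k B"
  shows "real k * w powr c < real (card V) powr c"
proof -
  have "w powr c \<le> homog E (B i)" if "i < k" for i
  proof -
    obtain j where j: "j < k" "j \<noteq> i"
      using k by (metis One_nat_def Suc_1 less_2_cases_iff less_le_trans zero_neq_one)
    have "B j \<noteq> {}" using B[OF j(1)] w by auto
    moreover have "B i \<inter> B j = {}"
      using pw irr j that unfolding pairwise_to_def irreflp_def by blast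
    ultimately have "B i \<subset> V" using B that j by blast
    then have "real (card (B i)) powr c \<le> homog E (B i)" by (rule homog_ge)
    moreover have "w powr c \<le> real (card (B i)) powr c"
      using B that w c_pos by (intro powr_mono2) auto
    ultimately show ?thesis by linarith
  qed
  then have "real k * w powr c \<le> (\<Sum>i<k. real (homog E (B i)))"
    using sum_mono[of "{..<k}" "\<lambda>_. w powr c" "\<lambda>i. real (homog E (B i))"] by simp
  also have "\<dots> \<le> real (homog E V)"
  proof -
    have "(\<Sum>i<k. homog E (B i)) \<le> homog E V"
      by (rule homog_sum[OF fin _ irr pw]) (use B in blast)
    then have "real (\<Sum>i<k. homog E (B i)) \<le> real (homog E V)" by (rule of_nat_mono)
    then show ?thesis by simp
  qed
  finally show ?thesis using homog_less by linarith
qed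

lemma pure_blocks_bound:
  assumes "2 \<le> k" "0 < w" "\<And>i. i < k \<Longrightarrow> B i \<subseteq> V \<and> w \<le> real (card (B i))"
    and "pairwise_to Q k B" "Q = E \<or> Q = co E"
  shows "real k * w powr c < real (card V) powr c"
proof -
  interpret C: critical "co E" V c by (rule critical_co)
  show ?thesis
    using complete_blocks_bound[of k w B] C.complete_blocks_bound[of k w B] assms by auto
qed

text \<open>The form in which minimality is used: in units of \<open>card V powr c\<close>, the
  number of blocks contributes a factor \<open>x powr (- r)\<close> and their size a factor
  \<open>x powr (g * c)\<close>, which is at least \<open>x powr r\<close> when
  \<open>c * g \<le> r\<close>. Together they reach 1, more than \<open>homog E V\<close>
  allows.\<close>

lemma no_pure_blocks:
  assumes x: "0 < x" "x < 1" and r: "0 < r" and k: "x powr (- r) \<le> real k"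
    and B: "\<And>i. i < k \<Longrightarrow> B i \<subseteq> V \<and> x powr g * real (card V) \<le> real (card (B i))"
    and pw: "pairwise_to Q k B" "Q = E \<or> Q = co E"
    and cg: "c * g \<le> r"
  shows False
proof -
  have "x powr r < 1 powr r" using x r by (intro powr_less_mono2) auto
  then have "x powr r < 1" by simp
  then have "1 < x powr (- r)" using x by (simp add: powr_minus one_less_inverse)
  then have k2: "2 \<le> k" using k by linarith
  define n where "n = real (card V)"
  have n: "0 < n" using card_V_pos by (simp add: n_def)
  have "real k * (x powr g * n) powr c < n powr c"
    unfolding n_def by (rule pure_blocks_bound[OF k2 _ B pw]) (use x card_V_pos in auto)
  then have "real k * x powr (g * c) * n powr c < 1 * n powr c"
    using n x by (simp add: powr_mult powr_powr)
  then have "real k * x powr (g * c) < 1"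
    by (rule mult_right_less_imp_less) simp
  moreover have "x powr (- r) * x powr (g * c) \<le> real k * x powr (g * c)"
    using k by (intro mult_right_mono) auto
  moreover have "1 \<le> x powr (- r) * x powr (g * c)"
  proof -
    have "x powr (- r) * x powr (g * c) = x powr (- (r - g * c))"
      by (simp flip: powr_add)
    also have "\<dots> = inverse (x powr (r - g * c))" by (rule powr_minus)
    finally have "x powr (- r) * x powr (g * c) = inverse (x powr (r - g * c))" .
    moreover have "x powr (r - g * c) \<le> 1"
      using x cg by (intro powr_le1) (auto simp: mult.commute)
    ultimately show ?thesis using x by (simp add: one_le_inverse)
  qed
  ultimately show False by linarith
qed

text \<open>Contrapositive of \<open>peel\<close>: completing \<open>x powr (- r)\<close> rounds,
  rounded up, would contradict \<open>no_pure_blocks\<close>, so the peeling step fails at some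
  \<open>T\<close> that still has half of \<open>S\<close>. The \<open>+ 1\<close> in the condition
  on \<open>\<delta>\<close> pays for the rounding.\<close>

lemma unpeelable_subset:
  assumes S: "S \<subseteq> V" and Q: "Q = E \<or> Q = co E" and x: "0 < x" "x < 1" and r: "0 < r"
    and \<delta>: "0 \<le> \<delta>" "(x powr (- r) + 1) * \<delta> \<le> 1/2" and cg: "c * g \<le> r"
  obtains T where "T \<subseteq> S" "card S \<le> 2 * card T"
    "\<not> (\<exists>A B. A \<subseteq> T \<and> B \<subseteq> T \<and> (\<forall>x\<in>A. \<forall>y\<in>B. Q x y) \<and>
      x powr g * card V \<le> card A \<and> real (card (T - B)) \<le> \<delta> * card S)"
proof (rule ccontr)
  assume "\<not> thesis"
  note found = that
  have step: "\<exists>A B. A \<subseteq> T \<and> B \<subseteq> T \<and> (\<forall>x\<in>A. \<forall>y\<in>B. Q x y) \<and>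
      x powr g * card V \<le> card A \<and> real (card (T - B)) \<le> \<delta> * card S"
    if T: "T \<subseteq> S" "card S \<le> 2 * card T" for T
  proof (rule ccontr)
    assume none: "\<not> ?thesis"
    have thesis by (rule found[OF T none])
    with \<open>\<not> thesis\<close> show False by blast
  qed
  define k where "k = nat \<lceil>x powr (- r)\<rceil>"
  have k: "x powr (- r) \<le> real k" "real k \<le> x powr (- r) + 1"
    unfolding k_def by (auto simp: real_nat_ceiling_ge)
  have "real k * \<delta> \<le> (x powr (- r) + 1) * \<delta>" using k \<delta> by (intro mult_right_mono)
  then have "real k * \<delta> \<le> 1/2" using \<delta> by linarith
  moreover have "finite S" using S fin finite_subset by blast
  moreover have "symp Q" using Q sym symp_co by blast
  ultimately obtain B where B: "\<forall>i<k. B i \<subseteq> S \<and> x powr g * card V \<le> card (B i)" "pairwise_to Q k B"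
    using peel[of S Q "x powr g * card V" \<delta> k, OF _ _ step] \<delta>(1) by blast
  show False
    by (rule no_pure_blocks[OF x r k(1) _ B(2) Q cg]) (use B S in auto)
qed

end

text \<open>Greedy choice: putting a vertex into \<open>Y\<close> deletes its closed neighbourhood,
  at most \<open>d + 1\<close> vertices.\<close>

lemma turan_bound:
  fixes d :: real
  assumes "finite X" and "symp E" and "\<And>v. v \<in> X \<Longrightarrow> real (deg E v X) \<le> d" and d: "0 \<le> d"
  shows "\<exists>Y\<subseteq>X. clique_in (co E) Y \<and> real (card X) \<le> (d + 1) * real (card Y)"
  using assms(1,3)
proof (induction X rule: finite_psubset_induct)
  case (psubset X)
  show ?case
  proof (cases "X = {}")
    case True
    then show ?thesis by (simp add: clique_in_def)
  next
    case False
    then obtain v where v: "v \<in> X" by blast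
    define X' where "X' = X - insert v {u\<in>X. E v u}"
    have X': "X' \<subset> X" using v by (auto simp: X'_def)
    have "real (deg E u X') \<le> d" if "u \<in> X'" for u
      using psubset.prems[of u] deg_mono[of X X' E u] that X' psubset.hyps by fastforce
    from psubset.IH[OF X' this] obtain Y where Y: "Y \<subseteq> X'" "clique_in (co E) Y"
      "real (card X') \<le> (d + 1) * real (card Y)" by blast
    have "v \<notin> Y" using Y(1) by (auto simp: X'_def)
    have finY: "finite Y" using Y(1) X' psubset.hyps by (meson finite_subset psubset_imp_subset)
    have "card X \<le> card X' + card (insert v {u\<in>X. E v u})"
    proof -
      have "X \<subseteq> X' \<union> insert v {u\<in>X. E v u}" by (auto simp: X'_def)
      then have "card X \<le> card (X' \<union> insert v {u\<in>X. E v u})"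
        using psubset.hyps X' by (intro card_mono) (auto intro: finite_subset)
      then show ?thesis using card_Un_le order_trans by blast
    qed
    moreover have "card (insert v {u\<in>X. E v u}) \<le> deg E v X + 1"
      unfolding deg_def by (simp add: card_insert_le_m1 card_insert_if psubset.hyps)
    ultimately have "real (card X) \<le> real (card X') + d + 1"
      using psubset.prems[OF v] by linarith
    also have "\<dots> \<le> (d + 1) * real (card (insert v Y))"
      using Y(3) \<open>v \<notin> Y\<close> finY by (simp add: algebra_simps)
    finally have "real (card X) \<le> (d + 1) * real (card (insert v Y))" .
    moreover have "clique_in (co E) (insert v Y)"
      using Y(1,2) \<open>symp E\<close> unfolding clique_in_def X'_def co_def symp_def by blast
    ultimately show ?thesis using Y(1) X' v by (intro exI[of _ "insert v Y"]) auto
  qed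
qed

section \<open>Counting stable sets\<close>

lemma card_supersets_le:
  assumes "finite T" "Z \<subseteq> T" "card Z \<le> m"
  shows "card {U. U \<subseteq> T \<and> card U = m \<and> Z \<subseteq> U} \<le> (card T - card Z) choose (m - card Z)"
proof -
  let ?A = "{U. U \<subseteq> T \<and> card U = m \<and> Z \<subseteq> U}"
  let ?B = "{U. U \<subseteq> T - Z \<and> card U = m - card Z}"
  have "inj_on (\<lambda>U. U - Z) ?A" by (rule inj_onI) blast
  moreover have "(\<lambda>U. U - Z) ` ?A \<subseteq> ?B"
    using assms by (auto simp: card_Diff_subset finite_subset)
  ultimately have "card ?A \<le> card ?B"
    using assms(1) by (intro card_inj_on_le) auto
  also have "\<dots> = (card T - card Z) choose (m - card Z)"
    using assms by (simp add: n_subsets card_Diff_subset finite_subset)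
  finally show ?thesis .
qed

text \<open>The proportion of \<open>m\<close>-subsets containing a given \<open>s\<close>-set is
  the product of the fractions \<open>(m - i) / (M - i)\<close> for \<open>i < s\<close>, each at
  most \<open>m / M\<close>. Multiplied out to stay in the natural numbers.\<close>

lemma choose_ratio_le:
  assumes "s \<le> m" "m \<le> M"
  shows "((M - s) choose (m - s)) * M ^ s \<le> m ^ s * (M choose m)"
  using assms(1)
proof (induction s)
  case 0
  then show ?case by simp
next
  case (Suc s)
  have eq: "(m - s) * ((M - s) choose (m - s)) = (M - s) * ((M - Suc s) choose (m - Suc s))"
    using times_binomial_minus1_eq[of "m - s" "M - s"] Suc.prems by simp
  have pos: "0 < M - s" using Suc.prems assms(2) by simp
  have ratio: "(m - s) * M \<le> m * (M - s)"
  proof -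
    have "m * s \<le> s * M" using assms(2) by (simp add: mult.commute)
    then show ?thesis by (simp add: diff_mult_distrib diff_mult_distrib2 mult.commute diff_le_mono2)
  qed
  have "(M - s) * (((M - Suc s) choose (m - Suc s)) * M ^ Suc s)
      = ((M - s) * ((M - Suc s) choose (m - Suc s))) * (M * M ^ s)"
    by (simp only: power_Suc ac_simps)
  also have "\<dots> = (m - s) * M * (((M - s) choose (m - s)) * M ^ s)"
    by (simp only: eq[symmetric] ac_simps)
  also have "\<dots> \<le> m * (M - s) * (m ^ s * (M choose m))"
    by (rule mult_le_mono[OF ratio Suc.IH]) (use Suc.prems in simp)
  also have "\<dots> = (M - s) * (m ^ Suc s * (M choose m))" by simp
  finally show ?case using pos by simp
qed

lemma card_hitting_le:
  assumes fin: "finite T" and C: "\<And>Z. Z \<in> \<C> \<Longrightarrow> Z \<subseteq> T \<and> card Z = s" and m: "m \<le> card T"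
  shows "card {U. U \<subseteq> T \<and> card U = m \<and> (\<exists>Z\<in>\<C>. Z \<subseteq> U)} * card T ^ s
    \<le> card \<C> * (m ^ s * (card T choose m))"
proof (cases "s \<le> m")
  case False
  have "{U. U \<subseteq> T \<and> card U = m \<and> (\<exists>Z\<in>\<C>. Z \<subseteq> U)} = {}"
  proof (rule equals0I)
    fix U assume "U \<in> {U. U \<subseteq> T \<and> card U = m \<and> (\<exists>Z\<in>\<C>. Z \<subseteq> U)}"
    then obtain Z where "Z \<in> \<C>" "Z \<subseteq> U" "U \<subseteq> T" "card U = m" by blast
    then show False
      using False C[of Z] fin card_mono[of U Z] by (auto intro: finite_subset)
  qed
  then show ?thesis by (simp only: card.empty)
next
  case True
  have finC: "finite \<C>" using C fin by (intro finite_subset[of \<C> "Pow T"]) auto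
  have "{U. U \<subseteq> T \<and> card U = m \<and> (\<exists>Z\<in>\<C>. Z \<subseteq> U)} = (\<Union>Z\<in>\<C>. {U. U \<subseteq> T \<and> card U = m \<and> Z \<subseteq> U})"
    by auto
  then have "card {U. U \<subseteq> T \<and> card U = m \<and> (\<exists>Z\<in>\<C>. Z \<subseteq> U)}
      \<le> (\<Sum>Z\<in>\<C>. card {U. U \<subseteq> T \<and> card U = m \<and> Z \<subseteq> U})"
    using card_UN_le[OF finC] by simp
  also have "\<dots> \<le> (\<Sum>Z\<in>\<C>. (card T - s) choose (m - s))"
  proof (rule sum_mono)
    fix Z assume "Z \<in> \<C>"
    then show "card {U. U \<subseteq> T \<and> card U = m \<and> Z \<subseteq> U} \<le> (card T - s) choose (m - s)"
      using card_supersets_le[OF fin, of Z m] C[of Z] True by simp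
  qed
  finally have "card {U. U \<subseteq> T \<and> card U = m \<and> (\<exists>Z\<in>\<C>. Z \<subseteq> U)} * card T ^ s
      \<le> card \<C> * ((card T - s) choose (m - s)) * card T ^ s"
    by (intro mult_right_mono) auto
  also have "\<dots> \<le> card \<C> * (m ^ s * (card T choose m))"
    using choose_ratio_le[OF True m] by (simp add: mult.assoc)
  finally show ?thesis .
qed

text \<open>The independence polynomial of \<open>U\<close>, that is, the hard-core partition
  function at fugacity \<open>l\<close>. The stable sets of size \<open>t\<close> are read off by
  comparing with their weight \<open>l ^ t\<close>.\<close>

definition stable_sum :: "('a \<Rightarrow> 'a \<Rightarrow> bool) \<Rightarrow> real \<Rightarrow> 'a set \<Rightarrow> real" where
  "stable_sum E l U = (\<Sum>I\<in>{I. I \<subseteq> U \<and> clique_in (co E) I}. l ^ card I)"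

text \<open>A stable set either avoids \<open>v\<close>, or is \<open>v\<close> together with a
  stable set outside the closed neighbourhood of \<open>v\<close>.\<close>

lemma stable_sum_step:
  assumes "finite U" "v \<in> U" "0 \<le> l"
  shows "stable_sum E l U \<le> stable_sum E l (U - {v}) + l * stable_sum E l (U - insert v {u\<in>U. E v u})"
proof -
  let ?U' = "U - insert v {u\<in>U. E v u}"
  let ?A = "{I. I \<subseteq> U - {v} \<and> clique_in (co E) I}" and ?B = "{I. I \<subseteq> ?U' \<and> clique_in (co E) I}"
  have sub: "{I. I \<subseteq> U \<and> clique_in (co E) I} \<subseteq> ?A \<union> insert v ` ?B"
  proof
    fix I assume "I \<in> {I. I \<subseteq> U \<and> clique_in (co E) I}"
    then have I: "I \<subseteq> U" "clique_in (co E) I" by auto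
    show "I \<in> ?A \<union> insert v ` ?B"
    proof (cases "v \<in> I")
      case True
      have "I - {v} \<in> ?B" using I True by (auto simp: clique_in_def co_def)
      then have "insert v (I - {v}) \<in> insert v ` ?B" by blast
      then show ?thesis using True by (simp add: insert_absorb)
    next
      case False
      then show ?thesis using I by auto
    qed
  qed
  have fin: "finite ?A" "finite ?B" using assms(1) by auto
  have "stable_sum E l U \<le> (\<Sum>I\<in>?A \<union> insert v ` ?B. l ^ card I)"
    unfolding stable_sum_def by (rule sum_mono2[OF _ sub]) (use fin assms(3) in auto)
  also have "\<dots> \<le> (\<Sum>I\<in>?A. l ^ card I) + (\<Sum>I\<in>insert v ` ?B. l ^ card I)"
    by (subst sum.union_inter[symmetric])
      (use fin assms(3) in \<open>auto intro!: sum_nonneg\<close>)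
  also have "(\<Sum>I\<in>insert v ` ?B. l ^ card I) = (\<Sum>I\<in>?B. l ^ card (insert v I))"
    by (subst sum.reindex) (auto intro!: inj_onI)
  also have "\<dots> = (\<Sum>I\<in>?B. l * l ^ card I)"
  proof (rule sum.cong)
    fix I assume "I \<in> ?B"
    then have "v \<notin> I" "finite I" using assms(1) by (auto intro: finite_subset)
    then show "l ^ card (insert v I) = l * l ^ card I" by simp
  qed simp
  finally show ?thesis unfolding stable_sum_def by (simp add: sum_distrib_left)
qed

lemma stable_sum_mono:
  assumes "finite U" "U' \<subseteq> U" "0 \<le> l"
  shows "stable_sum E l U' \<le> stable_sum E l U"
  unfolding stable_sum_def using assms by (intro sum_mono2) auto

lemma stable_sum_le_power:
  assumes "finite U" "0 \<le> l"
  shows "stable_sum E l U \<le> (1 + l) ^ card U"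
  using assms(1)
proof (induction U)
  case empty
  have "{I. I \<subseteq> {} \<and> clique_in (co E) I} = {{}}" by (auto simp: clique_in_def)
  then show ?case by (simp add: stable_sum_def)
next
  case (insert v U)
  have "stable_sum E l (insert v U) \<le> stable_sum E l U
      + l * stable_sum E l (insert v U - insert v {u\<in>insert v U. E v u})"
    using stable_sum_step[of "insert v U" v l E] insert assms(2) by simp
  also have "\<dots> \<le> stable_sum E l U + l * stable_sum E l U"
    using insert assms(2) by (intro add_left_mono mult_left_mono stable_sum_mono) auto
  also have "\<dots> \<le> (1 + l) * (1 + l) ^ card U"
    using insert.IH assms(2) by (simp add: distrib_right mult_left_mono add_mono)
  finally show ?case using insert by simp
qed

text \<open>The Kleitman--Winston argument, run on the partition function of the hard-core model so that
  the branching recursion closes up without binomial coefficients: as long as more than \<open>W\<close>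
  candidates remain, each vertex put into the stable set removes a fraction \<open>\<epsilon>\<close> of them.\<close>

lemma stable_sum_le:
  fixes \<epsilon> l :: real
  assumes "finite U" and l: "0 \<le> l" and \<epsilon>: "0 \<le> \<epsilon>" "\<epsilon> < 1"
    and dense: "\<And>U'. U' \<subseteq> U \<Longrightarrow> W < card U' \<Longrightarrow> \<not> sparse_in E \<epsilon> U'"
    and \<rho>: "(1 - \<epsilon>) ^ \<rho> * card U \<le> real W"
    and irr: "irreflp E"
  shows "stable_sum E l U \<le> (1 + l) ^ W * (1 + l * card U) ^ \<rho>"
  using assms(1,5,6)
proof (induction U arbitrary: \<rho> rule: finite_psubset_induct)
  case (psubset U)
  show ?case
  proof (cases "W < card U")
    case False
    have "stable_sum E l U \<le> (1 + l) ^ card U"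
      by (rule stable_sum_le_power[OF psubset.hyps l])
    also have "\<dots> \<le> (1 + l) ^ W * 1"
      using False l by (simp add: power_increasing)
    also have "\<dots> \<le> (1 + l) ^ W * (1 + l * card U) ^ \<rho>"
      using l by (intro mult_left_mono one_le_power) auto
    finally show ?thesis .
  next
    case True
    \<comment> \<open>For \<open>\<rho> = 0\<close> the hypothesis would read
      \<open>card U \<le> W\<close>.\<close>
    then obtain \<sigma> where \<sigma>: "\<rho> = Suc \<sigma>"
      using psubset.prems(2) by (cases \<rho>) auto
    obtain v where v: "v \<in> U" "\<epsilon> * card U < real (deg E v U)"
      using psubset.prems(1)[OF order.refl True] unfolding sparse_in_def by force
    define U1 where "U1 = U - {v}"
    define U2 where "U2 = U - insert v {u\<in>U. E v u}"
    have sub: "U1 \<subset> U" "U2 \<subset> U" "U2 \<subseteq> U1" using v(1) by (auto simp: U1_def U2_def)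
    have c1: "real (card U1) = real (card U) - 1"
      using card_Suc_Diff1[OF psubset.hyps v(1)] by (simp add: U1_def)
    have c12: "card U2 \<le> card U1"
      using sub psubset.hyps by (intro card_mono) (auto intro: finite_subset)
    have "card {u\<in>U. E v u} + card U2 \<le> card U"
    proof -
      have "card ({u\<in>U. E v u} \<union> U2) \<le> card U"
        using psubset.hyps by (intro card_mono) (auto simp: U2_def)
      moreover have "card ({u\<in>U. E v u} \<union> U2) = card {u\<in>U. E v u} + card U2"
        using psubset.hyps by (intro card_Un_disjoint) (auto simp: U2_def)
      ultimately show ?thesis by simp
    qed
    then have c2: "real (card U2) \<le> (1 - \<epsilon>) * card U"
      using v(2) unfolding deg_def by (simp add: algebra_simps)
    \<comment> \<open>Leaving \<open>v\<close> out keeps the budget \<open>\<rho>\<close>; taking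
      \<open>v\<close> spends one unit, since \<open>U2\<close> has lost a fraction
      \<open>\<epsilon>\<close> of the candidates.\<close>
    have ih1: "stable_sum E l U1 \<le> (1 + l) ^ W * (1 + l * card U1) ^ \<rho>"
    proof (rule psubset.IH[OF sub(1)])
      show "(1 - \<epsilon>) ^ \<rho> * card U1 \<le> real W"
      proof -
        have "(1 - \<epsilon>) ^ \<rho> * card U1 \<le> (1 - \<epsilon>) ^ \<rho> * card U"
          using c1 \<epsilon> by (intro mult_left_mono) auto
        then show ?thesis using psubset.prems(2) by linarith
      qed
      show "\<not> sparse_in E \<epsilon> U'" if "U' \<subseteq> U1" "W < card U'" for U'
        using that sub psubset.prems(1) by blast
    qed
    have ih2: "stable_sum E l U2 \<le> (1 + l) ^ W * (1 + l * card U2) ^ \<sigma>"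
    proof (rule psubset.IH[OF sub(2)])
      have "(1 - \<epsilon>) ^ \<sigma> * card U2 \<le> (1 - \<epsilon>) ^ \<sigma> * ((1 - \<epsilon>) * card U)"
        using c2 \<epsilon> by (intro mult_left_mono) auto
      then show "(1 - \<epsilon>) ^ \<sigma> * card U2 \<le> real W"
        using psubset.prems(2) \<sigma> by (simp add: mult.assoc mult.commute mult.left_commute)
      show "\<not> sparse_in E \<epsilon> U'" if "U' \<subseteq> U2" "W < card U'" for U'
        using that sub psubset.prems(1) by blast
    qed
    have "(1 + l * card U2) ^ \<sigma> \<le> (1 + l * card U1) ^ \<sigma>"
      using c12 l by (intro power_mono add_left_mono mult_left_mono) auto
    then have ih2': "stable_sum E l U2 \<le> (1 + l) ^ W * (1 + l * card U1) ^ \<sigma>"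
    proof -
      have "(1 + l) ^ W * (1 + l * card U2) ^ \<sigma> \<le> (1 + l) ^ W * (1 + l * card U1) ^ \<sigma>"
        if "(1 + l * card U2) ^ \<sigma> \<le> (1 + l * card U1) ^ \<sigma>"
        using that l by (intro mult_left_mono) auto
      then show ?thesis using ih2 \<open>(1 + l * card U2) ^ \<sigma> \<le> _\<close> by linarith
    qed
    have "stable_sum E l U \<le> stable_sum E l U1 + l * stable_sum E l U2"
      unfolding U1_def U2_def by (rule stable_sum_step[OF psubset.hyps v(1) l])
    also have "\<dots> \<le> (1 + l) ^ W * (1 + l * card U1) ^ \<rho> + l * ((1 + l) ^ W * (1 + l * card U1) ^ \<sigma>)"
      using ih1 ih2' l by (intro add_mono mult_left_mono) auto
    \<comment> \<open>The branches combine exactly: after taking out the common power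
      \<open>\<sigma>\<close>, the rest is \<open>(1 + l * card U1) + l\<close>, which equals
      \<open>1 + l * card U\<close> because \<open>U\<close> has one vertex more than
      \<open>U1\<close>.\<close>
    also have "\<dots> = (1 + l) ^ W * ((1 + l * card U1) ^ \<sigma> * (1 + l * card U))"
    proof -
      have "card U = 1 + real (card U1)" using c1 by simp
      then show ?thesis unfolding \<sigma> power_Suc by (simp only:) (simp add: algebra_simps)
    qed
    also have "\<dots> \<le> (1 + l) ^ W * ((1 + l * card U) ^ \<sigma> * (1 + l * card U))"
      using l c1 by (intro mult_left_mono mult_right_mono power_mono add_left_mono) auto
    finally show ?thesis by (simp add: \<sigma> mult.commute)
  qed
qed

text \<open>The fugacity \<open>t / W\<close> makes \<open>(1 + l) ^ W\<close> at most
  \<open>exp t\<close>, hence at most \<open>3 ^ t\<close>.\<close>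

lemma card_stable_le:
  fixes \<epsilon> :: real
  assumes fin: "finite T" and \<epsilon>: "0 \<le> \<epsilon>" "\<epsilon> < 1"
    and dense: "\<And>U. U \<subseteq> T \<Longrightarrow> W < card U \<Longrightarrow> \<not> sparse_in E \<epsilon> U"
    and \<rho>: "(1 - \<epsilon>) ^ \<rho> * card T \<le> real W"
    and irr: "irreflp E" and W: "0 < W"
  shows "card {I. I \<subseteq> T \<and> clique_in (co E) I \<and> card I = t} * (real t / W) ^ t
    \<le> 3 ^ t * (1 + t / W * card T) ^ \<rho>"
proof -
  let ?l = "real t / W"
  have l: "0 \<le> ?l" by simp
  have "card {I. I \<subseteq> T \<and> clique_in (co E) I \<and> card I = t} * ?l ^ t
      = (\<Sum>I\<in>{I. I \<subseteq> T \<and> clique_in (co E) I \<and> card I = t}. ?l ^ card I)" by simp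
  also have "\<dots> \<le> stable_sum E ?l T"
    unfolding stable_sum_def using fin by (intro sum_mono2) auto
  also have "\<dots> \<le> (1 + ?l) ^ W * (1 + ?l * card T) ^ \<rho>"
    by (rule stable_sum_le[OF fin l \<epsilon> dense \<rho> irr])
  also have "\<dots> \<le> 3 ^ t * (1 + ?l * card T) ^ \<rho>"
  proof (rule mult_right_mono)
    have "(1 + ?l) ^ W \<le> exp ?l ^ W"
      using exp_ge_add_one_self[of ?l] l by (intro power_mono) auto
    also have "\<dots> = exp (real t)" using W by (simp flip: exp_of_nat_mult)
    also have "\<dots> = exp 1 ^ t" by (simp flip: exp_of_nat_mult)
    also have "\<dots> \<le> 3 ^ t" using exp_le by (intro power_mono) auto
    finally show "(1 + ?l) ^ W \<le> 3 ^ t" .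
  qed simp
  finally show ?thesis .
qed

section \<open>From many stable sets to a sparse subset\<close>

lemma powr_nat_power:
  fixes y :: real
  assumes "0 < y"
  shows "(y powr a) ^ n = y powr (a * real n)"
  using assms by (subst powr_realpow[symmetric]) (simp_all add: powr_powr)

lemma powr_antimono:
  fixes y :: real
  assumes "0 < y" "y \<le> 1" "b \<le> a"
  shows "y powr a \<le> y powr b"
  using powr_mono'[OF assms(3), of y] assms by simp

text \<open>If no such subset exists, \<open>card_stable_le\<close> applies with
  \<open>\<epsilon> = y^2\<close> and \<open>W\<close> about \<open>y powr (2 * g) * card T\<close>.
  Against \<open>many\<close> this gives
  \<open>y powr (- g * t) \<le> y powr (- g * (1 + 3 * \<rho>))\<close>, hence
  \<open>t \<le> 1 + 3 * \<rho>\<close>. But \<open>\<rho>\<close> is only of order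
  \<open>y powr (-3)\<close>, while \<open>t\<close> is at least \<open>y powr (-5)\<close>.\<close>

lemma sparse_subset_if_many_stable:
  fixes y g :: real
  assumes y: "0 < y" "y \<le> 1/3" "y\<^sup>2 * (8 + 6 * g) \<le> 1" and g: "1 \<le> g"
    and fin: "finite T" and irr: "irreflp E"
    and t: "y powr (-5) \<le> real t" "3 * real t \<le> y powr (- g)"
    and m: "0 < m" "3 * real m \<le> y powr (- g)"
    and T: "y powr (- 2 * g) \<le> card T"
    and many: "(card T) ^ t \<le> 3 * real m ^ t * card {I. I \<subseteq> T \<and> clique_in (co E) I \<and> card I = t}"
  shows "\<exists>U\<subseteq>T. sparse_in E (y\<^sup>2) U \<and> y powr (2 * g) * card T \<le> card U"
proof (rule ccontr)
  assume neg: "\<not> ?thesis"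
  define M where "M = real (card T)"
  define \<mu> where "\<mu> = y powr (2 * g)"
  define W where "W = nat \<lfloor>\<mu> * M\<rfloor>"
  have \<mu>: "0 < \<mu>" using y by (simp add: \<mu>_def)
  have \<mu>M: "1 \<le> \<mu> * M"
  proof -
    have "\<mu> * y powr (- 2 * g) \<le> \<mu> * M"
      using T \<mu> unfolding M_def by (intro mult_left_mono) auto
    moreover have "\<mu> * y powr (- 2 * g) = 1"
      using y unfolding \<mu>_def by (simp flip: powr_add)
    ultimately show ?thesis by linarith
  qed
  have Mpos: "0 < M" using \<mu>M \<mu> by (smt (verit) mult_nonneg_nonpos)
  have W: "real W \<le> \<mu> * M" "\<mu> * M < real W + 1" "0 < W"
    using \<mu>M unfolding W_def by linarith+
  have W2: "\<mu> * M \<le> 2 * real W" using W by linarith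
  have dense: "\<not> sparse_in E (y\<^sup>2) U" if "U \<subseteq> T" "W < card U" for U
  proof
    assume "sparse_in E (y\<^sup>2) U"
    moreover have "\<mu> * M \<le> card U" using W(2) that(2) by linarith
    ultimately show False using neg that(1) unfolding \<mu>_def M_def by blast
  qed
  \<comment> \<open>Enough rounds for \<open>(1 - y^2) ^ \<rho> \<le> \<mu> / 2\<close>; the factor
    2 covers the rounding in \<open>W\<close>.\<close>
  define \<rho> where "\<rho> = nat \<lceil>ln (2 / \<mu>) / y\<^sup>2\<rceil>"
  have y2: "0 \<le> y\<^sup>2" "y\<^sup>2 < 1" using y by (auto simp: power_less_one_iff)
  have lnb: "ln (2 / \<mu>) \<le> (1 + 2 * g) / y"
  proof -
    have "ln (2 / \<mu>) = ln 2 + 2 * g * ln (1 / y)"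
      using y \<mu> by (simp add: ln_div \<mu>_def ln_powr)
    also have "\<dots> \<le> 1 + 2 * g * (1 / y - 1)"
      using ln_le_minus_one[of "1/y"] ln_le_minus_one[of "2::real"] y g
      by (intro add_mono mult_left_mono) auto
    also have "\<dots> \<le> 1 / y + 2 * g * (1 / y)"
    proof -
      have "1 \<le> 1 / y" using y by simp
      then show ?thesis using g by (simp add: right_diff_distrib)
    qed
    also have "\<dots> = (1 + 2 * g) / y" by (simp add: add_divide_distrib)
    finally show ?thesis .
  qed
  have \<rho>_ge: "ln (2 / \<mu>) / y\<^sup>2 \<le> real \<rho>" unfolding \<rho>_def by (rule real_nat_ceiling_ge)
  have ln0: "0 \<le> ln (2 / \<mu>)"
    using \<mu> y g powr_le1[of "2 * g" y] unfolding \<mu>_def by (intro ln_ge_zero) (auto simp: field_simps)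
  have \<rho>_le: "real \<rho> \<le> ln (2 / \<mu>) / y\<^sup>2 + 1"
  proof -
    have "0 \<le> ln (2 / \<mu>) / y\<^sup>2" using ln0 by simp
    then show ?thesis unfolding \<rho>_def by linarith
  qed
  have \<rho>1: "(1 - y\<^sup>2) ^ \<rho> * card T \<le> real W"
  proof -
    have "(1 - y\<^sup>2) ^ \<rho> \<le> exp (- y\<^sup>2) ^ \<rho>"
      using y2 exp_ge_add_one_self[of "- y\<^sup>2"] by (intro power_mono) auto
    also have "\<dots> = exp (- (y\<^sup>2 * real \<rho>))" by (simp flip: exp_of_nat_mult add: mult.commute)
    also have "\<dots> \<le> exp (- ln (2 / \<mu>))"
      using \<rho>_ge y by (simp add: field_simps)
    also have "\<dots> = \<mu> / 2" using \<mu> by (simp add: exp_minus)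
    finally have "(1 - y\<^sup>2) ^ \<rho> * M \<le> \<mu> / 2 * M" using Mpos by (intro mult_right_mono) auto
    then show ?thesis using W2 unfolding M_def by linarith
  qed
  have tpos: "0 < real t" using t(1) y by (smt (verit) powr_gt_zero)
  have kw: "card {I. I \<subseteq> T \<and> clique_in (co E) I \<and> card I = t} * (real t / W) ^ t
    \<le> 3 ^ t * (1 + t / W * card T) ^ \<rho>"
    by (rule card_stable_le[OF fin y2 dense \<rho>1 irr W(3)])
  define K where "K = real (card {I. I \<subseteq> T \<and> clique_in (co E) I \<and> card I = t})"
  \<comment> \<open>Lower bound for the base of the \<open>t\<close>-th power: each stable vertex
    gains \<open>card T / m\<close> from \<open>many\<close> and \<open>t / (3 * W)\<close> from the
    count.\<close>
  have low: "y powr (- g) \<le> M * t / (3 * W * m)"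
  proof -
    have "y powr (- g) * (3 * W * m) = y powr (- g) * W * (3 * real m)" by simp
    also have "\<dots> \<le> y powr (- g) * W * y powr (- g)"
      using m by (intro mult_left_mono) auto
    also have "\<dots> = y powr (- 2 * g) * W" by (simp flip: powr_add)
    also have "\<dots> \<le> y powr (- 2 * g) * (\<mu> * M)" using W by (intro mult_left_mono) auto
    also have "\<dots> = M" using y unfolding \<mu>_def by (simp flip: powr_add mult.assoc)
    also have "\<dots> \<le> M * t" using tpos Mpos by simp
    finally show ?thesis using W(3) m(1) by (simp add: pos_le_divide_eq)
  qed
  have up: "1 + t / W * M \<le> y powr (- 3 * g)"
  proof -
    have "M / W \<le> 2 / \<mu>" using W2 W(3) \<mu> by (simp add: field_simps)
    then have "t * (M / W) \<le> t * (2 / \<mu>)"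
      using tpos by (intro mult_left_mono) auto
    then have "t / W * M \<le> t * (2 / \<mu>)" by simp
    also have "\<dots> = 2 * t * y powr (- 2 * g)" unfolding \<mu>_def by (simp add: powr_minus field_simps)
    finally have "t / W * M \<le> 2 * t * y powr (- 2 * g)" .
    moreover have "1 \<le> t * y powr (- 2 * g)"
    proof -
      have "1 \<le> y powr (- 2 * g)" using y g by (simp add: powr_minus one_le_inverse powr_le1)
      moreover have "1 \<le> real t" using tpos by simp
      ultimately show ?thesis using mult_mono[of 1 "real t" 1 "y powr (- 2 * g)"] by simp
    qed
    ultimately have "1 + t / W * M \<le> 3 * t * y powr (- 2 * g)" by linarith
    also have "\<dots> \<le> y powr (- g) * y powr (- 2 * g)" using t(2) by (intro mult_right_mono) auto
    also have "\<dots> = y powr (- 3 * g)" by (simp flip: powr_add)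
    finally show ?thesis .
  qed
  have "M ^ t * (real t / W) ^ t \<le> 3 * real m ^ t * (K * (real t / W) ^ t)"
    using many unfolding M_def K_def
    by (simp add: mult_right_mono flip: mult.assoc)
  also have "\<dots> \<le> 3 * real m ^ t * (3 ^ t * (1 + t / W * M) ^ \<rho>)"
    using kw unfolding K_def M_def by (intro mult_left_mono) auto
  finally have main: "M ^ t * (real t / W) ^ t \<le> 3 * (1 + t / W * M) ^ \<rho> * (3 * real m) ^ t"
    by (simp add: power_mult_distrib mult_ac)
  have "(M * t / (3 * W * m)) ^ t = M ^ t * (real t / W) ^ t / (3 * real m) ^ t"
    by (simp add: power_mult_distrib power_divide)
  also have "\<dots> \<le> 3 * (1 + t / W * M) ^ \<rho>"
    using main m(1) by (subst pos_divide_le_eq) auto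
  finally have "(M * t / (3 * W * m)) ^ t \<le> 3 * (1 + t / W * M) ^ \<rho>" .
  moreover have "(y powr (- g)) ^ t \<le> (M * t / (3 * W * m)) ^ t"
    using low by (intro power_mono) auto
  moreover have "(1 + t / W * M) ^ \<rho> \<le> (y powr (- 3 * g)) ^ \<rho>"
    using up Mpos by (intro power_mono) auto
  ultimately have "(y powr (- g)) ^ t \<le> 3 * (y powr (- 3 * g)) ^ \<rho>" by linarith
  also have "\<dots> \<le> y powr (- g) * (y powr (- 3 * g)) ^ \<rho>"
  proof (rule mult_right_mono)
    have "3 \<le> y powr (- 1)" using y by (simp add: powr_minus field_simps)
    also have "\<dots> \<le> y powr (- g)" using y g by (intro powr_antimono) auto
    finally show "3 \<le> y powr (- g)" .
  qed simp
  also have "(y powr (- g)) ^ t = y powr (- g * t)"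
    using y by (simp add: powr_nat_power)
  also have "y powr (- g) * (y powr (- 3 * g)) ^ \<rho> = y powr (- g * (1 + 3 * \<rho>))"
  proof -
    have "(y powr (- 3 * g)) ^ \<rho> = y powr (- 3 * g * \<rho>)"
      using y by (simp add: powr_nat_power)
    then show ?thesis by (simp add: algebra_simps flip: powr_add)
  qed
  finally have "y powr (- g * t) \<le> y powr (- g * (1 + 3 * \<rho>))" .
  then have "\<not> - g * t < - g * (1 + 3 * \<rho>)"
    using powr_less_mono'[of y "- g * t" "- g * (1 + 3 * \<rho>)"] y by linarith
  then have "real t \<le> 1 + 3 * real \<rho>" using g by simp
  also have "\<dots> \<le> 1 + 3 * (((1 + 2 * g) / y) / y\<^sup>2 + 1)"
  proof -
    have "real \<rho> \<le> ((1 + 2 * g) / y) / y\<^sup>2 + 1"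
      by (rule order_trans[OF \<rho>_le add_right_mono[OF divide_right_mono[OF lnb y2(1)]]])
    from mult_left_mono[OF this, of 3] show ?thesis by linarith
  qed
  also have "\<dots> = 4 + (3 + 6 * g) / y ^ 3"
    using y by (simp add: field_simps power2_eq_square power3_eq_cube)
  \<comment> \<open>Origin of \<open>8 + 6 * g\<close> in the hypothesis: the additive 4 is absorbed
    as \<open>5 / y ^ 3\<close>, and one factor \<open>y^2\<close> then pays for the whole
    numerator.\<close>
  also have "\<dots> < (8 + 6 * g) / y ^ 3"
  proof -
    have "y ^ 3 < 1" using y by (simp add: power_less_one_iff)
    then have "4 < 5 / y ^ 3" using y by (simp add: field_simps)
    moreover have "(8 + 6 * g) / y ^ 3 = (3 + 6 * g) / y ^ 3 + 5 / y ^ 3"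
      by (simp add: add_divide_distrib)
    ultimately show ?thesis by linarith
  qed
  also have "\<dots> \<le> 1 / y ^ 5"
  proof -
    have "(8 + 6 * g) / y ^ 3 = (y\<^sup>2 * (8 + 6 * g)) / y ^ 5"
      using y by (simp add: field_simps power2_eq_square eval_nat_numeral)
    then show ?thesis using y by (simp add: divide_right_mono)
  qed
  also have "\<dots> = y powr (- 5)" using y by (simp add: powr_minus field_simps)
  finally show False using t(1) by linarith
qed

section \<open>Abundance of copies\<close>

lemma powr_mult_eq:
  fixes y :: real
  shows "a + b = d \<Longrightarrow> y powr a * y powr b = y powr d"
  by (auto simp: powr_add)

text \<open>If every large set contains a copy or a large homogeneous set, then counting the subsets of
  size \<open>m\<close> by what they contain shows that copies are abundant or that homogeneous sets of size
  \<open>t\<close> are; the latter is impossible when all large subsets are far from restricted.\<close>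

lemma viral:
  fixes c0 :: real and s :: nat
  assumes c0: "0 < c0"
  shows "\<exists>p y1. 1 \<le> p \<and> 0 < y1 \<and> (\<forall>y (E :: 'a \<Rightarrow> 'a \<Rightarrow> bool) T \<C>.
    0 < y \<longrightarrow> y \<le> y1 \<longrightarrow> symp E \<longrightarrow> irreflp E \<longrightarrow> finite T \<longrightarrow> y powr (- p) \<le> card T \<longrightarrow>
    (\<forall>Z\<in>\<C>. Z \<subseteq> T \<and> card Z = s) \<longrightarrow>
    (\<forall>U\<subseteq>T. (\<forall>Z\<in>\<C>. \<not> Z \<subseteq> U) \<longrightarrow>
       (\<exists>X\<subseteq>U. (clique_in E X \<or> clique_in (co E) X) \<and> real (card U) powr c0 \<le> card X)) \<longrightarrow>
    (\<exists>U\<subseteq>T. restricted_in E (y\<^sup>2) U \<and> y powr p * card T \<le> card U) \<or> y powr p * card T ^ s \<le> card \<C>)"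
proof -
  \<comment> \<open>\<open>g\<close> is such that both \<open>3 * t\<close> and \<open>3 * m\<close>
    are at most \<open>y powr (- g)\<close>: they are bounded by \<open>y powr (-7)\<close> and
    \<open>y powr (- (6 / c0 + 2))\<close>. \<open>p\<close> covers the size exponent
    \<open>2 * g\<close> of a sparse subset and the exponent \<open>1 + g * s\<close> of the density
    \<open>1 / (3 * m ^ s)\<close> of copies.\<close>
  define g where "g = 6 / c0 + 7"
  define p where "p = 2 * g + g * s + 1"
  define y1 where "y1 = 1 / (8 + 6 * g)"
  have g: "7 \<le> g" "6 / c0 + 2 \<le> g" using c0 by (auto simp: g_def)
  have p: "2 * g \<le> p" "1 \<le> p" "1 + g * s \<le> p" using g by (auto simp: p_def)
  have y1: "0 < y1" "y1 \<le> 1/3" using g by (auto simp: y1_def field_simps)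
  have main: "(\<exists>U\<subseteq>T. restricted_in E (y\<^sup>2) U \<and> y powr p * card T \<le> card U) \<or> y powr p * card T ^ s \<le> card \<C>"
    if y0: "0 < y" "y \<le> y1" and sym: "symp E" and irr: "irreflp E" and fin: "finite T"
      and T: "y powr (- p) \<le> card T" and C: "\<And>Z. Z \<in> \<C> \<Longrightarrow> Z \<subseteq> T \<and> card Z = s"
      and eh: "\<And>U. U \<subseteq> T \<Longrightarrow> (\<forall>Z\<in>\<C>. \<not> Z \<subseteq> U) \<Longrightarrow>
        \<exists>X\<subseteq>U. (clique_in E X \<or> clique_in (co E) X) \<and> real (card U) powr c0 \<le> card X"
    for y :: real and E :: "'a \<Rightarrow> 'a \<Rightarrow> bool" and T \<C>
  proof -
    have y: "0 < y" "y \<le> 1/3" using y0 y1 by auto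
    have y3: "y\<^sup>2 * (8 + 6 * g) \<le> 1"
    proof -
      have "y\<^sup>2 \<le> 1 * y" unfolding power2_eq_square using y by (intro mult_right_mono) auto
      then have "y\<^sup>2 \<le> y1" using y0 by linarith
      then have "y\<^sup>2 * (8 + 6 * g) \<le> y1 * (8 + 6 * g)" using g by (intro mult_right_mono) auto
      also have "\<dots> = 1" using g by (simp add: y1_def)
      finally show ?thesis .
    qed
    have inv: "1 \<le> y powr (- a)" if "0 \<le> a" for a
      using powr_antimono[of y "- a" 0] y that by simp
    have ym1: "3 \<le> y powr (- 1)" using y by (simp add: powr_minus field_simps)
    have ym2: "6 \<le> y powr (- 2)"
    proof -
      have "y powr (- 1) * y powr (- 1) = y powr (- 2)" by (rule powr_mult_eq) simp
      moreover have "3 * 3 \<le> y powr (- 1) * y powr (- 1)" by (rule mult_mono[OF ym1 ym1]) auto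
      ultimately show ?thesis by linarith
    qed
    \<comment> \<open>\<open>m\<close> is the least size at which a homogeneous set of size
      \<open>m powr c0\<close> is guaranteed to have \<open>t\<close> vertices.\<close>
    define t where "t = nat \<lceil>y powr (- 5)\<rceil>"
    define m where "m = nat \<lceil>real t powr (1 / c0)\<rceil>"
    have t1: "y powr (- 5) \<le> real t" unfolding t_def by (rule real_nat_ceiling_ge)
    have t2: "real t \<le> 2 * y powr (- 5)"
      using inv[of 5] unfolding t_def by linarith
    have t3: "3 * real t \<le> y powr (- g)"
    proof -
      have "3 * real t \<le> 6 * y powr (- 5)" using t2 by linarith
      also have "\<dots> \<le> y powr (- 2) * y powr (- 5)" using ym2 by (intro mult_right_mono) auto
      also have "\<dots> = y powr (- 7)" by (simp flip: powr_add)
      also have "\<dots> \<le> y powr (- g)" using g y by (intro powr_antimono) auto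
      finally show ?thesis .
    qed
    have t4: "real t \<le> y powr (- 6)"
    proof -
      have "real t \<le> y powr (- 1) * y powr (- 5)"
        using t2 mult_right_mono[OF ym1, of "y powr (- 5)"] by (smt (verit) powr_ge_zero)
      also have "\<dots> = y powr (- 6)" by (rule powr_mult_eq) simp
      finally show ?thesis .
    qed
    have tpos: "1 \<le> real t" using t1 inv[of 5] by linarith
    have m1: "real t powr (1 / c0) \<le> real m" unfolding m_def by (rule real_nat_ceiling_ge)
    have m0: "0 < m"
    proof -
      have "1 \<le> real t powr (1 / c0)" using tpos c0 by (simp add: ge_one_powr_ge_zero)
      then show ?thesis using m1 by linarith
    qed
    have m3: "3 * real m \<le> y powr (- g)"
    proof -
      have "real t powr (1 / c0) \<le> (y powr (- 6)) powr (1 / c0)"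
        using t4 c0 by (intro powr_mono2) auto
      also have "\<dots> = y powr (- (6 / c0))" by (simp add: powr_powr)
      finally have "real m \<le> y powr (- (6 / c0)) + 1"
        unfolding m_def using powr_ge_zero[of "real t" "1/c0"] by linarith
      then have "3 * real m \<le> 6 * y powr (- (6 / c0))"
        using inv[of "6 / c0"] c0 by simp
      also have "\<dots> \<le> y powr (- 2) * y powr (- (6 / c0))" using ym2 by (intro mult_right_mono) auto
      also have "\<dots> = y powr (- (6 / c0 + 2))" by (rule powr_mult_eq) simp
      also have "\<dots> \<le> y powr (- g)" using g y by (intro powr_antimono) auto
      finally show ?thesis .
    qed
    have mt: "real t \<le> real m powr c0"
    proof -
      have "(real t powr (1 / c0)) powr c0 \<le> real m powr c0"
        using m1 c0 by (intro powr_mono2) auto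
      then show ?thesis using c0 tpos by (simp add: powr_powr)
    qed
    define M where "M = card T"
    have T2: "y powr (- 2 * g) \<le> card T"
      using T powr_antimono[of y "- p" "- 2 * g"] y p by simp
    have mM: "m \<le> M"
    proof -
      have "y powr (- g) \<le> y powr (- 2 * g)" using y g by (intro powr_antimono) auto
      then show ?thesis using m3 T2 unfolding M_def by linarith
    qed
    define St where "St = {I. I \<subseteq> T \<and> clique_in (co E) I \<and> card I = t}"
    define Cl where "Cl = {I. I \<subseteq> T \<and> clique_in E I \<and> card I = t}"
    define hit where "hit D = {U. U \<subseteq> T \<and> card U = m \<and> (\<exists>Z\<in>D. Z \<subseteq> U)}" for D
    have finhit: "finite (hit D)" for D
      unfolding hit_def using fin by simp
    have cover: "{U. U \<subseteq> T \<and> card U = m} \<subseteq> hit \<C> \<union> (hit St \<union> hit Cl)"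
    proof
      fix U assume "U \<in> {U. U \<subseteq> T \<and> card U = m}"
      then have U: "U \<subseteq> T" "card U = m" by auto
      show "U \<in> hit \<C> \<union> (hit St \<union> hit Cl)"
      proof (cases "\<forall>Z\<in>\<C>. \<not> Z \<subseteq> U")
        case False
        then show ?thesis using U by (auto simp: hit_def)
      next
        case True
        from eh[OF U(1) this] obtain X where X: "X \<subseteq> U" "clique_in E X \<or> clique_in (co E) X"
          "real m powr c0 \<le> card X" using U(2) by blast
        then have "t \<le> card X" using mt by linarith
        then obtain I where I: "I \<subseteq> X" "card I = t" by (meson obtain_subset_with_card_n)
        then have "clique_in E I \<or> clique_in (co E) I" using X(2) unfolding clique_in_def by blast
        then have "I \<in> St \<or> I \<in> Cl" unfolding St_def Cl_def using I X(1) U(1) by blast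
        moreover have "I \<subseteq> U" using I(1) X(1) by blast
        ultimately have "U \<in> hit St \<or> U \<in> hit Cl" unfolding hit_def using U by auto
        then show ?thesis by blast
      qed
    qed
    define N where "N = M choose m"
    have N: "0 < N" using mM by (simp add: N_def)
    have "N = card {U. U \<subseteq> T \<and> card U = m}" unfolding N_def M_def by (simp add: n_subsets[OF fin])
    also have "\<dots> \<le> card (hit \<C> \<union> (hit St \<union> hit Cl))"
      by (rule card_mono[OF _ cover]) (use finhit in auto)
    also have "\<dots> \<le> card (hit \<C>) + (card (hit St) + card (hit Cl))"
      by (meson card_Un_le add_left_mono order_trans)
    \<comment> \<open>Pigeonhole: one of the three families is contained in a third of all
      \<open>m\<close>-subsets. This is the origin of the factor 3 in \<open>many\<close> of
      \<open>sparse_subset_if_many_stable\<close>.\<close>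
    finally have sum3: "N \<le> 3 * card (hit \<C>) \<or> N \<le> 3 * card (hit St) \<or> N \<le> 3 * card (hit Cl)"
      by linarith
    have large: "M ^ r \<le> 3 * m ^ r * card D"
      if D: "\<And>Z. Z \<in> D \<Longrightarrow> Z \<subseteq> T \<and> card Z = r" and "N \<le> 3 * card (hit D)" for D r
    proof -
      have "card (hit D) * M ^ r \<le> card D * (m ^ r * N)"
        unfolding hit_def M_def N_def by (rule card_hitting_le[OF fin D]) (use mM in \<open>auto simp: M_def\<close>)
      moreover have "N * M ^ r \<le> 3 * card (hit D) * M ^ r" using that(2) by (rule mult_right_mono) simp
      ultimately have "N * M ^ r \<le> 3 * (card D * (m ^ r * N))" by linarith
      then have "N * M ^ r \<le> N * (3 * m ^ r * card D)" by (simp only: ac_simps)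
      then show ?thesis using N by simp
    qed
    have p2: "y powr p \<le> y powr (2 * g)" using y p by (intro powr_antimono) auto
    have fromspr: "\<exists>U\<subseteq>T. restricted_in E (y\<^sup>2) U \<and> y powr p * card T \<le> card U"
      if "\<exists>U\<subseteq>T. sparse_in E' (y\<^sup>2) U \<and> y powr (2 * g) * card T \<le> card U" "E' = E \<or> E' = co E" for E'
    proof -
      from that(1) obtain U where U: "U \<subseteq> T" "sparse_in E' (y\<^sup>2) U" "y powr (2 * g) * card T \<le> card U"
        by blast
      have "y powr p * card T \<le> y powr (2 * g) * card T" using p2 by (intro mult_right_mono) auto
      then have "y powr p * card T \<le> card U" using U(3) by linarith
      moreover have "restricted_in E (y\<^sup>2) U" using U(2) that(2) unfolding restricted_in_def by auto
      ultimately show ?thesis using U(1) by auto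
    qed
    have g1: "1 \<le> g" using g by simp
    consider (C) "N \<le> 3 * card (hit \<C>)" | (S) "N \<le> 3 * card (hit St)" | (K) "N \<le> 3 * card (hit Cl)"
      using sum3 by blast
    then show ?thesis
    proof cases
      case S
      have "M ^ t \<le> 3 * m ^ t * card St" by (rule large[OF _ S]) (auto simp: St_def)
      then have "real (M ^ t) \<le> real (3 * m ^ t * card St)" by (rule of_nat_mono)
      then have "\<exists>U\<subseteq>T. sparse_in E (y\<^sup>2) U \<and> y powr (2 * g) * card T \<le> card U"
        unfolding St_def M_def
        by (intro sparse_subset_if_many_stable[OF y y3 g1 fin irr t1 t3 m0 m3 T2]) simp
      from fromspr[OF this] show ?thesis by blast
    next
      case K
      have "M ^ t \<le> 3 * m ^ t * card Cl" by (rule large[OF _ K]) (auto simp: Cl_def)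
      then have "real (M ^ t) \<le> real (3 * m ^ t * card Cl)" by (rule of_nat_mono)
      then have "\<exists>U\<subseteq>T. sparse_in (co E) (y\<^sup>2) U \<and> y powr (2 * g) * card T \<le> card U"
        unfolding Cl_def M_def
        by (intro sparse_subset_if_many_stable[OF y y3 g1 fin irreflp_co t1 t3 m0 m3 T2]) (simp add: co_co[OF irr])
      from fromspr[OF this] show ?thesis by blast
    next
      case C
      have "M ^ s \<le> 3 * m ^ s * card \<C>" by (rule large[OF \<open>\<And>Z. Z \<in> \<C> \<Longrightarrow> _\<close> C])
      then have le: "real M ^ s \<le> 3 * real m ^ s * real (card \<C>)"
        by (metis (mono_tags) of_nat_le_iff of_nat_mult of_nat_numeral of_nat_power)
      have "y powr p * (3 * real m ^ s) \<le> y powr (1 + g * s) * (y powr (- 1) * (y powr (- g)) ^ s)"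
        using p y ym1 m3 by (intro mult_mono powr_antimono power_mono) auto
      also have "\<dots> = 1" using y by (simp add: powr_nat_power flip: powr_add)
      finally have "y powr p * (3 * real m ^ s) * real (card \<C>) \<le> 1 * real (card \<C>)"
        by (rule mult_right_mono) simp
      moreover have "y powr p * real M ^ s \<le> y powr p * (3 * real m ^ s * real (card \<C>))"
        using le by (rule mult_left_mono) simp
      ultimately show ?thesis unfolding M_def by (simp add: mult.assoc)
    qed
  qed
  show ?thesis
    by (intro exI[of _ p] exI[of _ y1] conjI p y1 allI impI) (rule main; blast)
qed

text \<open>Pigeonhole on the rest \<open>Z - {u Z}\<close>: there are at most
  \<open>card T ^ r\<close> rests, so one of them has at least \<open>q * card T\<close> copies in
  its fibre. Within a fibre the copy is determined by its marked vertex, so the marked vertices are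
  distinct.\<close>

lemma many_copies_share_rest:
  assumes fin: "finite T" and C: "\<And>Z. Z \<in> \<C> \<Longrightarrow> Z \<subseteq> T \<and> card Z = Suc r" and u: "\<And>Z. Z \<in> \<C> \<Longrightarrow> u Z \<in> Z"
    and q: "q * real (card T) ^ Suc r \<le> card \<C>" and pos: "0 < card \<C>"
  obtains X A where "X \<subseteq> T" "card X = r" "A \<subseteq> T" "q * card T \<le> card A"
    "\<And>a. a \<in> A \<Longrightarrow> a \<notin> X \<and> insert a X \<in> \<C> \<and> u (insert a X) = a"
proof -
  define F where "F X = {Z\<in>\<C>. Z - {u Z} = X}" for X
  define R where "R = (\<lambda>Z. Z - {u Z}) ` \<C>"
  have finC: "finite \<C>" using pos card_gt_0_iff by blast
  have Z: "finite Z" "u Z \<in> Z" "Z \<subseteq> T" "card Z = Suc r" if "Z \<in> \<C>" for Z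
    using C[OF that] u[OF that] fin by (auto intro: finite_subset)
  have R: "X \<subseteq> T" "card X = r" if "X \<in> R" for X
    using that Z unfolding R_def by auto
  have "R \<subseteq> {X. X \<subseteq> T \<and> card X = r}" using R by blast
  then have "card R \<le> card {X. X \<subseteq> T \<and> card X = r}" using fin by (intro card_mono) auto
  also have "\<dots> = card T choose r" using fin by (simp add: n_subsets)
  also have "\<dots> \<le> card T ^ r"
  proof (cases "r \<le> card T")
    case True
    then show ?thesis by (rule binomial_le_pow)
  qed (simp add: binomial_eq_0)
  finally have cR: "card R \<le> card T ^ r" .
  have finR: "finite R" "R \<noteq> {}" using finC pos by (auto simp: R_def card_gt_0_iff)
  have "\<exists>X\<in>R. q * card T \<le> card (F X)"
  proof (rule ccontr)
    assume "\<not> ?thesis"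
    then have less: "\<And>X. X \<in> R \<Longrightarrow> real (card (F X)) < q * card T" by force
    have "\<C> = (\<Union>X\<in>R. F X)" unfolding R_def F_def by auto
    then have "card \<C> \<le> (\<Sum>X\<in>R. card (F X))" using card_UN_le[OF finR(1)] by metis
    then have "real (card \<C>) \<le> (\<Sum>X\<in>R. real (card (F X)))" by (metis of_nat_mono of_nat_sum)
    also have "\<dots> < (\<Sum>X\<in>R. q * card T)" using less finR by (intro sum_strict_mono) auto
    also have "\<dots> = card R * (q * card T)" by simp
    also have "\<dots> \<le> real (card T ^ r) * (q * card T)"
    proof (rule mult_right_mono)
      \<comment> \<open>Nonnegativity comes from the assumption to be refuted:
        \<open>0 \<le> card (F X) < q * card T\<close>.\<close>
      obtain X where "X \<in> R" using finR by blast
      then show "0 \<le> q * card T" using less[of X] by linarith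
    qed (use cR in simp)
    also have "\<dots> = q * real (card T) ^ Suc r" by simp
    finally show False using q by linarith
  qed
  then obtain X where X: "X \<in> R" "q * card T \<le> card (F X)" by blast
  define A where "A = u ` F X"
  have ins: "insert (u Z) X = Z" if "Z \<in> F X" for Z using that Z(2) unfolding F_def by blast
  have "inj_on u (F X)" by (rule inj_onI) (metis ins)
  then have "card A = card (F X)" unfolding A_def by (rule card_image)
  moreover have "a \<notin> X \<and> insert a X \<in> \<C> \<and> u (insert a X) = a" if a: "a \<in> A" for a
  proof -
    obtain Z where Z': "Z \<in> F X" "a = u Z" using a unfolding A_def by blast
    then have "insert a X = Z" using ins by simp
    moreover have "a \<notin> X" using Z' unfolding F_def by blast
    ultimately show ?thesis using Z' unfolding F_def by auto
  qed
  moreover have "A \<subseteq> T" unfolding A_def F_def using Z(2,3) by blast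
  ultimately show ?thesis using that[of X A] R[OF X(1)] X(2) by metis
qed

section \<open>Cleaning blockades\<close>

text \<open>Connectivity by cuts instead of paths: every nonempty proper part has an edge leaving
  it. Growing and splitting sets is direct in this form; \<open>conn_in_imp_anti_connected\<close>
  returns to paths.\<close>

definition conn_in :: "('a \<Rightarrow> 'a \<Rightarrow> bool) \<Rightarrow> 'a set \<Rightarrow> bool" where
  "conn_in R Y \<longleftrightarrow> Y \<noteq> {} \<and> (\<forall>Z\<subseteq>Y. Z \<noteq> {} \<longrightarrow> Z \<noteq> Y \<longrightarrow> (\<exists>z\<in>Z. \<exists>x\<in>Y - Z. R z x))"

lemma conn_in_insert:
  assumes "conn_in R Y" "symp R" "y \<in> Y" "R y x"
  shows "conn_in R (insert x Y)"
  unfolding conn_in_def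
proof (intro conjI allI impI)
  fix Z assume Z: "Z \<subseteq> insert x Y" "Z \<noteq> {}" "Z \<noteq> insert x Y"
  consider (a) "Z \<inter> Y = {}" | (b) "Z \<inter> Y = Y" | (c) "Z \<inter> Y \<noteq> {}" "Z \<inter> Y \<noteq> Y" by blast
  then show "\<exists>z\<in>Z. \<exists>x\<in>insert x Y - Z. R z x"
  proof cases
    case a
    then have "Z = {x}" "x \<notin> Y" using Z by auto
    then show ?thesis using assms(2-4) by (auto dest: sympD)
  next
    case b
    then have "x \<notin> Z" "Y \<subseteq> Z" using Z by auto
    then show ?thesis using assms(3,4) by blast
  next
    case c
    then obtain z u where "z \<in> Z \<inter> Y" "u \<in> Y - (Z \<inter> Y)" "R z u"
      using assms(1) unfolding conn_in_def by (metis inf_le2)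
    then show ?thesis by blast
  qed
qed simp

text \<open>A connected proper subset can be enlarged by one vertex along an edge leaving it, so all
  sizes are reached.\<close>

lemma conn_in_subset:
  assumes "conn_in R Y" "symp R" "finite Y" "1 \<le> w" "w \<le> card Y"
  shows "\<exists>X\<subseteq>Y. conn_in R X \<and> card X = w"
  using assms(4,5)
proof (induction w rule: nat_induct_at_least)
  case base
  obtain y where "y \<in> Y" using assms(1) by (auto simp: conn_in_def)
  moreover have "conn_in R {y}" by (auto simp: conn_in_def)
  ultimately show ?case by (intro exI[of _ "{y}"]) auto
next
  case (Suc w)
  then obtain X where X: "X \<subseteq> Y" "conn_in R X" "card X = w" by auto
  then have "X \<noteq> {}" "X \<noteq> Y" using Suc.prems by (auto simp: conn_in_def)
  then obtain z x where zx: "z \<in> X" "x \<in> Y - X" "R z x"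
    using assms(1) X(1) unfolding conn_in_def by blast
  have "conn_in R (insert x X)" by (rule conn_in_insert[OF X(2) assms(2) zx(1,3)])
  moreover have "card (insert x X) = Suc w"
    using zx X assms(3) by (simp add: finite_subset)
  ultimately show ?case using X(1) zx by (intro exI[of _ "insert x X"]) auto
qed

text \<open>A smallest union of components of size at least \<open>w\<close> is a single component or has size
  less than \<open>2 w\<close>.\<close>

lemma conn_in_or_small_closed:
  assumes fin: "finite T" and w: "1 \<le> w" "w \<le> card T" and sym: "symp R"
  shows "(\<exists>Y\<subseteq>T. conn_in R Y \<and> card Y = w) \<or>
    (\<exists>A\<subseteq>T. w \<le> card A \<and> card A < 2 * w \<and> (\<forall>x\<in>A. \<forall>y\<in>T - A. \<not> R x y))"
proof -
  let ?P = "\<lambda>A. A \<subseteq> T \<and> w \<le> card A \<and> (\<forall>x\<in>A. \<forall>y\<in>T - A. \<not> R x y)"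
  have "?P T" using w by simp
  then obtain A where A: "?P A" and min: "\<And>A'. ?P A' \<Longrightarrow> card A \<le> card A'"
    using ex_has_least_nat[of ?P T card] by blast
  show ?thesis
  proof (cases "card A < 2 * w")
    case True
    then show ?thesis using A by blast
  next
    case False
    have finA: "finite A" using A fin finite_subset by blast
    have "conn_in R A"
      unfolding conn_in_def
    proof (intro conjI allI impI)
      show "A \<noteq> {}" using A w by auto
      fix Z assume Z: "Z \<subseteq> A" "Z \<noteq> {}" "Z \<noteq> A"
      show "\<exists>z\<in>Z. \<exists>x\<in>A - Z. R z x"
      proof (rule ccontr)
        assume "\<not> ?thesis"
        \<comment> \<open>Both sides of a cut without edges would again be closed in
          \<open>T\<close> and smaller than \<open>A\<close>. By minimality each has fewer than
          \<open>w\<close> vertices, contradicting \<open>2 * w \<le> card A\<close>.\<close>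
        then have sep: "\<And>z x. z \<in> Z \<Longrightarrow> x \<in> A - Z \<Longrightarrow> \<not> R z x" by blast
        have finZ: "finite Z" using finA Z(1) finite_subset by blast
        have "card Z < card A" using Z finA by (intro psubset_card_mono) auto
        moreover have "\<forall>x\<in>Z. \<forall>y\<in>T - Z. \<not> R x y" using sep A Z(1) by blast
        ultimately have 1: "card Z < w" using min[of Z] A Z(1) by (meson not_le order_trans)
        have "A - Z \<subset> A" using Z by blast
        then have "card (A - Z) < card A" using finA by (intro psubset_card_mono)
        moreover have "\<forall>x\<in>A - Z. \<forall>y\<in>T - (A - Z). \<not> R x y"
          using sep A Z(1) sym by (metis DiffE DiffI sympD)
        ultimately have 2: "card (A - Z) < w" using min[of "A - Z"] A by (meson Diff_subset not_le order_trans)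
        have "card A = card Z + card (A - Z)"
          using card_Diff_subset[OF finZ Z(1)] card_mono[OF finA Z(1)] by simp
        then show False using 1 2 False by linarith
      qed
    qed
    from conn_in_subset[OF this sym finA w(1)] obtain Y where "Y \<subseteq> A" "conn_in R Y" "card Y = w"
      using A by blast
    moreover have "Y \<subseteq> T" using \<open>Y \<subseteq> A\<close> A by blast
    ultimately show ?thesis by blast
  qed
qed

text \<open>Otherwise the subset at which peeling by complete sets is stuck contains a small union
  of components of the complement. It is complete to the rest and has fewer than
  \<open>2 * w\<close> vertices, so it is itself a peeling step with
  \<open>\<delta> = 2 * w / card X\<close>.\<close>

lemma (in critical) anti_connected_subset_exists:
  assumes X: "X \<subseteq> V" and w: "1 \<le> w" and x: "0 < x" "x < 1" and r: "0 < r"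
    and size: "(x powr (- r) + 1) * (2 * real w) \<le> real (card X) / 2"
    and wg: "x powr g * card V \<le> real w" and cg: "c * g \<le> r"
  shows "\<exists>Y\<subseteq>X. conn_in (co E) Y \<and> card Y = w"
proof (rule ccontr)
  assume no: "\<not> ?thesis"
  define \<delta> where "\<delta> = 2 * real w / card X"
  have big: "2 * real w \<le> (x powr (- r) + 1) * (2 * real w)" by (simp add: mult_le_cancel_right1)
  have Xpos: "0 < real (card X)" using size big w by linarith
  have \<delta>: "0 \<le> \<delta>" "(x powr (- r) + 1) * \<delta> \<le> 1/2"
    using size Xpos by (auto simp: \<delta>_def field_simps)
  obtain T where T: "T \<subseteq> X" "card X \<le> 2 * card T"
    "\<not> (\<exists>A B. A \<subseteq> T \<and> B \<subseteq> T \<and> (\<forall>x\<in>A. \<forall>y\<in>B. E x y) \<and>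
      x powr g * card V \<le> card A \<and> real (card (T - B)) \<le> \<delta> * card X)"
    by (rule unpeelable_subset[OF X disjI1[OF refl] x r \<delta> cg])
  have finT: "finite T" using T(1) X fin by (meson finite_subset)
  have "w \<le> card T" using T(2) size big by linarith
  moreover have "\<not> (\<exists>Y\<subseteq>T. conn_in (co E) Y \<and> card Y = w)" using no T(1) by blast
  ultimately obtain A where A: "A \<subseteq> T" "w \<le> card A" "card A < 2 * w"
      "\<forall>x\<in>A. \<forall>y\<in>T - A. \<not> co E x y"
    using conn_in_or_small_closed[OF finT w _ symp_co[OF sym]] by blast
  have "\<forall>x\<in>A. \<forall>y\<in>T - A. E x y"
  proof (intro ballI)
    fix x y assume "x \<in> A" "y \<in> T - A"
    moreover from this have "\<not> co E x y" using A(4) by blast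
    ultimately show "E x y" by (auto simp: co_def)
  qed
  moreover have "T - (T - A) = A" using A(1) by blast
  moreover have "real (card A) \<le> \<delta> * card X" using A(3) Xpos by (simp add: \<delta>_def)
  moreover have "x powr g * card V \<le> card A" using wg A(2) by linarith
  ultimately have "A \<subseteq> T \<and> T - A \<subseteq> T \<and> (\<forall>x\<in>A. \<forall>y\<in>T - A. E x y) \<and>
      x powr g * card V \<le> card A \<and> real (card (T - (T - A))) \<le> \<delta> * card X"
    using A(1) by simp
  then show False using T(3) by blast
qed

text \<open>Deleting an element of greatest value never raises the average.\<close>

lemma low_average_subset:
  fixes f :: "'a \<Rightarrow> real"
  assumes "finite B" "1 \<le> w" "w \<le> card B"
  shows "\<exists>C\<subseteq>B. card C = w \<and> sum f C / w \<le> sum f B / card B"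
  using assms(1,3)
proof (induction B rule: finite_psubset_induct)
  case (psubset B)
  show ?case
  proof (cases "card B = w")
    case True
    then show ?thesis by (intro exI[of _ B]) simp
  next
    case False
    then have less: "w < card B" using psubset.prems by simp
    then have "B \<noteq> {}" by auto
    have "Max (f ` B) \<in> f ` B" using psubset.hyps \<open>B \<noteq> {}\<close> by simp
    then obtain x where x: "x \<in> B" "f x = Max (f ` B)" by auto
    have max: "f y \<le> f x" if "y \<in> B" for y using x(2) psubset.hyps that by simp
    have avg: "sum f B \<le> card B * f x" using sum_bounded_above[of B f "f x"] max by simp
    have c: "card (B - {x}) = card B - 1" using x psubset.hyps by simp
    have "w \<le> card (B - {x})" using c less by linarith
    moreover have "B - {x} \<subset> B" using x by blast
    ultimately obtain C where C: "C \<subseteq> B - {x}" "card C = w"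
      "sum f C / w \<le> sum f (B - {x}) / card (B - {x})" using psubset.IH by blast
    have "sum f (B - {x}) / card (B - {x}) \<le> sum f B / card B"
    proof -
      have s: "sum f (B - {x}) = sum f B - f x" using x psubset.hyps by (simp add: sum_diff1)
      have b: "real (card (B - {x})) = real (card B) - 1" "1 < card B"
        using c less assms(2) by (auto simp: of_nat_diff)
      show ?thesis unfolding s b(1) using b(2) avg by (simp add: field_simps)
    qed
    then show ?thesis using C by (intro exI[of _ C]) auto
  qed
qed

section \<open>Edge densities and the trimming of weakly sparse blocks\<close>

definition edge_count :: "('a \<Rightarrow> 'a \<Rightarrow> bool) \<Rightarrow> 'a set \<Rightarrow> 'a set \<Rightarrow> real" where
  "edge_count E X Y = (\<Sum>x\<in>X. real (deg E x Y))"

definition density :: "('a \<Rightarrow> 'a \<Rightarrow> bool) \<Rightarrow> 'a set \<Rightarrow> 'a set \<Rightarrow> real" where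
  "density E X Y = edge_count E X Y / (card X * card Y)"

lemma edge_count_sym:
  assumes "finite X" "finite Y" "symp E"
  shows "edge_count E X Y = edge_count E Y X"
proof -
  have "real (deg E v Z) = (\<Sum>z\<in>Z. if E v z then 1 else 0)" if "finite Z" for v Z
    unfolding deg_def using that by (simp add: sum.If_cases Int_def)
  then have "edge_count E X Y = (\<Sum>x\<in>X. \<Sum>y\<in>Y. if E x y then 1 else 0)"
    "edge_count E Y X = (\<Sum>y\<in>Y. \<Sum>x\<in>X. if E y x then 1 else 0)"
    unfolding edge_count_def using assms by simp_all
  moreover have "E x y \<longleftrightarrow> E y x" for x y using assms(3) by (meson sympD)
  ultimately show ?thesis by (subst (asm) sum.swap) simp
qed

lemma density_sym:
  "finite X \<Longrightarrow> finite Y \<Longrightarrow> symp E \<Longrightarrow> density E X Y = density E Y X"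
  unfolding density_def by (simp add: edge_count_sym mult.commute)

lemma density_nonneg: "0 \<le> density E X Y"
  unfolding density_def edge_count_def by (simp add: sum_nonneg)

text \<open>The total density over the pairs in \<open>P\<close> is a sum over the vertices of each single block,
  so replacing that block by its \<open>w\<close> vertices of least contribution does not increase it.\<close>

lemma equalize:
  fixes k :: nat
  assumes sym: "symp E" and P: "symp P"
    and B: "\<And>i. i < k \<Longrightarrow> finite (B i) \<and> w \<le> card (B i)" and w: "1 \<le> w"
  shows "\<exists>C. (\<forall>i<k. C i \<subseteq> B i \<and> card (C i) = w) \<and>
    (\<Sum>i<k. \<Sum>j<k. if P i j \<and> i \<noteq> j then density E (C i) (C j) else 0) \<le>
    (\<Sum>i<k. \<Sum>j<k. if P i j \<and> i \<noteq> j then density E (B i) (B j) else 0)"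
proof -
  define \<Phi> where "\<Phi> C = (\<Sum>i<k. \<Sum>j<k. if P i j \<and> i \<noteq> j then density E (C i) (C j) else 0)" for C
  have "m \<le> k \<Longrightarrow> \<exists>C. (\<forall>i<k. C i \<subseteq> B i) \<and> (\<forall>i<m. card (C i) = w) \<and> (\<forall>i<k. w \<le> card (C i)) \<and> \<Phi> C \<le> \<Phi> B" for m
  proof (induction m)
    case 0
    then show ?case using B by (intro exI[of _ B]) auto
  next
    case (Suc m)
    then obtain C where C: "\<forall>i<k. C i \<subseteq> B i" "\<forall>i<m. card (C i) = w" "\<forall>i<k. w \<le> card (C i)" "\<Phi> C \<le> \<Phi> B"
      by (meson Suc_leD)
    have m: "m < k" using Suc.prems by simp
    have finC: "finite (C i)" if "i < k" for i using C(1) B that finite_subset by blast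
    define J where "J = {..<k} - {m}"
    \<comment> \<open>\<open>f v\<close> is the contribution of \<open>v\<close> to the densities
      from block \<open>m\<close> to the others: the sum of these densities is the average of
      \<open>f\<close> over the block, as \<open>row\<close> shows. Thus
      \<open>low_average_subset\<close> applies.\<close>
    define f where "f v = (\<Sum>j\<in>J. if P m j then real (deg E v (C j)) / card (C j) else 0)" for v
    obtain X where X: "X \<subseteq> C m" "card X = w" "sum f X / w \<le> sum f (C m) / card (C m)"
      using low_average_subset[OF finC[OF m] w, of f] C(3) m by blast
    have row: "(\<Sum>j\<in>J. if P m j then density E Y (C j) else 0) = sum f Y / card Y" for Y
    proof -
      have "sum f Y = (\<Sum>j\<in>J. \<Sum>v\<in>Y. if P m j then real (deg E v (C j)) / card (C j) else 0)"
        unfolding f_def by (rule sum.swap)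
      also have "\<dots> = (\<Sum>j\<in>J. if P m j then edge_count E Y (C j) / card (C j) else 0)"
        by (intro sum.cong refl) (simp add: edge_count_def sum_divide_distrib)
      finally show ?thesis
        by (simp add: sum_divide_distrib density_def if_distrib[of "\<lambda>x. x / _"] mult.commute cong: if_cong)
    qed
    define R where "R = (\<Sum>i\<in>J. \<Sum>j\<in>J. if P i j \<and> i \<noteq> j then density E (C i) (C j) else 0)"
    \<comment> \<open>The sum runs over ordered pairs, so by symmetry block \<open>m\<close>
      contributes twice; \<open>R\<close> collects the pairs not involving it.\<close>
    have split: "\<Phi> (C(m := Y)) = R + 2 * (sum f Y / card Y)" if Y: "finite Y" for Y
    proof -
      let ?C = "C(m := Y)"
      let ?d = "\<lambda>i j. if P i j \<and> i \<noteq> j then density E (?C i) (?C j) else 0"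
      have I: "{..<k} = insert m J" "m \<notin> J" "finite J" using m by (auto simp: J_def)
      have "\<Phi> ?C = (\<Sum>j\<in>insert m J. ?d m j) + (\<Sum>i\<in>J. \<Sum>j\<in>insert m J. ?d i j)"
        unfolding \<Phi>_def I(1) using I(2,3) by simp
      also have "(\<Sum>j\<in>insert m J. ?d m j) = (\<Sum>j\<in>J. ?d m j)" using I(2,3) by simp
      also have "(\<Sum>i\<in>J. \<Sum>j\<in>insert m J. ?d i j) = (\<Sum>i\<in>J. ?d i m) + (\<Sum>i\<in>J. \<Sum>j\<in>J. ?d i j)"
        using I(2,3) by (simp add: sum.distrib)
      also have "(\<Sum>i\<in>J. \<Sum>j\<in>J. ?d i j) = R"
        unfolding R_def using I(2) by (intro sum.cong refl) auto
      also have "(\<Sum>j\<in>J. ?d m j) = sum f Y / card Y"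
        unfolding row[symmetric] using I(2) by (intro sum.cong refl) auto
      also have "(\<Sum>i\<in>J. ?d i m) = (\<Sum>j\<in>J. if P m j then density E Y (C j) else 0)"
      proof (rule sum.cong[OF refl])
        fix i assume i: "i \<in> J"
        then have "finite (C i)" "i \<noteq> m" using finC by (auto simp: J_def)
        moreover have "P i m \<longleftrightarrow> P m i" using P by (meson sympD)
        ultimately show "?d i m = (if P m i then density E Y (C i) else 0)"
          using density_sym[OF _ Y sym] by simp
      qed
      finally have "\<Phi> ?C = sum f Y / card Y + (sum f Y / card Y + R)" unfolding row .
      then show ?thesis by linarith
    qed
    have finX: "finite X" using X(1) finC[OF m] finite_subset by blast
    have "\<Phi> (C(m := X)) \<le> \<Phi> (C(m := C m))"
      unfolding split[OF finX] split[OF finC[OF m]] using X by simp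
    then have "\<Phi> (C(m := X)) \<le> \<Phi> B" using C(4) by simp
    moreover have "\<forall>i<k. (C(m := X)) i \<subseteq> B i" using C(1) X(1) m by auto
    moreover have "\<forall>i<Suc m. card ((C(m := X)) i) = w" using C(2) X(2) by (auto simp: less_Suc_eq)
    moreover have "\<forall>i<k. w \<le> card ((C(m := X)) i)" using C(3) X(2) by auto
    ultimately show ?case by blast
  qed
  from this[of k] show ?thesis unfolding \<Phi>_def by blast
qed

text \<open>Weak sparsity does not pass to arbitrary subsets, so \<open>equalize\<close> comes first
  and controls only the total density, at most
  \<open>k * k * \<epsilon> ^ 8 \<le> 4 * \<epsilon> ^ 6\<close>; this then bounds every single
  pair. By Markov a pair has at most \<open>4 * \<epsilon>^2 * w\<close> vertices of degree above
  \<open>\<epsilon> ^ 4 * w\<close>. Over at most \<open>2 / \<epsilon>\<close> partners these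
  amount to \<open>8 * \<epsilon> * w \<le> w / 2\<close>, so half of each block survives.\<close>

lemma clean_blocks:
  fixes \<epsilon> :: real and k :: nat
  assumes sym: "symp E" and \<epsilon>: "0 < \<epsilon>" "\<epsilon> \<le> 1/16" and k: "real k \<le> 2 / \<epsilon>" and w: "1 \<le> w"
    and B: "\<And>i. i < k \<Longrightarrow> finite (B i) \<and> w \<le> card (B i)"
    and pairs: "\<And>i j. i < k \<Longrightarrow> j < k \<Longrightarrow> i \<noteq> j \<Longrightarrow>
      (\<forall>x\<in>B i. \<forall>y\<in>B j. E x y) \<or> edge_count E (B i) (B j) \<le> \<epsilon> ^ 8 * card (B i) * card (B j)"
  shows "\<exists>C. (\<forall>i<k. C i \<subseteq> B i \<and> w \<le> 2 * card (C i) \<and> card (C i) \<le> w) \<and>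
    (\<forall>i<k. \<forall>j<k. i \<noteq> j \<longrightarrow> (\<forall>x\<in>B i. \<forall>y\<in>B j. E x y) \<or> (\<forall>x\<in>C i. real (deg E x (C j)) \<le> \<epsilon> ^ 4 * w))"
proof -
  define P where "P i j \<longleftrightarrow> i < k \<and> j < k \<and> edge_count E (B i) (B j) \<le> \<epsilon> ^ 8 * card (B i) * card (B j)" for i j
  have symP: "symp P"
    unfolding symp_def P_def using edge_count_sym[OF _ _ sym] B by (auto simp: mult_ac)
  obtain C where C: "\<And>i. i < k \<Longrightarrow> C i \<subseteq> B i \<and> card (C i) = w"
    and le: "(\<Sum>i<k. \<Sum>j<k. if P i j \<and> i \<noteq> j then density E (C i) (C j) else 0) \<le>
      (\<Sum>i<k. \<Sum>j<k. if P i j \<and> i \<noteq> j then density E (B i) (B j) else 0)"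
    using equalize[OF sym symP, of k B w] B w by blast
  have "(\<Sum>i<k. \<Sum>j<k. if P i j \<and> i \<noteq> j then density E (B i) (B j) else 0) \<le> (\<Sum>i<k. \<Sum>j<k. \<epsilon> ^ 8)"
  proof (intro sum_mono)
    fix i j assume ij: "i \<in> {..<k}" "j \<in> {..<k}"
    then have "0 < card (B i)" "0 < card (B j)" using B w by (metis lessThan_iff less_le_trans zero_less_one)+
    then show "(if P i j \<and> i \<noteq> j then density E (B i) (B j) else 0) \<le> \<epsilon> ^ 8"
      using \<epsilon> by (auto simp: P_def density_def divide_le_eq mult.assoc)
  qed
  also have "\<dots> = real k * real k * \<epsilon> ^ 8" by simp
  also have "\<dots> \<le> (2 / \<epsilon>) * (2 / \<epsilon>) * \<epsilon> ^ 8"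
    using k \<epsilon> by (intro mult_right_mono mult_mono) auto
  also have "\<dots> = 4 * \<epsilon> ^ 6" using \<epsilon> by (simp add: field_simps eval_nat_numeral)
  finally have total: "(\<Sum>i<k. \<Sum>j<k. if P i j \<and> i \<noteq> j then density E (C i) (C j) else 0) \<le> 4 * \<epsilon> ^ 6"
    using le by linarith
  have finC: "finite (C i)" if "i < k" for i using C B that finite_subset by blast
  have one: "density E (C i) (C j) \<le> 4 * \<epsilon> ^ 6" if "P i j" "i \<noteq> j" for i j
  proof -
    have ij: "i < k" "j < k" using that by (auto simp: P_def)
    let ?d = "\<lambda>i j. if P i j \<and> i \<noteq> j then density E (C i) (C j) else 0"
    have nn: "0 \<le> ?d a b" for a b by (simp add: density_nonneg)
    have "?d i j \<le> (\<Sum>j<k. ?d i j)"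
      by (rule member_le_sum) (use ij nn in auto)
    also have "\<dots> \<le> (\<Sum>i<k. \<Sum>j<k. ?d i j)"
      by (rule member_le_sum[of i _ "\<lambda>i. \<Sum>j<k. ?d i j"]) (use ij nn in \<open>auto intro!: sum_nonneg\<close>)
    finally show ?thesis using total that by simp
  qed
  define Bad where "Bad i j = {x\<in>C i. \<epsilon> ^ 4 * w < real (deg E x (C j))}" for i j
  have bad: "real (card (Bad i j)) \<le> 4 * \<epsilon>\<^sup>2 * w" if "P i j" "i \<noteq> j" for i j
  proof -
    have ij: "i < k" "j < k" using that by (auto simp: P_def)
    have "real (card (Bad i j)) * (\<epsilon> ^ 4 * w) = (\<Sum>x\<in>Bad i j. \<epsilon> ^ 4 * w)" by simp
    also have "\<dots> \<le> (\<Sum>x\<in>Bad i j. real (deg E x (C j)))"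
      by (intro sum_mono) (simp add: Bad_def)
    also have "\<dots> \<le> edge_count E (C i) (C j)"
      unfolding edge_count_def Bad_def by (rule sum_mono2) (use finC ij in auto)
    also have "\<dots> = density E (C i) (C j) * (real w * real w)"
      unfolding density_def using C ij w by simp
    also have "\<dots> \<le> 4 * \<epsilon> ^ 6 * (real w * real w)"
      using one[OF that] by (intro mult_right_mono) auto
    also have "\<dots> = 4 * \<epsilon>\<^sup>2 * w * (\<epsilon> ^ 4 * w)" by (simp add: eval_nat_numeral)
    finally show ?thesis using \<epsilon> w by (simp add: mult_le_cancel_right)
  qed
  define D where "D i = C i - (\<Union>j\<in>{j. P i j \<and> i \<noteq> j}. Bad i j)" for i
  have D: "D i \<subseteq> C i" for i by (auto simp: D_def)
  have cD: "w \<le> 2 * card (D i)" if i: "i < k" for i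
  proof -
    let ?J = "{j. P i j \<and> i \<noteq> j}"
    have J: "?J \<subseteq> {..<k}" by (auto simp: P_def)
    then have finJ: "finite ?J" using finite_subset by blast
    have cJ: "card ?J \<le> k" using card_mono[OF _ J] by simp
    have "real (card (\<Union>j\<in>?J. Bad i j)) \<le> (\<Sum>j\<in>?J. real (card (Bad i j)))"
      using card_UN_le[OF finJ, of "Bad i"] by (metis of_nat_mono of_nat_sum)
    also have "\<dots> \<le> (\<Sum>j\<in>?J. 4 * \<epsilon>\<^sup>2 * w)" using bad by (intro sum_mono) auto
    also have "\<dots> = card ?J * (4 * \<epsilon>\<^sup>2 * w)" by simp
    also have "\<dots> \<le> (2 / \<epsilon>) * (4 * \<epsilon>\<^sup>2 * w)"
      using cJ k \<epsilon> by (intro mult_right_mono) auto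
    also have "\<dots> = 8 * \<epsilon> * w" using \<epsilon> by (simp add: power2_eq_square)
    also have "\<dots> \<le> 1/2 * w" using \<epsilon> by (intro mult_right_mono) auto
    finally have "2 * card (\<Union>j\<in>?J. Bad i j) \<le> w" by linarith
    moreover have "card (C i) - card (\<Union>j\<in>?J. Bad i j) \<le> card (D i)"
      unfolding D_def using finC[OF i] by (intro diff_card_le_card_Diff) (auto simp: Bad_def finJ)
    ultimately show ?thesis using C[OF i] by linarith
  qed
  have "(\<forall>x\<in>B i. \<forall>y\<in>B j. E x y) \<or> (\<forall>x\<in>D i. real (deg E x (D j)) \<le> \<epsilon> ^ 4 * w)"
    if ij: "i < k" "j < k" "i \<noteq> j" for i j
  proof (cases "P i j")
    case True
    have "real (deg E x (D j)) \<le> \<epsilon> ^ 4 * w" if "x \<in> D i" for x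
    proof -
      have "real (deg E x (C j)) \<le> \<epsilon> ^ 4 * w"
        using that True ij(3) unfolding D_def Bad_def by (auto simp: not_less)
      then show ?thesis using deg_mono[OF finC[OF ij(2)] D, of E x] by linarith
    qed
    then show ?thesis by blast
  next
    case False
    then show ?thesis using pairs[OF ij] ij unfolding P_def by blast
  qed
  moreover have "D i \<subseteq> B i \<and> w \<le> 2 * card (D i) \<and> card (D i) \<le> w" if "i < k" for i
    using D cD[OF that] C[OF that] card_mono[OF finC[OF that] D] by auto
  ultimately show ?thesis by (intro exI[of _ D]) auto
qed

section \<open>Generalized niceness in a minimal counterexample\<close>

lemma adj_induced: "adj (induced G S) u v \<longleftrightarrow> adj G u v \<and> u \<in> S \<and> v \<in> S"
  by (auto simp: adj_def induced_def)

lemma verts_induced [simp]: "verts (induced G S) = S"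
  by (simp add: induced_def)

lemma verts_complement [simp]: "verts (complement G) = verts G"
  by (simp add: complement_def)

lemma adj_complement:
  "adj (complement G) u v \<longleftrightarrow> u \<in> verts G \<and> v \<in> verts G \<and> co (adj G) u v"
  by (auto simp: adj_def complement_def co_def card_insert_if)

lemma symp_adj: "symp (adj G)"
  by (auto simp: symp_def adj_def insert_commute)

lemma irreflp_adj: "simple_graph G \<Longrightarrow> irreflp (adj G)"
  by (fastforce simp: simple_graph_def irreflp_def adj_def)

lemma simple_induced: "simple_graph G \<Longrightarrow> S \<subseteq> verts G \<Longrightarrow> simple_graph (induced G S)"
  by (auto simp: simple_graph_def induced_def intro: finite_subset)

lemma simple_complement: "simple_graph G \<Longrightarrow> simple_graph (complement G)"
  by (auto simp: simple_graph_def complement_def)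

lemma induced_induced: "X \<subseteq> S \<Longrightarrow> induced (induced G S) X = induced G X"
  by (auto simp: induced_def)

lemma free_induced: "free \<F> G \<Longrightarrow> S \<subseteq> verts G \<Longrightarrow> free \<F> (induced G S)"
  unfolding free_def by (metis induced_induced order_trans verts_induced)

lemma clique_iff: "clique G X \<longleftrightarrow> X \<subseteq> verts G \<and> clique_in (adj G) X"
  by (simp add: clique_def clique_in_def)

lemma stable_iff: "stable G X \<longleftrightarrow> X \<subseteq> verts G \<and> clique_in (co (adj G)) X"
  by (auto simp: stable_def clique_in_def co_def)

lemma clique_in_cong: "(\<And>u v. u \<in> X \<Longrightarrow> v \<in> X \<Longrightarrow> E u v \<longleftrightarrow> E' u v) \<Longrightarrow> clique_in E X \<longleftrightarrow> clique_in E' X"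
  by (simp add: clique_in_def)

lemma nbrs_Int: "X \<subseteq> verts G \<Longrightarrow> card (nbrs G v \<inter> X) = deg (adj G) v X"
  unfolding nbrs_def deg_def by (rule arg_cong[of _ _ card]) auto

lemma deg_cong: "(\<And>u. u \<in> X \<Longrightarrow> E v u \<longleftrightarrow> E' v u) \<Longrightarrow> deg E v X = deg E' v X"
  unfolding deg_def by (rule arg_cong[of _ _ card]) auto

lemma restricted_induced:
  assumes "X \<subseteq> S"
  shows "restricted (induced G S) d X \<longleftrightarrow> restricted_in (adj G) d X"
proof -
  have "deg (adj (induced G S)) v X = deg (adj G) v X"
    "deg (adj (complement (induced G S))) v X = deg (co (adj G)) v X" if "v \<in> X" for v
    using that assms by (auto intro!: deg_cong simp: adj_induced adj_complement co_def)
  then show ?thesis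
    using assms unfolding restricted_def sparse_def restricted_in_def sparse_in_def by (simp add: nbrs_Int)
qed

text \<open>The same map works on both sides: complementing negates adjacency of distinct vertices,
  and simplicity excludes loops.\<close>

lemma isomorphic_complement_iff:
  assumes "simple_graph G" "simple_graph F" "X \<subseteq> verts G"
  shows "isomorphic (induced (complement G) X) F \<longleftrightarrow> isomorphic (induced G X) (complement F)"
proof -
  have "(adj (induced (complement G) X) u v \<longleftrightarrow> adj F (f u) (f v)) \<longleftrightarrow>
      (adj (induced G X) u v \<longleftrightarrow> adj (complement F) (f u) (f v))"
    if "bij_betw f X (verts F)" "u \<in> X" "v \<in> X" for f u v
  proof -
    have "f u \<in> verts F" "f v \<in> verts F" "f u = f v \<longleftrightarrow> u = v"
      using that by (auto simp: bij_betw_def inj_on_def)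
    moreover have "\<not> adj G u u" "\<not> adj F (f u) (f u)"
      using irreflp_adj assms by (auto simp: irreflp_def)
    ultimately show ?thesis
      using that assms(3) by (auto simp: adj_induced adj_complement co_def)
  qed
  then show ?thesis unfolding isomorphic_def by (metis verts_complement verts_induced)
qed

lemma free_complement_iff:
  assumes "simple_graph G" "\<forall>F\<in>\<F>. simple_graph F"
  shows "free (complement ` \<F>) G \<longleftrightarrow> free \<F> (complement G)"
proof -
  have "isomorphic (induced G X) (complement F) \<longleftrightarrow> isomorphic (induced (complement G) X) F"
    if "F \<in> \<F>" "X \<subseteq> verts G" for F X
    using isomorphic_complement_iff[OF assms(1) _ that(2), of F] assms(2) that(1) by blast
  then have "(\<exists>X\<subseteq>verts G. \<exists>F\<in>\<F>. isomorphic (induced G X) (complement F)) \<longleftrightarrow>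
      (\<exists>X\<subseteq>verts G. \<exists>F\<in>\<F>. isomorphic (induced (complement G) X) F)" by meson
  then show ?thesis unfolding free_def by simp
qed

text \<open>For disjoint sets the map from ordered pairs to edges is injective.\<close>

lemma edge_count_le_edges:
  assumes fin: "finite T" and XY: "X \<subseteq> T" "Y \<subseteq> T" "X \<inter> Y = {}"
  shows "edge_count (adj G) X Y \<le> real (card {e \<in> edges (induced G T). \<exists>x\<in>X. \<exists>y\<in>Y. e = {x, y}})"
proof -
  let ?S = "SIGMA x:X. {y\<in>Y. adj G x y}"
  let ?R = "{e \<in> edges (induced G T). \<exists>x\<in>X. \<exists>y\<in>Y. e = {x, y}}"
  have finXY: "finite X" "finite Y" using fin XY by (auto intro: finite_subset)
  have "card ?S = (\<Sum>x\<in>X. deg (adj G) x Y)"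
    unfolding deg_def using finXY by (intro card_SigmaI) auto
  moreover have "inj_on (\<lambda>(x, y). {x, y}) ?S"
    using XY(3) by (auto simp: inj_on_def doubleton_eq_iff)
  moreover have "(\<lambda>(x, y). {x, y}) ` ?S \<subseteq> ?R"
    using XY by (auto simp: induced_def adj_def)
  moreover have "finite ?R"
    by (rule finite_subset[of _ "Pow T"]) (use fin in \<open>auto simp: induced_def\<close>)
  ultimately have "(\<Sum>x\<in>X. deg (adj G) x Y) \<le> card ?R"
    using card_inj_on_le[of "\<lambda>(x, y). {x, y}" ?S ?R] by simp
  then have "real (\<Sum>x\<in>X. deg (adj G) x Y) \<le> real (card ?R)" by (rule of_nat_mono)
  then show ?thesis by (simp add: edge_count_def)
qed

text \<open>The set reachable from \<open>u\<close> has no complement edge leaving it, so by the cut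
  condition it is all of \<open>Y\<close>.\<close>

lemma conn_in_imp_anti_connected:
  assumes "conn_in (co (adj G)) Y" "Y \<subseteq> S"
  shows "anti_connected (induced G S) Y"
proof -
  let ?A = "adj (complement (induced (induced G S) Y))"
  have A: "?A u v \<longleftrightarrow> u \<in> Y \<and> v \<in> Y \<and> co (adj G) u v" for u v
    using assms(2) by (auto simp: adj_complement adj_induced co_def)
  have "?A\<^sup>*\<^sup>* u v" if "u \<in> Y" "v \<in> Y" for u v
  proof (rule ccontr)
    assume "\<not> ?A\<^sup>*\<^sup>* u v"
    define Z where "Z = {z\<in>Y. ?A\<^sup>*\<^sup>* u z}"
    have "Z \<subseteq> Y" "Z \<noteq> {}" "Z \<noteq> Y"
      using that \<open>\<not> ?A\<^sup>*\<^sup>* u v\<close> by (auto simp: Z_def)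
    then obtain z x where zx: "z \<in> Z" "x \<in> Y - Z" "co (adj G) z x"
      using assms(1) unfolding conn_in_def by blast
    then have "?A z x" using A by (auto simp: Z_def)
    moreover have "?A\<^sup>*\<^sup>* u z" using zx(1) unfolding Z_def by blast
    ultimately have "?A\<^sup>*\<^sup>* u x" by (rule rtranclp.rtrancl_into_rtrancl[rotated])
    then show False using zx(2) by (simp add: Z_def)
  qed
  then show ?thesis
    using assms(1) unfolding anti_connected_def connected_graph_def conn_in_def by simp
qed

section \<open>Niceness applied inside a minimal counterexample\<close>

lemma powr_mono_exp:
  fixes x :: real
  assumes "1 \<le> x" "a \<le> b"
  shows "x powr a \<le> x powr b"
  using powr_mono[OF assms(2)] assms(1) by simp

text \<open>Sparsity is measured against the common \<open>w\<close>, since the blocks are only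
  known to lie between \<open>w / 2\<close> and \<open>w\<close>. The upper bounds on
  \<open>k\<close> and \<open>w\<close> keep the union of the blocks small.\<close>

definition clean_blocks ::
  "nat graph \<Rightarrow> nat set \<Rightarrow> real \<Rightarrow> real \<Rightarrow> nat \<Rightarrow> (nat \<Rightarrow> nat set) \<Rightarrow> nat \<Rightarrow> bool" where
  "clean_blocks G T \<epsilon> c1 k C w \<longleftrightarrow> 1 / \<epsilon> \<le> real k \<and> real k \<le> 2 / \<epsilon> \<and>
     \<epsilon> powr c1 * card T \<le> real w \<and> real w \<le> \<epsilon> powr c1 * card T + 1 \<and> 1 \<le> w \<and>
     (\<forall>i<k. C i \<subseteq> T \<and> w \<le> 2 * card (C i) \<and> card (C i) \<le> w) \<and>
     (\<forall>i<k. \<forall>j<k. i \<noteq> j \<longrightarrow> C i \<inter> C j = {} \<and>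
       ((\<forall>x\<in>C i. \<forall>y\<in>C j. adj G x y) \<or> (\<forall>x\<in>C i. real (deg (adj G) x (C j)) \<le> \<epsilon> ^ 4 * w)))"

lemma clean_blocksD:
  assumes "clean_blocks G T \<epsilon> c1 k C w"
  shows "1 / \<epsilon> \<le> real k" "real k \<le> 2 / \<epsilon>"
    "\<epsilon> powr c1 * card T \<le> real w" "real w \<le> \<epsilon> powr c1 * card T + 1" "1 \<le> w"
    "\<forall>i<k. C i \<subseteq> T \<and> w \<le> 2 * card (C i) \<and> card (C i) \<le> w"
    "\<forall>i<k. \<forall>j<k. i \<noteq> j \<longrightarrow> C i \<inter> C j = {} \<and>
      ((\<forall>x\<in>C i. \<forall>y\<in>C j. adj G x y) \<or> (\<forall>x\<in>C i. real (deg (adj G) x (C j)) \<le> \<epsilon> ^ 4 * w))"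
  using assms unfolding clean_blocks_def by simp_all

text \<open>Niceness for a subset \<open>T\<close> of relative size
  \<open>\<epsilon> powr g\<close>. The lower bound on the order and \<open>c \<le> c4 / 2\<close>
  exclude the homogeneous outcome, \<open>c * (c5 + g) \<le> 1\<close> the pure one;
  \<open>c2\<close> has been lowered to 8.\<close>

definition nice_for :: "nat graph set \<Rightarrow> real \<Rightarrow> real \<Rightarrow> real \<Rightarrow> real \<Rightarrow> real \<Rightarrow> real \<Rightarrow> bool" where
  "nice_for \<F> c1 c3 c4 c5 c7 c8 \<longleftrightarrow> (\<forall>G c \<epsilon> T g.
     simple_graph G \<longrightarrow> free (complement ` \<F>) G \<longrightarrow> critical (adj G) (verts G) c \<longrightarrow> T \<subseteq> verts G \<longrightarrow>
     0 < \<epsilon> \<longrightarrow> \<epsilon> \<le> 1/16 \<longrightarrow> 0 \<le> g \<longrightarrow> \<epsilon> powr g * order G \<le> card T \<longrightarrow>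
     1 \<le> \<epsilon> powr (c3 + g) * real (order G) powr (1/2) \<longrightarrow> c \<le> c4 / 2 \<longrightarrow> c * (c5 + g) \<le> 1 \<longrightarrow>
     (\<exists>k C w. clean_blocks G T \<epsilon> c1 k C w) \<or>
     (\<exists>X\<subseteq>T. restricted_in (adj G) (\<epsilon> powr c7) X \<and> \<epsilon> powr c8 * card T \<le> card X))"

text \<open>In a minimal counterexample the homogeneous and the pure outcome of generalized niceness are
  impossible, and the blockade can be cut down to blocks of almost equal size with vertexwise
  sparsity.\<close>

lemma nice_outcome:
  assumes "generalized_nice \<F>"
  shows "\<exists>c1 c3 c4 c5 c7 c8. 3 \<le> c1 \<and> 0 < c3 \<and> 0 < c4 \<and> 0 < c5 \<and> 4 \<le> c7 \<and> 0 < c8 \<and>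
    nice_for \<F> c1 c3 c4 c5 c7 c8"
proof -
  obtain c1 c2 c3 c4 c5 c6 c7 c8 :: real where
    cs: "c1 \<ge> 3" "c2 \<ge> 8" "c3 > 0" "c4 > 0" "c5 > 0" "c6 \<ge> 1" "c7 \<ge> 4" "c8 > 0" and
    nice: "\<forall>(G :: nat graph) (\<epsilon> :: real).
         simple_graph G \<and> free (complement ` \<F>) G \<and> 0 < \<epsilon> \<and> \<epsilon> < 1/2 \<longrightarrow>
           (\<exists>\<B>. blockade G (1 / \<epsilon>) (\<epsilon> powr c1 * real (order G)) \<B> \<and>
              pairwise_blocks
                (\<lambda>B C. complete_to G B C \<or> weakly_sparse_pair G (\<epsilon> powr c2) B C) \<B>) \<or>
           (\<exists>X. (clique G X \<or> stable G X) \<and>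
              (\<epsilon> powr c3 * real (order G)) powr c4 \<le> real (card X)) \<or>
           (\<exists>k\<ge>\<epsilon> powr (-c6). \<exists>\<B>. blockade G k (real (order G) / k powr c5) \<B> \<and>
              (complete_blockade G \<B> \<or> anti_complete_blockade G \<B>)) \<or>
           (\<exists>X\<subseteq>verts G. restricted G (\<epsilon> powr c7) X \<and>
              \<epsilon> powr c8 * real (order G) \<le> real (card X))"
    using assms unfolding generalized_nice_def apply -
    apply (elim exE conjE)
    subgoal premises p for c1 c2 c3 c4 c5 c6 c7 c8
      by (rule that[of c1 c2 c3 c4 c5 c6 c7 c8]) (rule p)+
    done
  have "nice_for \<F> c1 c3 c4 c5 c7 c8"
    unfolding nice_for_def
  proof (intro allI impI)
    fix G :: "nat graph" and c \<epsilon> :: real and T g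
    assume simp: "simple_graph G" and free: "free (complement ` \<F>) G"
      and crit: "critical (adj G) (verts G) c" and T: "T \<subseteq> verts G" and \<epsilon>: "0 < \<epsilon>" "\<epsilon> \<le> 1/16"
      and g: "0 \<le> g" and Tg: "\<epsilon> powr g * order G \<le> card T"
      and big: "1 \<le> \<epsilon> powr (c3 + g) * real (order G) powr (1/2)"
      and cc: "c \<le> c4 / 2" "c * (c5 + g) \<le> 1"
    interpret critical "adj G" "verts G" c by (rule crit)
    let ?H = "induced G T"
    define n where "n = real (order G)"
    have n: "n = real (card (verts G))" by (simp add: n_def order_def)
    have n1: "1 \<le> n" using card_V_pos n by linarith
    have finT: "finite T" using fin T finite_subset by blast
    have ordH: "order ?H = card T" by (simp add: order_def)
    have Tpos: "0 < real (card T)"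
    proof -
      have "0 < \<epsilon> powr g * n" using \<epsilon> n1 by simp
      then show ?thesis using Tg unfolding n_def by linarith
    qed
    show "(\<exists>k C w. clean_blocks G T \<epsilon> c1 k C w) \<or>
      (\<exists>X\<subseteq>T. restricted_in (adj G) (\<epsilon> powr c7) X \<and> \<epsilon> powr c8 * card T \<le> card X)"
    proof -
      have "simple_graph ?H \<and> free (complement ` \<F>) ?H \<and> 0 < \<epsilon> \<and> \<epsilon> < 1/2"
        using simple_induced[OF simp T] free_induced[OF free T] \<epsilon> by simp
      from nice[rule_format, OF this] consider
        (blocks) \<B> where "blockade ?H (1 / \<epsilon>) (\<epsilon> powr c1 * real (order ?H)) \<B>"
          "pairwise_blocks (\<lambda>B C. complete_to ?H B C \<or> weakly_sparse_pair ?H (\<epsilon> powr c2) B C) \<B>"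
        | (homog) X where "clique ?H X \<or> stable ?H X" "(\<epsilon> powr c3 * real (order ?H)) powr c4 \<le> real (card X)"
        | (pure) k \<B> where "\<epsilon> powr (-c6) \<le> k" "blockade ?H k (real (order ?H) / k powr c5) \<B>"
            "complete_blockade ?H \<B> \<or> anti_complete_blockade ?H \<B>"
        | (restricted_in) X where "X \<subseteq> verts ?H" "restricted ?H (\<epsilon> powr c7) X"
            "\<epsilon> powr c8 * real (order ?H) \<le> real (card X)"
        by blast
      then show ?thesis
      proof cases
        case restricted_in
        then have "X \<subseteq> T" by simp
        with restricted_in show ?thesis unfolding ordH by (auto simp: restricted_induced)
      next
        case homog
        have "X \<subseteq> T" using homog(1) by (auto simp: clique_def stable_def)
        moreover have "clique_in (adj G) X \<or> clique_in (co (adj G)) X"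
          using homog(1) \<open>X \<subseteq> T\<close>
          unfolding clique_def stable_def clique_in_def co_def by (auto simp: adj_induced subset_iff)
        ultimately have less: "real (card X) < n powr c" unfolding n using clique_in_less T by blast
        \<comment> \<open>One factor \<open>n powr (1/2)\<close> of \<open>n\<close> absorbs
          \<open>\<epsilon> powr (c3 + g)\<close>; the other, raised to \<open>c4\<close>, is at
          least \<open>n powr c\<close>.\<close>
        have "n powr (1/2) = 1 * n powr (1/2)" by simp
        also have "\<dots> \<le> \<epsilon> powr (c3 + g) * n powr (1/2) * n powr (1/2)"
          using big unfolding n_def by (intro mult_right_mono) auto
        also have "\<dots> = \<epsilon> powr c3 * (\<epsilon> powr g * n)"
        proof -
          have "n powr (1/2) * n powr (1/2) = n" using powr_mult_eq[of "1/2" "1/2" 1 n] n1 by simp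
          then show ?thesis by (simp add: powr_add mult.assoc)
        qed
        also have "\<dots> \<le> \<epsilon> powr c3 * card T"
          using Tg unfolding n_def by (intro mult_left_mono) auto
        finally have "(n powr (1/2)) powr c4 \<le> (\<epsilon> powr c3 * card T) powr c4"
          using cs by (intro powr_mono2) auto
        also have "\<dots> \<le> card X" using homog(2) unfolding ordH .
        finally have "n powr (c4 / 2) \<le> card X" by (simp add: powr_powr)
        moreover have "n powr c \<le> n powr (c4 / 2)" using n1 cc by (intro powr_mono_exp) auto
        ultimately show ?thesis using less by linarith
      next
        case pure
        have k1: "1 / \<epsilon> \<le> k"
        proof -
          have "\<epsilon> powr (- 1) \<le> \<epsilon> powr (- c6)" using \<epsilon> cs by (intro powr_antimono) auto
          moreover have "\<epsilon> powr (- 1) = 1 / \<epsilon>" using \<epsilon> by (simp add: powr_minus_divide)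
          ultimately show ?thesis using pure(1) by linarith
        qed
        have k16: "16 \<le> k"
        proof -
          have "16 \<le> 1 / \<epsilon>" using \<epsilon> by (simp add: field_simps)
          then show ?thesis using k1 by linarith
        qed
        \<comment> \<open>The scale is \<open>1 / k\<close>, not \<open>\<epsilon>\<close>, because
          \<open>k\<close> may be far larger than \<open>1 / \<epsilon>\<close> and the blocks
          shrink with it. Since \<open>x \<le> \<epsilon>\<close>, the relative size of
          \<open>T\<close> is still at least \<open>x powr g\<close>.\<close>
        define x where "x = 1 / k"
        have x: "0 < x" "x < 1" "x \<le> \<epsilon>"
          using k16 k1 \<epsilon> by (auto simp: x_def field_simps)
        have len: "x powr (- 1) \<le> real (length \<B>)"
          using pure(2) k16 unfolding blockade_def x_def by (simp add: powr_minus field_simps)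
        have size: "x powr (c5 + g) * real (card (verts G)) \<le> real (card T) / k powr c5"
        proof -
          have "x powr g \<le> \<epsilon> powr g" using x g by (intro powr_mono2) auto
          then have "x powr c5 * (x powr g * n) \<le> x powr c5 * (\<epsilon> powr g * n)"
            using n1 by (intro mult_left_mono mult_right_mono) auto
          also have "\<dots> \<le> x powr c5 * card T"
            using Tg unfolding n_def by (intro mult_left_mono) auto
          finally show ?thesis using k16 unfolding n x_def by (simp add: powr_add powr_divide)
        qed
        have blk: "\<B> ! i \<subseteq> verts G \<and> x powr (c5 + g) * real (card (verts G)) \<le> real (card (\<B> ! i))"
          if "i < length \<B>" for i
          using pure(2) that size T unfolding blockade_def ordH by fastforce
        have sub: "\<B> ! i \<subseteq> T" if "i < length \<B>" for i
          using pure(2) that unfolding blockade_def by simp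
        have disj: "\<B> ! i \<inter> \<B> ! j = {}" if "i < length \<B>" "j < length \<B>" "i \<noteq> j" for i j
          using pure(2) that unfolding blockade_def by simp
        have "pairwise_to (adj G) (length \<B>) ((!) \<B>) \<or> pairwise_to (co (adj G)) (length \<B>) ((!) \<B>)"
          using pure(3)
        proof
          assume "complete_blockade ?H \<B>"
          then show ?thesis
            unfolding complete_blockade_def pairwise_blocks_def complete_to_def pairwise_to_def adj_induced by blast
        next
          assume a: "anti_complete_blockade ?H \<B>"
          \<comment> \<open>\<open>co\<close> also demands distinct vertices, which disjointness of
            the blocks supplies.\<close>
          have "co (adj G) x y" if "i < length \<B>" "j < length \<B>" "i \<noteq> j" "x \<in> \<B> ! i" "y \<in> \<B> ! j" for i j x y
            using a disj[OF that(1-3)] sub[OF that(1)] sub[OF that(2)] that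
            unfolding anti_complete_blockade_def pairwise_blocks_def anti_complete_to_def adj_induced co_def
            by blast
          then show ?thesis unfolding pairwise_to_def by blast
        qed
        then have False
          by (elim disjE; intro no_pure_blocks[where B = "(!) \<B>", OF x(1,2) zero_less_one len blk _ _ cc(2)]) auto
        then show ?thesis ..
      next
        case blocks
        \<comment> \<open>The blockade may be longer; only its first \<open>k\<close> blocks are
          kept, so that \<open>k \<le> 2 / \<epsilon>\<close>.\<close>
        define k where "k = nat \<lceil>1 / \<epsilon>\<rceil>"
        define w where "w = nat \<lceil>\<epsilon> powr c1 * card T\<rceil>"
        have inv: "16 \<le> 1 / \<epsilon>" using \<epsilon> by (simp add: field_simps)
        have k: "1 / \<epsilon> \<le> real k" "real k \<le> 2 / \<epsilon>"
        proof -
          show "1 / \<epsilon> \<le> real k" unfolding k_def by (rule real_nat_ceiling_ge)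
          have "real k \<le> 1 / \<epsilon> + 1" using inv unfolding k_def by linarith
          also have "\<dots> \<le> 1 / \<epsilon> + 1 / \<epsilon>" using inv by linarith
          also have "\<dots> = 2 / \<epsilon>" by simp
          finally show "real k \<le> 2 / \<epsilon>" .
        qed
        have wpos: "0 < \<epsilon> powr c1 * card T" using \<epsilon> Tpos by simp
        have w: "\<epsilon> powr c1 * card T \<le> real w" "real w \<le> \<epsilon> powr c1 * card T + 1" "1 \<le> w"
          using wpos unfolding w_def by linarith+
        have klen: "k \<le> length \<B>"
          using blocks(1) unfolding blockade_def k_def by (simp add: ceiling_le_iff)
        define B where "B i = \<B> ! i" for i
        have B: "B i \<subseteq> T" "w \<le> card (B i)" if "i < k" for i
        proof -
          have "i < length \<B>" using that klen by simp
          then have "B i \<subseteq> T" "\<epsilon> powr c1 * card T \<le> real (card (B i))"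
            using blocks(1) unfolding blockade_def ordH B_def by auto
          then show "B i \<subseteq> T" "w \<le> card (B i)" unfolding w_def by (auto simp: ceiling_le_iff)
        qed
        have Bd: "B i \<inter> B j = {}" if "i < k" "j < k" "i \<noteq> j" for i j
          using blocks(1) that klen unfolding blockade_def B_def by auto
        have pairs: "(\<forall>x\<in>B i. \<forall>y\<in>B j. adj G x y) \<or>
            edge_count (adj G) (B i) (B j) \<le> \<epsilon> ^ 8 * card (B i) * card (B j)"
          if ij: "i < k" "j < k" "i \<noteq> j" for i j
        proof -
          have "complete_to ?H (B i) (B j) \<or> weakly_sparse_pair ?H (\<epsilon> powr c2) (B i) (B j)"
            using blocks(2) ij klen unfolding pairwise_blocks_def B_def by auto
          then show ?thesis
          proof
            assume "complete_to ?H (B i) (B j)"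
            then show ?thesis unfolding complete_to_def adj_induced by blast
          next
            assume a: "weakly_sparse_pair ?H (\<epsilon> powr c2) (B i) (B j)"
            have "edge_count (adj G) (B i) (B j) \<le> \<epsilon> powr c2 * card (B i) * card (B j)"
              using edge_count_le_edges[OF finT B(1)[OF ij(1)] B(1)[OF ij(2)] Bd[OF ij], of G] a
              unfolding weakly_sparse_pair_def by linarith
            also have "\<dots> \<le> \<epsilon> powr 8 * card (B i) * card (B j)"
              using cs \<epsilon> by (intro mult_right_mono powr_antimono) auto
            finally show ?thesis using \<epsilon> by simp
          qed
        qed
        have finB: "finite (B i) \<and> w \<le> card (B i)" if "i < k" for i
          using B[OF that] finT finite_subset by blast
        obtain C where C:
          "\<forall>i<k. C i \<subseteq> B i \<and> w \<le> 2 * card (C i) \<and> card (C i) \<le> w"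
          "\<forall>i<k. \<forall>j<k. i \<noteq> j \<longrightarrow> (\<forall>x\<in>B i. \<forall>y\<in>B j. adj G x y) \<or>
            (\<forall>x\<in>C i. real (deg (adj G) x (C j)) \<le> \<epsilon> ^ 4 * w)"
          using clean_blocks[where B = B, OF sym \<epsilon> k(2) w(3) finB pairs] by blast
        note C = C(1)[rule_format] C(2)[rule_format]
        have C1: "C i \<subseteq> T \<and> w \<le> 2 * card (C i) \<and> card (C i) \<le> w" if "i < k" for i
          using C(1)[OF that] B(1)[OF that] by blast
        have C2: "C i \<inter> C j = {} \<and> ((\<forall>x\<in>C i. \<forall>y\<in>C j. adj G x y) \<or>
            (\<forall>x\<in>C i. real (deg (adj G) x (C j)) \<le> \<epsilon> ^ 4 * w))" if ij: "i < k" "j < k" "i \<noteq> j" for i j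
          using C(2)[OF ij] Bd[OF ij] C(1)[OF ij(1)] C(1)[OF ij(2)] by blast
        have "clean_blocks G T \<epsilon> c1 k C w"
          unfolding clean_blocks_def by (intro conjI k w allI impI C1 C2)
        then show ?thesis by blast
      qed
    qed
  qed
  then show ?thesis using cs by blast
qed

section \<open>Sparsifying sparse sets\<close>

lemma big_power:
  fixes y n :: real
  assumes "0 < y" "y \<le> 1" "1 \<le> n" "1 \<le> y powr e * n powr (1/2)" "b \<le> e"
  shows "1 \<le> y powr b * n powr (1/2)" "1 \<le> y powr b * n"
proof -
  have "y powr e * n powr (1/2) \<le> y powr b * n powr (1/2)"
    using assms by (intro mult_right_mono powr_antimono) auto
  then show 1: "1 \<le> y powr b * n powr (1/2)" using assms(4) by linarith
  have "n powr (1/2) \<le> n powr 1" using assms(3) by (intro powr_mono_exp) auto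
  then have "y powr b * n powr (1/2) \<le> y powr b * n"
    using assms(3) by (intro mult_left_mono) auto
  then show "1 \<le> y powr b * n" using 1 by linarith
qed

text \<open>The factor 2 lost by passing to \<open>T\<close> is absorbed in one more power of
  \<open>y\<close>.\<close>

lemma size_of_half:
  fixes y n :: real
  assumes "0 < y" "y \<le> 1/2" "y powr D * n \<le> card S" "card S \<le> 2 * card T"
  shows "y powr (D + 1) * n \<le> card T"
proof -
  have "y powr (D + 1) * n = y * (y powr D * n)" using assms(1) by (simp add: powr_add)
  also have "\<dots> \<le> y * (2 * real (card T))" using assms by (intro mult_left_mono) linarith+
  also have "\<dots> = (2 * y) * real (card T)" by simp
  also have "\<dots> \<le> 1 * real (card T)" using assms(2) by (intro mult_right_mono) auto
  finally show ?thesis by simp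
qed

text \<open>One round, with the same \<open>D\<close> before and after:
  \<open>y powr (2 * D)\<close> is the \<open>D\<close>-th power of the new parameter
  \<open>y^2\<close>. The hypothesis with \<open>e\<close> says that the order is large compared to
  \<open>1 / y\<close>; \<open>e\<close> and \<open>\<kappa>\<close> may depend on
  \<open>D\<close>.\<close>

definition step_at ::
  "nat graph set \<Rightarrow> (nat graph \<Rightarrow> real \<Rightarrow> nat set \<Rightarrow> bool) \<Rightarrow> real \<Rightarrow> real \<Rightarrow> real \<Rightarrow> real \<Rightarrow> bool" where
  "step_at \<F> P y1 D e \<kappa> \<longleftrightarrow> (\<forall>G c y S.
     simple_graph G \<longrightarrow> free (complement ` \<F>) G \<longrightarrow> critical (adj G) (verts G) c \<longrightarrow> c \<le> \<kappa> \<longrightarrow>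
     0 < y \<longrightarrow> y \<le> y1 \<longrightarrow> 1 \<le> y powr e * real (order G) powr (1/2) \<longrightarrow>
     S \<subseteq> verts G \<longrightarrow> P G y S \<longrightarrow> y powr D * order G \<le> card S \<longrightarrow>
     (\<exists>U\<subseteq>verts G. restricted_in (adj G) (y\<^sup>2) U \<and> y powr (2 * D) * order G \<le> card U))"

text \<open>Let \<open>T\<close> be the part of \<open>S\<close> at which peeling by anti-complete
  sets is stuck. Every outcome of niceness and wonderfulness either gives a sufficiently restricted
  large set, or an anti-connected block that is anti-complete to all but
  \<open>4 * y * card S\<close> vertices of \<open>T\<close>, which is the forbidden peeling
  step.\<close>

lemma sparse_step:
  assumes "wonderful \<F>" and "generalized_nice \<F>"
  shows "\<exists>y1>0. \<exists>D0. \<forall>D\<ge>D0. \<exists>e \<kappa>. 0 < \<kappa> \<and> step_at \<F> (\<lambda>G y S. sparse_in (adj G) y S) y1 D e \<kappa>"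
proof -
  obtain c1 c3 c4 c5 c7 c8 where cs: "3 \<le> c1" "0 < c3" "0 < c4" "0 < c5" "4 \<le> c7" "0 < c8"
    and nice: "nice_for \<F> c1 c3 c4 c5 c7 c8"
    using nice_outcome[OF assms(2)] by blast
  obtain a :: real where a: "6 \<le> a" and wonder: "\<forall>y :: real. \<forall>G :: nat graph.
        0 < y \<and> y < 1/2 \<and> simple_graph G \<and> free (complement ` \<F>) G \<longrightarrow>
        (\<forall>(\<B> :: nat set list) (l :: nat) (w :: real).
           length \<B> = l \<and> y powr (-a) \<le> real l \<and> blockade G (real l) w \<B> \<and>
           (\<forall>B\<in>set \<B>. anti_connected G B) \<and>
           (\<forall>B\<in>set \<B>. \<forall>C\<in>set \<B>. card B = card C) \<and>
           pairwise_blocks (\<lambda>B C. complete_to G B C \<or> sparse_pair G (y powr a) B C) \<B> \<longrightarrow>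
           (\<exists>X\<subseteq>verts G. restricted G (y ^ 4) X \<and> w \<le> real (card X)) \<or>
           (\<exists>i<l.
              real (card {v \<in> verts G - \<Union> (set \<B>).
                 0 < card (nbrs G v \<inter> \<B> ! i) \<and>
                 real (card (nbrs G v \<inter> \<B> ! i)) < 1/2 * real (card (\<B> ! i))})
              \<le> y * real (order G)))"
    using assms(1) unfolding wonderful_def apply -
    apply (elim exE conjE)
    subgoal premises p for a
      by (rule that[of a]) (rule p)+
    done
  \<comment> \<open>\<open>y powr g1 * n\<close> bounds the size of the anti-connected blocks from
    below. The bound on \<open>D\<close> ensures that \<open>g1\<close> and
    \<open>a * c8 + D + 1\<close> are at most \<open>2 * D\<close>, so that restricted sets from
    either source are large enough.\<close>
  have main: "\<exists>U\<subseteq>verts G. restricted_in (adj G) (y\<^sup>2) U \<and> y powr (2 * D) * order G \<le> card U"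
    if D: "a * (c1 + 3) + a * c8 + 1 \<le> D" and g1: "g1 = a * (c1 + 3) + D + 1"
      and simp: "simple_graph G" and free: "free (complement ` \<F>) G"
      and crit: "critical (adj G) (verts G) c"
      and \<kappa>: "c \<le> c4 / 2" "c * (c5 + (D + 1) / a) \<le> 1" "c * g1 \<le> 1/2"
      and y: "0 < y" "y \<le> 1/256"
      and big: "1 \<le> y powr (a * c3 + g1 + 1) * real (order G) powr (1/2)"
      and S: "S \<subseteq> verts G" "sparse_in (adj G) y S" and size: "y powr D * order G \<le> card S"
    for G :: "nat graph" and c y D g1 :: real and S
  proof (rule ccontr)
    assume goal: "\<not> ?thesis"
    interpret critical "adj G" "verts G" c by (rule crit)
    define n where "n = real (order G)"
    have n: "n = real (card (verts G))" by (simp add: n_def order_def)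
    have n1: "1 \<le> n" using card_V_pos n by linarith
    have y1: "y < 1" "y \<le> 1" using y by auto
    have apos: "0 \<le> a * c1" "0 \<le> a * c3" "0 \<le> a * c8" using a cs by auto
    have D1: "1 \<le> D"
    proof -
      have "0 \<le> a * (c1 + 3)" using a cs by simp
      then show ?thesis using D apos by linarith
    qed
    have bigb: "1 \<le> y powr b * n" if "b \<le> a * c3 + g1 + 1" for b
      using big_power(2)[OF y(1) y1(2) n1 _ that] big unfolding n_def by blast
    \<comment> \<open>Wonderfulness at \<open>y\<close> asks for \<open>y powr (- a)\<close> blocks,
      hence niceness is applied at \<open>y powr a\<close>.\<close>
    define \<epsilon> where "\<epsilon> = y powr a"
    have \<epsilon>: "0 < \<epsilon>" "\<epsilon> \<le> y" "\<epsilon> \<le> 1/16"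
    proof -
      show "0 < \<epsilon>" using y by (simp add: \<epsilon>_def)
      have "y powr a \<le> y powr 1" using y a by (intro powr_antimono) auto
      then show "\<epsilon> \<le> y" using y by (simp add: \<epsilon>_def)
      then show "\<epsilon> \<le> 1/16" using y by linarith
    qed
    have \<epsilon>p: "\<epsilon> powr b = y powr (a * b)" for b unfolding \<epsilon>_def by (simp add: powr_powr)
    \<comment> \<open>Peeling runs for about \<open>y powr (- (1/2))\<close> rounds, each costing
      \<open>4 * y\<close>; the total is about \<open>4 * y powr (1/2)\<close>, at most
      \<open>1/4\<close> for \<open>y \<le> 1/256\<close>, plus \<open>4 * y\<close>.\<close>
    have \<delta>: "0 \<le> 4 * y" "(y powr (- (1/2)) + 1) * (4 * y) \<le> 1/2"
    proof -
      have "y powr (- (1/2)) * y = y powr (1/2)"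
        using powr_mult_eq[of "-(1/2)" 1 "1/2" y] y by simp
      moreover have "y powr (1/2) \<le> (1/256) powr (1/2)" using y by (intro powr_mono2) auto
      moreover have "(1/256 :: real) powr (1/2) = 1/16"
        using powr_half_sqrt[of "1/256 :: real"] real_sqrt_abs[of "1/16 :: real"] by (simp add: power2_eq_square)
      ultimately have "y powr (- (1/2)) * y \<le> 1/16" by linarith
      moreover have "(y powr (- (1/2)) + 1) * (4 * y) = 4 * (y powr (- (1/2)) * y) + 4 * y"
        by (simp add: algebra_simps)
      ultimately show "(y powr (- (1/2)) + 1) * (4 * y) \<le> 1/2" using y by linarith
    qed (use y in simp)
    have half: "(0::real) < 1/2" by simp
    obtain T where T: "T \<subseteq> S" "card S \<le> 2 * card T" and none:
      "\<not> (\<exists>A B. A \<subseteq> T \<and> B \<subseteq> T \<and> (\<forall>x\<in>A. \<forall>y\<in>B. co (adj G) x y) \<and>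
        y powr g1 * card (verts G) \<le> card A \<and> real (card (T - B)) \<le> 4 * y * card S)"
      by (rule unpeelable_subset[OF S(1) disjI2[OF refl] y(1) y1(1) half \<delta> \<kappa>(3)])
    have TV: "T \<subseteq> verts G" using T S by blast
    have finT: "finite T" "finite S" using TV S fin finite_subset by blast+
    have cT: "y powr (D + 1) * n \<le> card T"
      by (rule size_of_half[OF y(1) _ _ T(2)]) (use y size n_def in auto)
    have TS: "card T \<le> card S" using T(1) finT by (intro card_mono)
    have \<epsilon>g: "\<epsilon> powr ((D + 1) / a) = y powr (D + 1)" unfolding \<epsilon>p using a by simp
    have g0: "0 \<le> (D + 1) / a" using D1 a by simp
    have h1: "\<epsilon> powr ((D + 1) / a) * order G \<le> card T"
      using cT unfolding \<epsilon>g n_def .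
    have h2: "1 \<le> \<epsilon> powr (c3 + (D + 1) / a) * real (order G) powr (1/2)"
    proof -
      have "a * (c3 + (D + 1) / a) \<le> a * c3 + g1 + 1"
      proof -
        have "a * (c3 + (D + 1) / a) = a * c3 + (D + 1)"
        proof -
          have "a * ((D + 1) / a) = D + 1" using a by (metis nonzero_mult_div_cancel_left not_numeral_le_zero times_divide_eq_right)
          then show ?thesis by (simp only: distrib_left)
        qed
        moreover have "0 \<le> a * (c1 + 3)" using a cs by simp
        ultimately show ?thesis unfolding g1 by linarith
      qed
      then show ?thesis
        unfolding \<epsilon>p using big_power(1)[OF y(1) y1(2) n1] big unfolding n_def by blast
    qed
    have found: False if "X \<subseteq> T" "restricted_in (adj G) d X" "d \<le> y\<^sup>2" "y powr b * n \<le> card X" "b \<le> 2 * D" for X d b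
    proof -
      have "y powr (2 * D) * n \<le> y powr b * n"
        using that y y1 n1 by (intro mult_right_mono powr_antimono) auto
      then have "y powr (2 * D) * n \<le> card X" using that(4) by linarith
      moreover have "restricted_in (adj G) (y\<^sup>2) X" using restricted_in_mono that by blast
      ultimately show False using goal that(1) TV unfolding n_def by blast
    qed
    have "(\<exists>k C w. clean_blocks G T \<epsilon> c1 k C w) \<or>
        (\<exists>X\<subseteq>T. restricted_in (adj G) (\<epsilon> powr c7) X \<and> \<epsilon> powr c8 * card T \<le> card X)"
      by (rule nice[unfolded nice_for_def, rule_format, OF simp free crit TV \<epsilon>(1,3) g0 h1 h2 \<kappa>(1,2)])
    then consider (blocks) k C w where "clean_blocks G T \<epsilon> c1 k C w"
      | (res) X where "X \<subseteq> T" "restricted_in (adj G) (\<epsilon> powr c7) X" "\<epsilon> powr c8 * card T \<le> card X"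
      by blast
    then show False
    proof cases
      case res
      have "y powr (a * c8 + (D + 1)) * n = \<epsilon> powr c8 * (y powr (D + 1) * n)"
        unfolding \<epsilon>p by (simp add: powr_add)
      also have "\<dots> \<le> \<epsilon> powr c8 * card T" using cT by (intro mult_left_mono) auto
      also have "\<dots> \<le> card X" by (rule res(3))
      finally have s: "y powr (a * c8 + (D + 1)) * n \<le> card X" .
      have "\<epsilon> powr c7 \<le> y powr 2"
      proof -
        have "6 * 4 \<le> a * c7" using a cs by (intro mult_mono) auto
        then show ?thesis unfolding \<epsilon>p using y y1 by (intro powr_antimono) auto
      qed
      then have "\<epsilon> powr c7 \<le> y\<^sup>2" using y by simp
      moreover have "a * c8 + (D + 1) \<le> 2 * D"
      proof -
        have "0 \<le> a * (c1 + 3)" using a cs by simp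
        then show ?thesis using D by linarith
      qed
      ultimately show False using found[OF res(1,2) _ s] by blast
    next
      case blocks
      note blocks = clean_blocksD[OF blocks]
      \<comment> \<open>Small enough for anti-connected subsets (\<open>1 / \<epsilon> + 1\<close>
        rounds of \<open>2 * w1\<close> vertices fit into half of a block), yet sparsity survives
        the shrinking: \<open>\<epsilon> ^ 4 * w \<le> 32 * \<epsilon> ^ 3 * w1 \<le> \<epsilon> *
        w1\<close>.\<close>
      define w1 where "w1 = nat \<lceil>\<epsilon> * w / 32\<rceil>"
      define b where "b = a * (c1 + 1) + D + 1"
      have bb: "b + 1 \<le> g1" using a unfolding b_def g1 by (simp add: algebra_simps)
      have \<epsilon>w: "y powr b * n \<le> \<epsilon> * w"
      proof -
        have "y powr b * n = \<epsilon> * (\<epsilon> powr c1 * (y powr (D + 1) * n))"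
        proof -
          have "b = a + (a * c1 + (D + 1))" by (simp add: b_def algebra_simps)
          then show ?thesis unfolding \<epsilon>p by (simp add: powr_add \<epsilon>_def)
        qed
        also have "\<dots> \<le> \<epsilon> * (\<epsilon> powr c1 * card T)" using cT \<epsilon> by (intro mult_left_mono) auto
        also have "\<dots> \<le> \<epsilon> * w" using blocks(3) \<epsilon> by (intro mult_left_mono) auto
        finally show ?thesis .
      qed
      have yb: "y powr (b + 1) * n = y * (y powr b * n)" using y by (simp add: powr_add)
      have \<epsilon>w32: "32 \<le> \<epsilon> * w"
      proof -
        have "1 \<le> y powr (b + 1) * n" using bb apos by (intro bigb) linarith
        then have "1 \<le> y * (\<epsilon> * w)" unfolding yb using \<epsilon>w y mult_left_mono[OF \<epsilon>w, of y] by linarith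
        also have "\<dots> \<le> 1/256 * (\<epsilon> * w)" using y \<epsilon> by (intro mult_right_mono) auto
        finally show ?thesis by linarith
      qed
      have w1: "\<epsilon> * w / 32 \<le> w1" "w1 \<le> \<epsilon> * w / 16" "1 \<le> w1"
        using \<epsilon>w32 unfolding w1_def by linarith+
      have wg: "y powr g1 * n \<le> w1"
      proof -
        have "y powr g1 * n \<le> y powr (b + 1) * n"
          using bb y y1 n1 by (intro mult_right_mono powr_antimono) auto
        also have "\<dots> \<le> 1/32 * (y powr b * n)" unfolding yb using y n1 by (intro mult_right_mono) auto
        also have "\<dots> \<le> w1" using w1(1) \<epsilon>w by linarith
        finally show ?thesis .
      qed
      have inv: "1 \<le> 1 / \<epsilon>" using \<epsilon> by (simp add: field_simps)
      have yinv: "y powr (- a) = 1 / \<epsilon>" unfolding \<epsilon>_def by (simp add: powr_minus_divide)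
      have kw1: "real k * w1 \<le> w / 8"
      proof -
        have "real k * w1 \<le> (2 / \<epsilon>) * (\<epsilon> * w / 16)"
          using blocks(2) w1(2) \<epsilon> by (intro mult_mono) auto
        then show ?thesis using \<epsilon> by simp
      qed
      have "\<exists>Y\<subseteq>C i. conn_in (co (adj G)) Y \<and> card Y = w1" if i: "i < k" for i
      proof (rule anti_connected_subset_exists[of "C i" w1 y a g1])
        show "C i \<subseteq> verts G" using blocks(6) i TV by blast
        have "(y powr (- a) + 1) * (2 * real w1) \<le> (1 / \<epsilon> + 1 / \<epsilon>) * (2 * (\<epsilon> * w / 16))"
          unfolding yinv using inv w1 \<epsilon> by (intro mult_mono add_mono) auto
        also have "\<dots> = w / 4" using \<epsilon> by simp
        also have "\<dots> \<le> card (C i) / 2" using blocks(6) i by force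
        finally show "(y powr (- a) + 1) * (2 * real w1) \<le> real (card (C i)) / 2" .
        show "y powr g1 * real (card (verts G)) \<le> real w1" using wg n by simp
        show "c * g1 \<le> a" using \<kappa>(3) a by linarith
      qed (use y y1 a w1 in auto)
      then obtain Y where Y: "\<And>i. i < k \<Longrightarrow> Y i \<subseteq> C i \<and> conn_in (co (adj G)) (Y i) \<and> card (Y i) = w1"
        by metis
      have YT: "Y i \<subseteq> T" if "i < k" for i using Y[OF that] blocks(6) that by blast
      have finC: "finite (C i)" if "i < k" for i using blocks(6) that finT finite_subset by blast
      let ?H = "induced G T"
      define \<B> where "\<B> = map Y [0..<k]"
      have len: "length \<B> = k" and nth: "\<And>i. i < k \<Longrightarrow> \<B> ! i = Y i" and setB: "set \<B> = Y ` {..<k}"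
        by (auto simp: \<B>_def)
      have degH: "card (nbrs ?H v \<inter> X) = deg (adj G) v X" if "v \<in> T" "X \<subseteq> T" for v X
        using that by (subst nbrs_Int) (auto intro!: deg_cong simp: adj_induced)
      have sparse1: "(\<forall>x\<in>Y i. \<forall>y\<in>Y j. adj G x y) \<or>
          (\<forall>x\<in>Y i. real (card (nbrs ?H x \<inter> Y j)) \<le> y powr a * card (Y j))"
        if ij: "i < k" "j < k" "i \<noteq> j" for i j
      proof -
        have "(\<forall>x\<in>C i. \<forall>y\<in>C j. adj G x y) \<or> (\<forall>x\<in>C i. real (deg (adj G) x (C j)) \<le> \<epsilon> ^ 4 * w)"
          using blocks(7) ij by blast
        then show ?thesis
        proof
          assume "\<forall>x\<in>C i. \<forall>y\<in>C j. adj G x y"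
          then show ?thesis using Y ij by blast
        next
          assume d: "\<forall>x\<in>C i. real (deg (adj G) x (C j)) \<le> \<epsilon> ^ 4 * w"
          have "real (card (nbrs ?H x \<inter> Y j)) \<le> y powr a * card (Y j)" if x: "x \<in> Y i" for x
          proof -
            have "card (nbrs ?H x \<inter> Y j) = deg (adj G) x (Y j)"
              using degH x YT ij by blast
            also have "\<dots> \<le> deg (adj G) x (C j)" using Y ij finC by (intro deg_mono) auto
            finally have "real (card (nbrs ?H x \<inter> Y j)) \<le> \<epsilon> ^ 4 * w"
              using d x Y[OF ij(1)] by (meson of_nat_mono order_trans subsetD)
            also have "\<dots> = \<epsilon> ^ 3 * (\<epsilon> * w)" by (simp add: eval_nat_numeral)
            also have "\<dots> \<le> \<epsilon> ^ 3 * (32 * w1)" using w1 \<epsilon> by (intro mult_left_mono) auto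
            also have "\<dots> = (32 * \<epsilon> * \<epsilon>) * (\<epsilon> * w1)" by (simp add: eval_nat_numeral)
            also have "\<dots> \<le> 1 * (\<epsilon> * w1)"
            proof (rule mult_right_mono)
              have "\<epsilon> * \<epsilon> \<le> (1/16) * (1/16)" using \<epsilon> by (intro mult_mono) auto
              then show "32 * \<epsilon> * \<epsilon> \<le> 1" by linarith
            qed (use \<epsilon> in simp)
            finally show ?thesis using Y[OF ij(2)] by (simp add: \<epsilon>_def)
          qed
          then show ?thesis by blast
        qed
      qed
      have pw: "pairwise_blocks (\<lambda>B C. complete_to ?H B C \<or> sparse_pair ?H (y powr a) B C) \<B>"
        unfolding pairwise_blocks_def len
      proof (intro allI impI)
        fix i j assume ij: "i < k" "j < k" "i \<noteq> j"
        show "complete_to ?H (\<B> ! i) (\<B> ! j) \<or> sparse_pair ?H (y powr a) (\<B> ! i) (\<B> ! j)"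
        proof (cases "\<forall>x\<in>Y i. \<forall>y\<in>Y j. adj G x y")
          case True
          then have "complete_to ?H (\<B> ! i) (\<B> ! j)"
            using YT ij unfolding nth[OF ij(1)] nth[OF ij(2)] complete_to_def adj_induced by blast
          then show ?thesis ..
        next
          case False
          then have "\<not> (\<forall>x\<in>Y j. \<forall>y\<in>Y i. adj G x y)" using sym by (meson sympD)
          then have "sparse_pair ?H (y powr a) (\<B> ! i) (\<B> ! j)"
            using False sparse1[OF ij] sparse1[OF ij(2,1)] ij
            unfolding nth[OF ij(1)] nth[OF ij(2)] sparse_pair_def by metis
          then show ?thesis ..
        qed
      qed
      have blk: "blockade ?H (real k) (real w1) \<B>"
      proof -
        have "\<B> ! i \<subseteq> verts ?H \<and> real w1 \<le> real (card (\<B> ! i))" if "i < k" for i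
          using Y[OF that] YT[OF that] nth[OF that] by simp
        moreover have "\<B> ! i \<inter> \<B> ! j = {}" if "i < k" "j < k" "i \<noteq> j" for i j
        proof -
          have "C i \<inter> C j = {}" using blocks(7) that by blast
          then show ?thesis using Y[OF that(1)] Y[OF that(2)] nth[OF that(1)] nth[OF that(2)] by auto
        qed
        ultimately show ?thesis unfolding blockade_def len by simp
      qed
      have anti: "\<forall>B\<in>set \<B>. anti_connected ?H B"
      proof -
        have "anti_connected ?H (Y i)" if "i < k" for i
          using conn_in_imp_anti_connected[OF _ YT[OF that]] Y[OF that] by blast
        then show ?thesis unfolding setB by simp
      qed
      have cond: "length \<B> = k \<and> y powr (-a) \<le> real k \<and> blockade ?H (real k) (real w1) \<B> \<and>
           (\<forall>B\<in>set \<B>. anti_connected ?H B) \<and> (\<forall>B\<in>set \<B>. \<forall>C\<in>set \<B>. card B = card C) \<and>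
           pairwise_blocks (\<lambda>B C. complete_to ?H B C \<or> sparse_pair ?H (y powr a) B C) \<B>"
      proof (intro conjI len blk anti pw)
        show "y powr (-a) \<le> real k" using blocks(1) yinv by simp
        show "\<forall>B\<in>set \<B>. \<forall>C\<in>set \<B>. card B = card C" unfolding setB using Y by simp
      qed
      have yH: "0 < y \<and> y < 1/2 \<and> simple_graph ?H \<and> free (complement ` \<F>) ?H"
        using y simple_induced[OF simp TV] free_induced[OF free TV] by simp
      from wonder[rule_format, OF yH cond] consider (res) X where "X \<subseteq> verts ?H" "restricted ?H (y ^ 4) X" "real w1 \<le> real (card X)"
        | (few) i where "i < k" "real (card {v \<in> verts ?H - \<Union> (set \<B>).
                 0 < card (nbrs ?H v \<inter> \<B> ! i) \<and>
                 real (card (nbrs ?H v \<inter> \<B> ! i)) < 1/2 * real (card (\<B> ! i))})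
              \<le> y * real (order ?H)"
        by blast
      then show False
      proof cases
        case res
        have XT: "X \<subseteq> T" using res(1) by simp
        have "y ^ 4 \<le> y\<^sup>2" using y y1 by (intro power_decreasing) auto
        moreover have "y powr g1 * n \<le> card X" using wg res(3) by linarith
        moreover have "g1 \<le> 2 * D" using D apos unfolding g1 by linarith
        ultimately show False
          using found[OF XT _ _ _ ] res(2) unfolding restricted_induced[OF XT] by blast
      next
        case few
        define Bad where "Bad = {v \<in> T - \<Union> (set \<B>). 0 < deg (adj G) v (Y i) \<and> real (deg (adj G) v (Y i)) < 1/2 * w1}"
        have ordH: "order ?H = card T" by (simp add: order_def)
        have Yi: "Y i \<subseteq> T" "card (Y i) = w1" "finite (Y i)"
          using YT Y few(1) finT finite_subset by blast+
        have "{v \<in> verts ?H - \<Union> (set \<B>). 0 < card (nbrs ?H v \<inter> \<B> ! i) \<and>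
            real (card (nbrs ?H v \<inter> \<B> ! i)) < 1/2 * real (card (\<B> ! i))} = Bad"
          unfolding Bad_def nth[OF few(1)] Yi(2) using degH[OF _ Yi(1)] by auto
        then have bad: "real (card Bad) \<le> y * card T" using few(2) unfolding ordH by simp
        \<comment> \<open>Counting edges between \<open>High\<close> and \<open>Y i\<close> from
          both sides: each vertex of \<open>High\<close> sees half of \<open>Y i\<close>, each
          vertex of \<open>Y i\<close> at most \<open>y * card S\<close> vertices.\<close>
        define High where "High = {v\<in>T. real w1 \<le> 2 * real (deg (adj G) v (Y i))}"
        have finH: "finite High" using finT by (simp add: High_def)
        have high: "real (card High) \<le> 2 * y * card S"
        proof -
          have "real (card High) * w1 = (\<Sum>v\<in>High. real w1)" by simp
          also have "\<dots> \<le> (\<Sum>v\<in>High. 2 * real (deg (adj G) v (Y i)))"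
            by (intro sum_mono) (simp add: High_def)
          also have "\<dots> = 2 * edge_count (adj G) High (Y i)"
            by (simp add: edge_count_def sum_distrib_left)
          also have "edge_count (adj G) High (Y i) = edge_count (adj G) (Y i) High"
            by (rule edge_count_sym[OF finH Yi(3) sym])
          also have "\<dots> \<le> (\<Sum>u\<in>Y i. y * card S)"
            unfolding edge_count_def
          proof (rule sum_mono)
            fix u assume "u \<in> Y i"
            then have "u \<in> S" using Yi(1) T(1) by blast
            then have "real (deg (adj G) u S) \<le> y * card S" using S(2) unfolding sparse_in_def by blast
            moreover have "deg (adj G) u High \<le> deg (adj G) u S"
              using finT T(1) by (intro deg_mono) (auto simp: High_def)
            ultimately show "real (deg (adj G) u High) \<le> y * card S" by linarith
          qed
          also have "\<dots> = w1 * (y * card S)" using Yi by simp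
          finally have "real (card High) * w1 \<le> 2 * y * card S * w1" by (simp add: mult_ac)
          then show ?thesis using w1(3) by (simp add: mult_le_cancel_right)
        qed
        have union: "real (card (\<Union> (set \<B>))) \<le> y * card S"
        proof -
          have "card (\<Union> (set \<B>)) \<le> (\<Sum>j<k. card (Y j))"
            unfolding setB by (rule card_UN_le) simp
          also have "\<dots> = k * w1" using Y by simp
          finally have "real (card (\<Union> (set \<B>))) \<le> real (k * w1)" by (rule of_nat_mono)
          also have "\<dots> = real k * w1" by simp
          also have "\<dots> \<le> w / 8" by (rule kw1)
          also have "\<dots> \<le> w / 2" by simp
          \<comment> \<open>Both terms of \<open>w \<le> \<epsilon> powr c1 * card T + 1\<close> are
            at most \<open>y * card T\<close>.\<close>
          also have "\<dots> \<le> y * card T"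
          proof -
            have "a * c1 \<ge> 1" using a cs mult_mono[of 6 a 3 c1] by simp
            then have "\<epsilon> powr c1 \<le> y powr 1" unfolding \<epsilon>p using y y1 by (intro powr_antimono) auto
            then have "\<epsilon> powr c1 * card T \<le> y * card T" using y by (intro mult_right_mono) auto
            moreover have "1 \<le> y * card T"
            proof -
              have "1 \<le> y powr (D + 2) * n"
              proof (rule bigb)
                have "0 \<le> a * (c1 + 3)" using a cs by simp
                then show "D + 2 \<le> a * c3 + g1 + 1" using apos unfolding g1 by linarith
              qed
              also have "y powr (D + 2) * n = y * (y powr (D + 1) * n)"
                using powr_mult_eq[of 1 "D + 1" "D + 2" y] y by simp
              also have "\<dots> \<le> y * card T" using cT y by (intro mult_left_mono) auto
              finally show ?thesis .
            qed
            ultimately show ?thesis using blocks(4) by linarith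
          qed
          also have "\<dots> \<le> y * card S" using TS y by (intro mult_left_mono) auto
          finally show ?thesis .
        qed
        \<comment> \<open>A vertex of \<open>T\<close> outside \<open>B\<close> lies in a block, is
          mixed on \<open>Y i\<close>, or sees at least half of it. The three costs
          \<open>y\<close>, \<open>y\<close> and \<open>2 * y\<close> give the \<open>4 * y\<close>
          used for peeling.\<close>
        define B where "B = {v \<in> T - \<Union> (set \<B>). deg (adj G) v (Y i) = 0}"
        have "T - B \<subseteq> \<Union> (set \<B>) \<union> (Bad \<union> High)"
          unfolding B_def Bad_def High_def by auto
        moreover have "finite (\<Union> (set \<B>) \<union> (Bad \<union> High))"
          using finH finT YT by (auto simp: setB Bad_def intro: finite_subset)
        ultimately have "card (T - B) \<le> card (\<Union> (set \<B>) \<union> (Bad \<union> High))" by (intro card_mono)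
        also have "\<dots> \<le> card (\<Union> (set \<B>)) + (card Bad + card High)"
          by (meson card_Un_le add_left_mono order_trans)
        finally have "real (card (T - B)) \<le> card (\<Union> (set \<B>)) + (real (card Bad) + card High)"
          by linarith
        also have "\<dots> \<le> y * card S + (y * card S + 2 * y * card S)"
        proof -
          have "y * card T \<le> y * card S" using TS y by (intro mult_left_mono) auto
          then show ?thesis using union bad high by linarith
        qed
        also have "\<dots> = 4 * y * card S" by simp
        finally have TB: "real (card (T - B)) \<le> 4 * y * card S" .
        have BT: "B \<subseteq> T" by (auto simp: B_def)
        have coB: "co (adj G) x v" if "x \<in> Y i" "v \<in> B" for x v
        proof -
          have "v \<notin> Y i" using that few(1) unfolding B_def setB by blast
          moreover have "{u\<in>Y i. adj G v u} = {}"
            using that Yi(3) unfolding B_def deg_def by simp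
          then have "\<not> adj G v x" using that(1) by blast
          then have "\<not> adj G x v" using sym by (meson sympD)
          ultimately show ?thesis using that(1) unfolding co_def by blast
        qed
        have gY: "y powr g1 * card (verts G) \<le> card (Y i)" using wg Yi(2) n by simp
        show False
          by (rule notE[OF none], intro exI[of _ "Y i"] exI[of _ B] conjI ballI Yi(1) BT coB gY TB)
      qed
    qed
  qed
  show ?thesis
  proof (rule exI[of _ "1/256"], rule conjI[OF _ exI[of _ "a * (c1 + 3) + a * c8 + 1"]], simp, intro allI impI)
    fix D :: real assume D: "a * (c1 + 3) + a * c8 + 1 \<le> D"
    define g1 where "g1 = a * (c1 + 3) + D + 1"
    have g0: "0 < g1"
    proof -
      have "0 \<le> a * (c1 + 3)" "0 \<le> a * c8" using a cs by auto
      then show ?thesis using D unfolding g1_def by linarith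
    qed
    have d0: "0 < c5 + (D + 1) / a"
    proof -
      have "0 \<le> a * (c1 + 3)" "0 \<le> a * c8" using a cs by auto
      then have "0 \<le> (D + 1) / a" using D a by (intro divide_nonneg_pos) linarith+
      then show ?thesis using cs by linarith
    qed
    define \<kappa> where "\<kappa> = min (c4 / 2) (min (1 / (c5 + (D + 1) / a)) (1 / (2 * g1)))"
    have \<kappa>0: "0 < \<kappa>" using cs g0 d0 by (simp add: \<kappa>_def)
    have \<kappa>: "c \<le> c4 / 2" "c * (c5 + (D + 1) / a) \<le> 1" "c * g1 \<le> 1/2" if "c \<le> \<kappa>" for c
      using that g0 d0 unfolding \<kappa>_def by (auto simp: pos_le_divide_eq mult.commute)
    show "\<exists>e \<kappa>. 0 < \<kappa> \<and> step_at \<F> (\<lambda>G y S. sparse_in (adj G) y S) (1/256) D e \<kappa>"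
      unfolding step_at_def
    proof (rule exI[of _ "a * c3 + g1 + 1"], rule exI[of _ "\<kappa>"], intro conjI \<kappa>0 allI impI)
      fix G :: "nat graph" and c y :: real and S
      assume *: "simple_graph G" "free (complement ` \<F>) G" "critical (adj G) (verts G) c" "c \<le> \<kappa>"
        "0 < y" "y \<le> 1/256" "1 \<le> y powr (a * c3 + g1 + 1) * real (order G) powr (1/2)"
        "S \<subseteq> verts G" "sparse_in (adj G) y S" "y powr D * order G \<le> card S"
      show "\<exists>U\<subseteq>verts G. restricted_in (adj G) (y\<^sup>2) U \<and> y powr (2 * D) * order G \<le> card U"
        by (rule main[OF D g1_def *(1-3) \<kappa>[OF *(4)] *(5-10)])
    qed
  qed
qed

section \<open>Sparsifying cosparse sets\<close>

text \<open>\<open>b\<close> takes the role of the leaf \<open>v\<close>: its only neighbour in the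
  copy \<open>Z\<close> of \<open>H - v\<close> is the vertex in the role of
  \<open>u\<close>.\<close>

lemma extend_by_leaf:
  assumes J: "simple_graph J" and H: "simple_graph H" and v: "v \<in> verts H" "nbrs H v = {u}"
    and f: "bij_betw f Z (verts H - {v})" "Z \<subseteq> verts J"
      "\<And>x y. x \<in> Z \<Longrightarrow> y \<in> Z \<Longrightarrow> adj J x y \<longleftrightarrow> adj H (f x) (f y)"
    and a: "a \<in> Z" "f a = u" and b: "b \<in> verts J" "b \<notin> Z" "\<And>z. z \<in> Z \<Longrightarrow> adj J z b \<longleftrightarrow> z = a"
  shows "isomorphic (induced J (insert b Z)) H"
proof -
  define f' where "f' = f(b := v)"
  have eqf: "\<And>z. z \<in> Z \<Longrightarrow> f' z = f z" "f' b = v" using b(2) by (auto simp: f'_def)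
  have "bij_betw f' Z (verts H - {v})"
    using f(1) by (rule bij_betw_cong[THEN iffD1, rotated]) (simp add: eqf)
  moreover have "bij_betw f' {b} {v}" using eqf(2) by (simp add: bij_betw_def)
  ultimately have "bij_betw f' (Z \<union> {b}) ((verts H - {v}) \<union> {v})"
    by (rule bij_betw_combine) auto
  then have bij: "bij_betw f' (insert b Z) (verts H)" using v(1) by (simp add: insert_absorb)
  have fz: "f z \<in> verts H" "f z \<noteq> v" if "z \<in> Z" for z
    using f(1) that unfolding bij_betw_def by auto
  have av: "adj H v x \<longleftrightarrow> x = u" if "x \<in> verts H" for x
    using v(2) that unfolding nbrs_def by blast
  have inj: "f z = f a \<longleftrightarrow> z = a" if "z \<in> Z" for z
    using f(1) a(1) that unfolding bij_betw_def inj_on_def by blast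
  have one: "adj J z b \<longleftrightarrow> adj H (f z) v" if "z \<in> Z" for z
  proof -
    have "adj H (f z) v \<longleftrightarrow> adj H v (f z)" using symp_adj by (meson sympD)
    then show ?thesis using av[OF fz(1)[OF that]] inj[OF that] b(3)[OF that] a(2) by simp
  qed
  have "adj J x y \<longleftrightarrow> adj H (f' x) (f' y)" if xy: "x \<in> insert b Z" "y \<in> insert b Z" for x y
  proof -
    consider "x = b" "y = b" | "x = b" "y \<in> Z" | "x \<in> Z" "y = b" | "x \<in> Z" "y \<in> Z"
      using xy by blast
    then show ?thesis
    proof cases
      case 1
      then show ?thesis using irreflp_adj[OF J] irreflp_adj[OF H] by (auto simp: irreflp_def)
    next
      case 2
      then show ?thesis using one[OF 2(2)] eqf symp_adj by (metis sympD)
    next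
      case 3
      then show ?thesis using one[OF 3(1)] eqf by simp
    next
      case 4
      then show ?thesis using f(3) eqf by simp
    qed
  qed
  then show ?thesis
    unfolding isomorphic_def using bij by (intro exI[of _ f']) (simp add: adj_induced)
qed

text \<open>The argument takes place in the complement \<open>J\<close>, which is
  \<open>\<F>\<close>-free and in which \<open>S\<close> is sparse. A candidate for \<open>u\<close>
  that is \<open>J\<close>-adjacent to an outside vertex not seen by the rest of its copy would
  complete \<open>H\<close>. So the candidates are complete in \<open>G\<close> to nearly all of
  \<open>T\<close>, a forbidden peeling step.\<close>

lemma cosparse_step:
  fixes \<F> :: "nat graph set"
  assumes simF: "\<forall>F\<in>\<F>. simple_graph F" and leaf: "leaf_reducible \<F>"
  shows "\<exists>y1>0. \<exists>D0. \<forall>D\<ge>D0. \<exists>e \<kappa>. 0 < \<kappa> \<and> step_at \<F> (\<lambda>G y S. sparse_in (co (adj G)) y S) y1 D e \<kappa>"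
proof -
  obtain H v where H: "H \<in> \<F>" "v \<in> verts H" "card (nbrs H v) = 1"
    and eh: "erdos_hajnal ((\<F> - {H}) \<union> {del_vertex H v})"
    using leaf unfolding leaf_reducible_def by blast
  have simH: "simple_graph H" using H simF by blast
  obtain u where u: "nbrs H v = {u}" using H(3) by (meson card_1_singletonE)
  have uH: "u \<in> verts H" "u \<noteq> v"
    using u irreflp_adj[OF simH] unfolding nbrs_def irreflp_def by auto
  have finH: "finite (verts H)" using simH by (simp add: simple_graph_def)
  define s where "s = card (verts H - {v})"
  have "0 < s" unfolding s_def using uH finH by (auto simp: card_gt_0_iff)
  then obtain r where r: "s = Suc r" using gr0_conv_Suc by blast
  obtain c0 where c0: "0 < c0" and ehc: "\<And>G :: nat graph. simple_graph G \<Longrightarrow>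
      free ((\<F> - {H}) \<union> {del_vertex H v}) G \<Longrightarrow>
      \<exists>X. (clique G X \<or> stable G X) \<and> real (order G) powr c0 \<le> real (card X)"
    using eh unfolding erdos_hajnal_def by blast
  obtain p y1 where p: "1 \<le> p" and y1: "0 < y1" and
    viral: "\<forall>y (E :: nat \<Rightarrow> nat \<Rightarrow> bool) T \<C>.
    0 < y \<longrightarrow> y \<le> y1 \<longrightarrow> symp E \<longrightarrow> irreflp E \<longrightarrow> finite T \<longrightarrow> y powr (- p) \<le> card T \<longrightarrow>
    (\<forall>Z\<in>\<C>. Z \<subseteq> T \<and> card Z = s) \<longrightarrow>
    (\<forall>U\<subseteq>T. (\<forall>Z\<in>\<C>. \<not> Z \<subseteq> U) \<longrightarrow>
       (\<exists>X\<subseteq>U. (clique_in E X \<or> clique_in (co E) X) \<and> real (card U) powr c0 \<le> card X)) \<longrightarrow>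
    (\<exists>U\<subseteq>T. restricted_in E (y\<^sup>2) U \<and> y powr p * card T \<le> card U) \<or> y powr p * card T ^ s \<le> card \<C>"
    using viral[where 'a = nat, OF c0, of s]
    apply -
    apply (elim exE conjE)
    subgoal premises q for p y1
      by (rule that[of p y1]) (rule q)+
    done
  \<comment> \<open>Makes \<open>(y powr (- (1/2)) + 1) * \<delta> \<le> 4 * (1 + r) * y powr (1/2)
    \<le> 1/2\<close> for the \<open>\<delta>\<close> below.\<close>
  define y2 where "y2 = min y1 (1 / (64 * (1 + real r)\<^sup>2))"
  have y2: "0 < y2" using y1 by (simp add: y2_def)
  \<comment> \<open>Candidate sets and restricted subsets of \<open>T\<close> have size at least
    \<open>y powr p * card T\<close>, hence at least \<open>y powr g * n\<close>;
    \<open>p + 1 \<le> D\<close> means \<open>g \<le> 2 * D\<close>.\<close>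
  have main: "\<exists>U\<subseteq>verts G. restricted_in (adj G) (y\<^sup>2) U \<and> y powr (2 * D) * order G \<le> card U"
    if D: "p + 1 \<le> D" and g: "g = p + D + 1"
      and simp: "simple_graph G" and free: "free (complement ` \<F>) G"
      and crit: "critical (adj G) (verts G) c" and cg: "c * g \<le> 1/2"
      and yy: "0 < y" "y \<le> y2"
      and big: "1 \<le> y powr g * real (order G) powr (1/2)"
      and S: "S \<subseteq> verts G" "sparse_in (co (adj G)) y S" and size: "y powr D * order G \<le> card S"
    for G :: "nat graph" and c y D g :: real and S
  proof (rule ccontr)
    assume goal: "\<not> ?thesis"
    interpret critical "adj G" "verts G" c by (rule crit)
    define n where "n = real (order G)"
    have n: "n = real (card (verts G))" by (simp add: n_def order_def)
    have n1: "1 \<le> n" using card_V_pos n by linarith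
    have yr: "y \<le> 1 / (64 * (1 + real r)\<^sup>2)" and yy1: "y \<le> y1" using yy by (auto simp: y2_def)
    have y64: "y \<le> 1/64"
    proof -
      have "1 \<le> (1 + real r)\<^sup>2" by (simp add: one_le_power)
      then have "1 / (64 * (1 + real r)\<^sup>2) \<le> 1/64" by (simp add: field_simps)
      then show ?thesis using yr by linarith
    qed
    have y: "0 < y" "y < 1" "y \<le> 1" using yy y64 by auto
    \<comment> \<open>The removed vertices: at most \<open>2 * y * card S\<close> candidates,
      \<open>r\<close> fixed vertices (with \<open>1 \<le> y * card S\<close>), and the
      \<open>J\<close>-neighbours of the fixed ones, at most \<open>r * y * card S\<close>.\<close>
    define \<delta> where "\<delta> = 2 * (1 + real r) * y"
    have \<delta>: "0 \<le> \<delta>" "(y powr (- (1/2)) + 1) * \<delta> \<le> 1/2"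
    proof -
      show "0 \<le> \<delta>" using y by (simp add: \<delta>_def)
      define z where "z = y powr (1/2)"
      have zz: "z * z = y" unfolding z_def using powr_mult_eq[of "1/2" "1/2" 1 y] y by simp
      have zi: "y powr (- (1/2)) * y = z"
        unfolding z_def using powr_mult_eq[of "-(1/2)" 1 "1/2" y] y by simp
      have z0: "0 < z" using y by (simp add: z_def)
      have "z \<le> 1 / (8 * (1 + real r))"
      proof (rule power2_le_imp_le)
        show "z\<^sup>2 \<le> (1 / (8 * (1 + real r)))\<^sup>2"
        proof -
          have "(1 / (8 * (1 + real r)))\<^sup>2 = 1 / (64 * (1 + real r)\<^sup>2)"
            unfolding power_divide power_mult_distrib by simp
          then show ?thesis using yr zz by (simp only: power2_eq_square[of z])
        qed
      qed simp
      then have z8: "(1 + real r) * z \<le> 1/8" by (simp add: field_simps)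
      have "y \<le> z" unfolding z_def using powr_antimono[of y "1/2" 1] y by simp
      have "(y powr (- (1/2)) + 1) * \<delta> = 2 * (1 + real r) * (y powr (- (1/2)) * y + y)"
        by (simp add: \<delta>_def algebra_simps)
      also have "\<dots> \<le> 2 * (1 + real r) * (z + z)"
        unfolding zi using \<open>y \<le> z\<close> by (intro mult_left_mono) auto
      also have "\<dots> = 4 * ((1 + real r) * z)" by simp
      also have "\<dots> \<le> 1/2" using z8 by linarith
      finally show "(y powr (- (1/2)) + 1) * \<delta> \<le> 1/2" .
    qed
    have half: "(0::real) < 1/2" by simp
    obtain T where T: "T \<subseteq> S" "card S \<le> 2 * card T" and none:
      "\<not> (\<exists>A B. A \<subseteq> T \<and> B \<subseteq> T \<and> (\<forall>x\<in>A. \<forall>y\<in>B. adj G x y) \<and>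
        y powr g * card (verts G) \<le> card A \<and> real (card (T - B)) \<le> \<delta> * card S)"
      by (rule unpeelable_subset[OF S(1) disjI1[OF refl] y(1,2) half \<delta> cg])
    have TV: "T \<subseteq> verts G" using T S by blast
    have finT: "finite T" "finite S" using TV S fin finite_subset by blast+
    have TS: "card T \<le> card S" using T(1) finT by (intro card_mono)
    have cT: "y powr (D + 1) * n \<le> card T"
      by (rule size_of_half[OF y(1) _ _ T(2)]) (use y64 size n_def in auto)
    have gn: "1 \<le> y powr g * n"
      using big_power(2)[OF y(1,3) n1 _ order.refl] big unfolding n_def by blast
    have gT: "y powr g * n \<le> y powr p * card T"
    proof -
      have "y powr g * n = y powr p * (y powr (D + 1) * n)"
        unfolding g by (simp add: powr_add)
      also have "\<dots> \<le> y powr p * card T" using cT by (intro mult_left_mono) auto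
      finally show ?thesis .
    qed
    have pT: "1 \<le> y powr p * card T" using gn gT by linarith
    have Tbig: "y powr (- p) \<le> card T"
    proof -
      have "y powr (- p) * 1 \<le> y powr (- p) * (y powr p * card T)"
        using pT by (intro mult_left_mono) auto
      also have "\<dots> = card T" using y by (simp add: powr_minus)
      finally show ?thesis by simp
    qed
    let ?J = "complement G" and ?R = "co (adj G)"
    have simJ: "simple_graph ?J" by (rule simple_complement[OF simp])
    have freeJ: "free \<F> ?J" using free free_complement_iff[OF simp simF] by blast
    have J: "adj ?J x z \<longleftrightarrow> ?R x z" if "x \<in> verts G" "z \<in> verts G" for x z
      using that by (simp add: adj_complement)
    define \<C> where "\<C> = {Z. Z \<subseteq> T \<and> card Z = s \<and> isomorphic (induced ?J Z) (del_vertex H v)}"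
    have C1: "\<forall>Z\<in>\<C>. Z \<subseteq> T \<and> card Z = s" by (auto simp: \<C>_def)
    have C2: "\<exists>X\<subseteq>U. (clique_in ?R X \<or> clique_in (co ?R) X) \<and> real (card U) powr c0 \<le> card X"
      \<comment> \<open>A set without a copy of \<open>H - v\<close> is free of the smaller class:
        the other members are excluded because \<open>J\<close> is \<open>\<F>\<close>-free.\<close>
      if U: "U \<subseteq> T" "\<forall>Z\<in>\<C>. \<not> Z \<subseteq> U" for U
    proof -
      have UV: "U \<subseteq> verts ?J" using U(1) TV by auto
      have "free ((\<F> - {H}) \<union> {del_vertex H v}) (induced ?J U)"
        unfolding free_def
      proof (intro notI)
        assume "\<exists>X\<subseteq>verts (induced ?J U). \<exists>F\<in>\<F> - {H} \<union> {del_vertex H v}. isomorphic (induced (induced ?J U) X) F"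
        then obtain X F where XF: "X \<subseteq> U" "F \<in> \<F> - {H} \<union> {del_vertex H v}" "isomorphic (induced ?J X) F"
          using induced_induced by (metis verts_induced)
        show False
        proof (cases "F \<in> \<F>")
          case True
          then show False using freeJ XF UV unfolding free_def by (meson order_trans)
        next
          case False
          then have iso: "isomorphic (induced ?J X) (del_vertex H v)" using XF by blast
          then have "card X = s"
            unfolding isomorphic_def s_def del_vertex_def using bij_betw_same_card by fastforce
          then have "X \<in> \<C>" unfolding \<C>_def using iso XF(1) U(1) by blast
          then show False using U(2) XF(1) by blast
        qed
      qed
      from ehc[OF simple_induced[OF simJ UV] this] obtain X where
        X: "clique (induced ?J U) X \<or> stable (induced ?J U) X" "real (card U) powr c0 \<le> real (card X)"
        by (auto simp: order_def)
      have XU: "X \<subseteq> U" using X(1) by (auto simp: clique_def stable_def)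
      have adjX: "adj (induced ?J U) x z \<longleftrightarrow> ?R x z" if "x \<in> X" "z \<in> X" for x z
      proof -
        have "x \<in> U" "z \<in> U" "x \<in> verts G" "z \<in> verts G" using that XU UV by auto
        then show ?thesis using J by (simp add: adj_induced)
      qed
      have "clique_in ?R X \<or> clique_in (co ?R) X"
        using X(1) unfolding clique_def stable_def clique_in_def using adjX by (auto simp: co_def[of ?R])
      then show ?thesis using X(2) XU by blast
    qed
    have "(\<exists>U\<subseteq>T. restricted_in ?R (y\<^sup>2) U \<and> y powr p * card T \<le> card U) \<or> y powr p * card T ^ s \<le> card \<C>"
      by (rule viral[THEN spec[of _ y], THEN spec[of _ ?R], THEN spec[of _ T], THEN spec[of _ \<C>],
            THEN mp, OF y(1), THEN mp, OF yy1, THEN mp, OF symp_co[OF sym], THEN mp, OF irreflp_co,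
            THEN mp, OF finT(1), THEN mp, OF Tbig, THEN mp, OF C1, THEN mp])
        (use C2 in blast)
    then show False
    proof
      assume "\<exists>U\<subseteq>T. restricted_in ?R (y\<^sup>2) U \<and> y powr p * card T \<le> card U"
      then obtain U where U: "U \<subseteq> T" "restricted_in ?R (y\<^sup>2) U" "y powr p * card T \<le> card U" by blast
      have "y powr (2 * D) * n \<le> y powr g * n"
        using D y n1 unfolding g by (intro mult_right_mono powr_antimono) auto
      then have "y powr (2 * D) * n \<le> card U" using gT U(3) by linarith
      then show False using goal U(1,2) TV restricted_in_co[OF irr] unfolding n_def by blast
    next
      assume many: "y powr p * card T ^ s \<le> card \<C>"
      have Tpos: "0 < card T" using pT by (cases "card T = 0") auto
      then have "0 < y powr p * card T ^ s" using y by simp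
      then have pos: "0 < card \<C>" using many by linarith
      have "\<exists>f. bij_betw f Z (verts H - {v}) \<and>
          (\<forall>x\<in>Z. \<forall>z\<in>Z. adj ?J x z \<longleftrightarrow> adj H (f x) (f z))" if "Z \<in> \<C>" for Z
      proof -
        have "isomorphic (induced ?J Z) (del_vertex H v)" using that by (simp add: \<C>_def)
        then obtain f where "bij_betw f (verts (induced ?J Z)) (verts (del_vertex H v))"
          "\<forall>x\<in>verts (induced ?J Z). \<forall>z\<in>verts (induced ?J Z).
            adj (induced ?J Z) x z \<longleftrightarrow> adj (del_vertex H v) (f x) (f z)"
          unfolding isomorphic_def by blast
        then have f: "bij_betw f Z (verts H - {v})"
          "\<forall>x\<in>Z. \<forall>z\<in>Z. adj (induced ?J Z) x z \<longleftrightarrow> adj (del_vertex H v) (f x) (f z)"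
          by (simp_all add: del_vertex_def)
        have "f x \<in> verts H - {v}" if "x \<in> Z" for x using f(1) that unfolding bij_betw_def by blast
        then have "\<forall>x\<in>Z. \<forall>z\<in>Z. adj ?J x z \<longleftrightarrow> adj H (f x) (f z)"
          using f(2) by (simp add: del_vertex_def adj_induced)
        then show ?thesis using f(1) by blast
      qed
      then obtain f where f: "\<And>Z. Z \<in> \<C> \<Longrightarrow> bij_betw (f Z) Z (verts H - {v})"
          "\<And>Z x z. Z \<in> \<C> \<Longrightarrow> x \<in> Z \<Longrightarrow> z \<in> Z \<Longrightarrow> adj ?J x z \<longleftrightarrow> adj H (f Z x) (f Z z)"
        by metis
      define w where "w Z = inv_into Z (f Z) u" for Z
      have w: "w Z \<in> Z" "f Z (w Z) = u" if "Z \<in> \<C>" for Z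
      proof -
        have "u \<in> f Z ` Z" using f(1)[OF that] uH unfolding bij_betw_def by blast
        then show "w Z \<in> Z" "f Z (w Z) = u" unfolding w_def by (rule inv_into_into, rule f_inv_into_f)
      qed
      have C1': "Z \<subseteq> T \<and> card Z = Suc r" if "Z \<in> \<C>" for Z using C1 that r by simp
      have many': "y powr p * real (card T) ^ Suc r \<le> card \<C>" using many r by simp
      obtain X A where X: "X \<subseteq> T" "card X = r" and A: "A \<subseteq> T" "y powr p * card T \<le> card A"
        "\<And>a. a \<in> A \<Longrightarrow> a \<notin> X \<and> insert a X \<in> \<C> \<and> w (insert a X) = a"
        by (rule many_copies_share_rest[OF finT(1) C1' w(1) many' pos]) auto
      \<comment> \<open>The set of candidates may be too large to be discarded from
        \<open>T\<close>, so it is cut down to the least size that still counts for peeling.\<close>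
      define m where "m = nat \<lceil>y powr p * card T\<rceil>"
      have mA: "m \<le> card A" using A(2) unfolding m_def by (simp add: ceiling_le_iff)
      have m: "y powr p * card T \<le> m" "real m \<le> y powr p * card T + 1"
        unfolding m_def using pT by linarith+
      obtain A' where A': "A' \<subseteq> A" "card A' = m" using obtain_subset_with_card_n[OF mA] by blast
      define N where "N = (\<Union>x\<in>X. {b\<in>T. ?R x b})"
      define B where "B = T - (A' \<union> X \<union> N)"
      have yS: "1 \<le> y * card S" "y powr p * card T \<le> y * card S"
      proof -
        have "y powr p \<le> y powr 1" using y p by (intro powr_antimono) auto
        then have "y powr p * card T \<le> y * card S"
          using TS y by (intro mult_mono) auto
        then show "y powr p * card T \<le> y * card S" "1 \<le> y * card S" using pT by linarith+
      qed
      have finX: "finite X" using X(1) finT finite_subset by blast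
      have cN: "real (card N) \<le> real r * (y * card S)"
      proof -
        have "card N \<le> (\<Sum>x\<in>X. card {b\<in>T. ?R x b})" unfolding N_def by (rule card_UN_le[OF finX])
        then have "real (card N) \<le> real (\<Sum>x\<in>X. card {b\<in>T. ?R x b})" by (rule of_nat_mono)
        also have "\<dots> = (\<Sum>x\<in>X. real (deg ?R x T))" by (simp add: deg_def)
        also have "\<dots> \<le> (\<Sum>x\<in>X. y * card S)"
        proof (rule sum_mono)
          fix x assume "x \<in> X"
          then have "x \<in> S" using X(1) T(1) by blast
          then have "real (deg ?R x S) \<le> y * card S" using S(2) unfolding sparse_in_def by blast
          moreover have "deg ?R x T \<le> deg ?R x S" using finT T(1) by (intro deg_mono)
          ultimately show "real (deg ?R x T) \<le> y * card S" by linarith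
        qed
        also have "\<dots> = real r * (y * card S)" using X(2) by simp
        finally show ?thesis .
      qed
      have "card (T - B) \<le> card (A' \<union> X \<union> N)"
      proof (rule card_mono)
        show "finite (A' \<union> X \<union> N)"
          using A' A(1) finT finX unfolding N_def by (auto intro: finite_subset)
      qed (auto simp: B_def)
      also have "\<dots> \<le> card A' + card X + card N"
        by (meson card_Un_le add_right_mono order_trans)
      finally have "real (card (T - B)) \<le> real m + real r + real (card N)"
        unfolding A'(2) X(2) by linarith
      also have "\<dots> \<le> (y * card S + y * card S) + real r * (y * card S) + real r * (y * card S)"
      proof -
        have "real r * 1 \<le> real r * (y * card S)" using yS(1) by (intro mult_left_mono) auto
        then show ?thesis using m(2) yS cN by linarith
      qed
      also have "\<dots> = \<delta> * card S" by (simp add: \<delta>_def algebra_simps)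
      finally have TB: "real (card (T - B)) \<le> \<delta> * card S" .
      have AB: "adj G a b" if ab: "a \<in> A'" "b \<in> B" for a b
      proof (rule ccontr)
        assume nab: "\<not> adj G a b"
        let ?Z = "insert a X"
        have aA: "a \<in> A" using ab A' by blast
        have Z: "?Z \<in> \<C>" "w ?Z = a" using A(3)[OF aA] by auto
        have ZT: "?Z \<subseteq> T" using C1 Z(1) by blast
        have bT: "b \<in> T" "b \<notin> ?Z" "\<And>x. x \<in> X \<Longrightarrow> \<not> ?R x b"
          using ab unfolding B_def N_def by auto
        have Rab: "?R a b" using nab bT(2) by (auto simp: co_def)
        have "isomorphic (induced ?J (insert b ?Z)) H"
        proof (rule extend_by_leaf[OF simJ simH H(2) u f(1)[OF Z(1)]])
          show "?Z \<subseteq> verts ?J" using ZT TV by auto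
          show "b \<in> verts ?J" using bT TV by auto
          show "f ?Z a = u" using w(2)[OF Z(1)] Z(2) by simp
          show "adj ?J z b \<longleftrightarrow> z = a" if "z \<in> ?Z" for z
          proof -
            have "z \<in> verts G" "b \<in> verts G" using that ZT TV bT(1) by blast+
            then show ?thesis using J Rab bT(3) that A(3)[OF aA] by auto
          qed
        qed (use f(2)[OF Z(1)] bT in auto)
        moreover have "insert b ?Z \<subseteq> verts ?J" using ZT TV bT by auto
        ultimately show False using freeJ H(1) unfolding free_def by blast
      qed
      have sub: "A' \<subseteq> T" "B \<subseteq> T" using A' A(1) by (auto simp: B_def)
      have gA: "y powr g * card (verts G) \<le> card A'" using gT m(1) A'(2) n by simp
      show False
        by (rule notE[OF none], intro exI[of _ A'] exI[of _ B] conjI ballI sub AB gA TB)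
    qed
  qed
  show ?thesis
  proof (rule exI[of _ y2], rule conjI[OF y2 exI[of _ "p + 1"]], intro allI impI)
    fix D :: real assume D: "p + 1 \<le> D"
    define g where "g = p + D + 1"
    have g0: "0 < g" using D p by (simp add: g_def)
    have \<kappa>: "c * g \<le> 1/2" if "c \<le> 1 / (2 * g)" for c
      using that g0 by (simp add: pos_le_divide_eq mult.commute)
    have \<kappa>0: "0 < 1 / (2 * g)" using g0 by simp
    show "\<exists>e \<kappa>. 0 < \<kappa> \<and> step_at \<F> (\<lambda>G y S. sparse_in (co (adj G)) y S) y2 D e \<kappa>"
      unfolding step_at_def
    proof (rule exI[of _ "g"], rule exI[of _ "1 / (2 * g)"], intro conjI \<kappa>0 allI impI)
      fix G :: "nat graph" and c y :: real and S
      assume *: "simple_graph G" "free (complement ` \<F>) G" "critical (adj G) (verts G) c" "c \<le> 1 / (2 * g)"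
        "0 < y" "y \<le> y2" "1 \<le> y powr (g) * real (order G) powr (1/2)"
        "S \<subseteq> verts G" "sparse_in (co (adj G)) y S" "y powr D * order G \<le> card S"
      show "\<exists>U\<subseteq>verts G. restricted_in (adj G) (y\<^sup>2) U \<and> y powr (2 * D) * order G \<le> card U"
        by (rule main[OF D g_def *(1-3) \<kappa>[OF *(4)] *(5-10)])
    qed
  qed
qed

section \<open>The iteration\<close>

text \<open>The union of blocks obtained at scale \<open>\<epsilon>\<close> is only
  \<open>4 * \<epsilon>\<close>-sparse, and the size is expressed in that parameter because the
  iteration starts from it.\<close>

definition start_at :: "nat graph set \<Rightarrow> real \<Rightarrow> real \<Rightarrow> real \<Rightarrow> real \<Rightarrow> bool" where
  "start_at \<F> \<epsilon> D e \<kappa> \<longleftrightarrow> (\<forall>(G :: nat graph) c.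
     simple_graph G \<longrightarrow> free (complement ` \<F>) G \<longrightarrow> critical (adj G) (verts G) c \<longrightarrow> c \<le> \<kappa> \<longrightarrow>
     1 \<le> \<epsilon> powr e * real (order G) powr (1/2) \<longrightarrow>
     (\<exists>U\<subseteq>verts G. restricted_in (adj G) (4 * \<epsilon>) U \<and> (4 * \<epsilon>) powr D * order G \<le> card U))"

text \<open>At a constant scale no two blocks are complete to each other, so the union of the blocks is
  sparse. This starts the iteration without an appeal to Roedl's theorem.\<close>

lemma sparse_start:
  fixes \<epsilon> :: real
  assumes "generalized_nice \<F>" and \<epsilon>: "0 < \<epsilon>" "\<epsilon> \<le> 1/16"
  shows "\<exists>D0. \<forall>D\<ge>D0. \<exists>e \<kappa>. 0 < \<kappa> \<and> start_at \<F> \<epsilon> D e \<kappa>"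
proof -
  obtain c1 c3 c4 c5 c7 c8 where cs: "3 \<le> c1" "0 < c3" "0 < c4" "0 < c5" "4 \<le> c7" "0 < c8"
    and nice: "nice_for \<F> c1 c3 c4 c5 c7 c8"
    using nice_outcome[OF assms(1)] by blast
  \<comment> \<open>Expresses the relative block size \<open>\<epsilon> powr c1 / 2\<close> as a
    power of \<open>1/2\<close>, so that \<open>no_pure_blocks\<close> applies to just two blocks
    with \<open>x = 1/2\<close> and \<open>r = 1\<close>.\<close>
  define h where "h = c1 * log 2 (1 / \<epsilon>) + 1"
  have h: "(1/2) powr h = \<epsilon> powr c1 / 2" "0 < h"
  proof -
    have "(1/2) powr h = 2 powr (- h)" by (simp add: powr_divide powr_minus_divide)
    also have "\<dots> = 2 powr (c1 * log 2 \<epsilon>) / 2"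
      using \<epsilon> unfolding h_def by (simp add: log_divide powr_add powr_minus field_simps powr_diff)
    also have "2 powr (c1 * log 2 \<epsilon>) = \<epsilon> powr c1"
      using \<epsilon> powr_powr[of 2 "log 2 \<epsilon>" c1] by (simp add: mult.commute)
    finally show "(1/2) powr h = \<epsilon> powr c1 / 2" .
    have "0 \<le> log 2 (1 / \<epsilon>)" using \<epsilon> by simp
    then show "0 < h" using cs unfolding h_def by (simp add: add_nonneg_pos)
  qed
  define \<kappa> where "\<kappa> = min (c4 / 2) (min (1 / (c5 + 1)) (1 / h))"
  have \<kappa>0: "0 < \<kappa>" using cs h by (simp add: \<kappa>_def)
  have main: "\<exists>U\<subseteq>verts G. restricted_in (adj G) (4 * \<epsilon>) U \<and> (4 * \<epsilon>) powr D * order G \<le> card U"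
    if D: "2 * c1 + 2 * c8 \<le> D"
      and simp: "simple_graph G" and free: "free (complement ` \<F>) G"
      and crit: "critical (adj G) (verts G) c" and c: "c \<le> \<kappa>"
      and big: "1 \<le> \<epsilon> powr (c3 + 1) * real (order G) powr (1/2)"
    for D c and G :: "nat graph"
  proof -
    interpret critical "adj G" "verts G" c by (rule crit)
    define n where "n = real (order G)"
    have n: "n = real (card (verts G))" by (simp add: n_def order_def)
    have n1: "1 \<le> n" using card_V_pos n by linarith
    have c: "c \<le> c4 / 2" "c * (c5 + 1) \<le> 1" "c * h \<le> 1"
      using c cs h unfolding \<kappa>_def by (auto simp: pos_le_divide_eq)
    \<comment> \<open>For \<open>\<epsilon> \<le> 1/16\<close> one has
      \<open>4 * \<epsilon> \<le> \<epsilon> powr (1/2)\<close>; doubling the exponent pays for the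
      factor 4.\<close>
    have small: "(4 * \<epsilon>) powr D \<le> \<epsilon> powr b" if "2 * b \<le> D" "0 \<le> b" for b
    proof -
      have "16 * \<epsilon>\<^sup>2 \<le> 1 * \<epsilon>" unfolding power2_eq_square using \<epsilon> by (simp flip: mult.assoc)
      then have "4 * \<epsilon> \<le> \<epsilon> powr (1/2)"
        using \<epsilon> by (simp add: powr_half_sqrt real_le_rsqrt power_mult_distrib)
      then have "(4 * \<epsilon>) powr D \<le> (\<epsilon> powr (1/2)) powr D"
        using \<epsilon> that by (intro powr_mono2) auto
      also have "\<dots> = \<epsilon> powr (D / 2)" by (simp add: powr_powr)
      also have "\<dots> \<le> \<epsilon> powr b" using \<epsilon> that by (intro powr_antimono) auto
      finally show ?thesis .
    qed
    have h1: "\<epsilon> powr 1 * order G \<le> card (verts G)"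
    proof -
      have "\<epsilon> powr 1 * n \<le> 1 * n" using \<epsilon> n1 by (intro mult_right_mono) auto
      then show ?thesis using n unfolding n_def by simp
    qed
    have "(\<exists>k C w. clean_blocks G (verts G) \<epsilon> c1 k C w) \<or>
        (\<exists>X\<subseteq>verts G. restricted_in (adj G) (\<epsilon> powr c7) X \<and> \<epsilon> powr c8 * card (verts G) \<le> card X)"
      by (rule nice[unfolded nice_for_def, rule_format, OF simp free crit order.refl \<epsilon> zero_le_one h1 big c(1,2)])
    then consider (blocks) k C w where "clean_blocks G (verts G) \<epsilon> c1 k C w"
      | (res) X where "X \<subseteq> verts G" "restricted_in (adj G) (\<epsilon> powr c7) X" "\<epsilon> powr c8 * card (verts G) \<le> card X"
      by blast
    then show ?thesis
    proof cases
      case res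
      have "\<epsilon> powr c7 \<le> \<epsilon> powr 1" using \<epsilon> cs by (intro powr_antimono) auto
      then have "\<epsilon> powr c7 \<le> 4 * \<epsilon>" using \<epsilon> by simp
      then have "restricted_in (adj G) (4 * \<epsilon>) X" by (rule restricted_in_mono[OF res(2)])
      moreover have "(4 * \<epsilon>) powr D * n \<le> \<epsilon> powr c8 * n"
        using small[of c8] D cs n1 by (intro mult_right_mono) auto
      ultimately show ?thesis using res(1,3) n n_def by (intro exI[of _ X]) auto
    next
      case blocks
      note blocks = clean_blocksD[OF blocks]
      have "16 \<le> 1 / \<epsilon>" using \<epsilon> by (simp add: field_simps)
      then have k16: "16 \<le> real k" using blocks(1) by linarith
      have no_complete: False if ij: "i < k" "j < k" "i \<noteq> j" and co: "\<forall>x\<in>C i. \<forall>y\<in>C j. adj G x y" for i j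
      proof -
        define B where "B l = (if l = (0::nat) then C i else C j)" for l
        have sz: "C l \<subseteq> verts G \<and> (1/2) powr h * real (card (verts G)) \<le> real (card (C l))" if "l < k" for l
        proof -
          have "w \<le> 2 * card (C l)" "C l \<subseteq> verts G" using blocks(6) that by auto
          then show ?thesis using blocks(3) unfolding h(1) by auto
        qed
        have Bl: "B l \<subseteq> verts G \<and> (1/2) powr h * real (card (verts G)) \<le> real (card (B l))" if "l < 2" for l
          using sz[OF ij(1)] sz[OF ij(2)] by (simp add: B_def)
        have pw: "pairwise_to (adj G) 2 B"
          unfolding pairwise_to_def
        proof (intro allI impI ballI)
          fix a b x y assume "a < (2::nat)" "b < (2::nat)" "a \<noteq> b" "x \<in> B a" "y \<in> B b"
          then have "x \<in> C i \<and> y \<in> C j \<or> x \<in> C j \<and> y \<in> C i"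
            unfolding B_def by (auto simp: less_2_cases_iff)
          then show "adj G x y" using co sym by (meson sympD)
        qed
        show False
          by (rule no_pure_blocks[of "1/2" 1 2 B h "adj G"]) (use Bl pw c(3) in \<open>auto simp: powr_minus\<close>)
      qed
      have finC: "finite (C i)" if "i < k" for i using blocks(6) that fin finite_subset by blast
      define U where "U = (\<Union>i<k. C i)"
      have UV: "U \<subseteq> verts G" using blocks(6) by (auto simp: U_def)
      have "card U = (\<Sum>i<k. card (C i))"
        unfolding U_def using finC blocks(7) by (intro card_UN_disjoint) auto
      also have "2 * \<dots> = (\<Sum>i<k. 2 * card (C i))" by (simp add: sum_distrib_left)
      also have "\<dots> \<ge> (\<Sum>i<k. w)" using blocks(6) by (intro sum_mono) auto
      finally have "real (k * w) \<le> real (2 * card U)" by (intro of_nat_mono) simp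
      then have cU: "real k * w \<le> 2 * card U" by simp
      have "sparse_in (adj G) (4 * \<epsilon>) U"
        unfolding sparse_in_def
      proof
        fix v assume "v \<in> U"
        then obtain i where i: "i < k" "v \<in> C i" by (auto simp: U_def)
        have "{u\<in>U. adj G v u} = (\<Union>j<k. {u\<in>C j. adj G v u})" by (auto simp: U_def)
        then have "deg (adj G) v U \<le> (\<Sum>j<k. deg (adj G) v (C j))"
          unfolding deg_def using card_UN_le[of "{..<k}" "\<lambda>j. {u\<in>C j. adj G v u}"] by simp
        then have "real (deg (adj G) v U) \<le> real (\<Sum>j<k. deg (adj G) v (C j))" by (rule of_nat_mono)
        also have "\<dots> = real (deg (adj G) v (C i)) + (\<Sum>j\<in>{..<k} - {i}. real (deg (adj G) v (C j)))"
          using i by (simp add: sum.remove[of _ i])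
        also have "\<dots> \<le> real w + (\<Sum>j\<in>{..<k} - {i}. \<epsilon> ^ 4 * w)"
        proof (rule add_mono)
          have "deg (adj G) v (C i) \<le> card (C i)" unfolding deg_def using finC i by (intro card_mono) auto
          also have "\<dots> \<le> w" using blocks(6) i by blast
          finally show "real (deg (adj G) v (C i)) \<le> real w" by simp
          show "(\<Sum>j\<in>{..<k} - {i}. real (deg (adj G) v (C j))) \<le> (\<Sum>j\<in>{..<k} - {i}. \<epsilon> ^ 4 * w)"
          proof (rule sum_mono)
            fix j assume j: "j \<in> {..<k} - {i}"
            then have ij: "i < k" "j < k" "i \<noteq> j" using i by auto
            have "(\<forall>x\<in>C i. \<forall>y\<in>C j. adj G x y) \<or> (\<forall>x\<in>C i. real (deg (adj G) x (C j)) \<le> \<epsilon> ^ 4 * w)"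
              using blocks(7) ij by blast
            then show "real (deg (adj G) v (C j)) \<le> \<epsilon> ^ 4 * w"
              using no_complete[OF ij] i(2) by blast
          qed
        qed
        also have "(\<Sum>j\<in>{..<k} - {i}. \<epsilon> ^ 4 * w) \<le> real k * (\<epsilon> ^ 4 * w)"
        proof -
          have "card ({..<k} - {i}) \<le> k" using card_mono[of "{..<k}" "{..<k} - {i}"] by simp
          then have "real (card ({..<k} - {i})) * (\<epsilon> ^ 4 * w) \<le> real k * (\<epsilon> ^ 4 * w)"
            using \<epsilon> by (intro mult_right_mono) auto
          then show ?thesis by simp
        qed
        also have "real k * (\<epsilon> ^ 4 * w) \<le> (2 / \<epsilon>) * (\<epsilon> ^ 4 * w)"
          using blocks(2) \<epsilon> by (intro mult_right_mono) auto
        also have "(2 / \<epsilon>) * (\<epsilon> ^ 4 * w) = (2 * \<epsilon> ^ 3) * w" using \<epsilon> by (simp add: eval_nat_numeral)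
        also have "\<dots> \<le> 1 * real w"
        proof (rule mult_right_mono)
          have "\<epsilon> ^ 3 \<le> (1/16) ^ 3" using \<epsilon> by (intro power_mono) auto
          then show "2 * \<epsilon> ^ 3 \<le> 1" by (simp add: eval_nat_numeral)
        qed simp
        finally have "real (deg (adj G) v U) \<le> 2 * w" by simp
        \<comment> \<open>The own block and all the others contribute at most \<open>w\<close>
          neighbours each; since \<open>k \<ge> 1 / \<epsilon>\<close> and the blocks keep at least
          \<open>w / 2\<close> vertices, this is a fraction \<open>4 * \<epsilon>\<close> of the
          union.\<close>
        also have "\<dots> \<le> 2 * w * (\<epsilon> * k)"
        proof -
          have "1 \<le> \<epsilon> * k" using blocks(1) \<epsilon> by (simp add: field_simps)
          then have "2 * real w * 1 \<le> 2 * real w * (\<epsilon> * k)" by (intro mult_left_mono) auto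
          then show ?thesis by simp
        qed
        also have "\<dots> = 2 * \<epsilon> * (real k * w)" by simp
        also have "\<dots> \<le> 2 * \<epsilon> * (2 * card U)" using cU \<epsilon> by (intro mult_left_mono) auto
        also have "\<dots> = 4 * \<epsilon> * card U" by simp
        finally show "real (deg (adj G) v U) \<le> 4 * \<epsilon> * card U" .
      qed
      then have "restricted_in (adj G) (4 * \<epsilon>) U" by (simp add: restricted_in_def)
      moreover have "(4 * \<epsilon>) powr D * n \<le> card U"
      proof -
        have "(4 * \<epsilon>) powr D * n \<le> \<epsilon> powr c1 * n"
          using small[of c1] D cs n1 by (intro mult_right_mono) auto
        also have "\<dots> \<le> real w" using blocks(3) n by simp
        also have "\<dots> \<le> card U"
        proof -
          have "2 * real w \<le> real k * w" using k16 by (intro mult_right_mono) auto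
          then show ?thesis using cU by linarith
        qed
        finally show ?thesis .
      qed
      ultimately show ?thesis using UV unfolding n_def by blast
    qed
  qed
  show ?thesis
  proof (rule exI[of _ "2 * c1 + 2 * c8"], intro allI impI)
    fix D assume D: "2 * c1 + 2 * c8 \<le> D"
    show "\<exists>e \<kappa>. 0 < \<kappa> \<and> start_at \<F> \<epsilon> D e \<kappa>"
      unfolding start_at_def
    proof (rule exI[of _ "c3 + 1"], rule exI[of _ \<kappa>], intro conjI \<kappa>0 allI impI)
      fix G :: "nat graph" and c
      assume *: "simple_graph G" "free (complement ` \<F>) G" "critical (adj G) (verts G) c" "c \<le> \<kappa>"
        "1 \<le> \<epsilon> powr (c3 + 1) * real (order G) powr (1/2)"
      show "\<exists>U\<subseteq>verts G. restricted_in (adj G) (4 * \<epsilon>) U \<and> (4 * \<epsilon>) powr D * order G \<le> card U"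
        by (rule main[OF D *])
    qed
  qed
qed

text \<open>\<open>n powr c > 2\<close> means \<open>n > 2 powr (1 / c)\<close>, so a small
  \<open>c\<close> makes \<open>n\<close> exceed any prescribed constant.\<close>

lemma large_order:
  fixes x e :: real
  assumes x: "0 < x" "x \<le> 1" and e: "0 \<le> e"
  shows "\<exists>\<kappa>>0. \<forall>c n. 0 < c \<longrightarrow> c \<le> \<kappa> \<longrightarrow> 1 \<le> n \<longrightarrow> 2 < n powr c \<longrightarrow> 1 \<le> x powr e * n powr (1/2)"
proof -
  define L where "L = e * log 2 (1 / x) + 1"
  have L: "0 < L" using x e by (simp add: L_def add_nonneg_pos)
  have "1 \<le> x powr e * n powr (1/2)" if c: "0 < c" "c \<le> 1 / (2 * L)" and n: "1 \<le> n" "2 < n powr c" for c n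
  proof -
    have "L \<le> 1 / (2 * c)" using c L by (simp add: field_simps)
    have "x powr (- e) = 2 powr (e * log 2 (1 / x))"
      using x powr_powr[of 2 "log 2 (1 / x)" e] by (simp add: mult.commute powr_divide powr_minus_divide)
    also have "\<dots> \<le> 2 powr (1 / (2 * c))"
      using \<open>L \<le> _\<close> unfolding L_def by (intro powr_mono_exp) auto
    also have "\<dots> \<le> (n powr c) powr (1 / (2 * c))"
      using n c by (intro powr_mono2) auto
    also have "\<dots> = n powr (1/2)" using c by (simp add: powr_powr)
    finally have "x powr e * x powr (- e) \<le> x powr e * n powr (1/2)" by (intro mult_left_mono) auto
    then show ?thesis using x by (simp add: powr_minus)
  qed
  then show ?thesis using L by (intro exI[of _ "1 / (2 * L)"]) auto
qed

text \<open>The greedy bound gives a homogeneous set of size at least \<open>1 / (2 * z)\<close>,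
  which exceeds \<open>card V powr (2 * c) / 2\<close>. The exponent \<open>2 * c\<close> instead of
  \<open>c\<close> absorbs the factor 2, because \<open>card V powr c > 2\<close>.\<close>

lemma (in critical) no_very_restricted_subset:
  assumes U: "U \<subseteq> V" and z: "0 < z" "z < real (card V) powr (- 2 * c)" and r: "restricted_in E z U"
    and size: "1 \<le> z * real (card U)"
  shows False
proof -
  define n where "n = real (card V)"
  have finU: "finite U" using U fin finite_subset by blast
  obtain R where R: "R = E \<or> R = co E" "sparse_in R z U" using r unfolding restricted_in_def by blast
  have symR: "symp R" using R(1) sym symp_co by blast
  obtain Y where Y: "Y \<subseteq> U" "clique_in (co R) Y" "real (card U) \<le> (z * card U + 1) * real (card Y)"
    using turan_bound[OF finU symR, of "z * card U"] R(2) z unfolding sparse_in_def by auto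
  have Upos: "0 < real (card U)" using size by (cases "card U = 0") auto
  have "real (card U) \<le> (z * card U + z * card U) * real (card Y)"
    using Y(3) size by (smt (verit) mult_right_mono of_nat_0_le_iff)
  then have "1 * real (card U) \<le> (2 * z * real (card Y)) * real (card U)" by (simp add: mult_ac)
  then have "1 \<le> 2 * z * real (card Y)" using Upos by (rule mult_right_le_imp_le)
  also have "\<dots> \<le> 2 * n powr (- 2 * c) * real (card Y)"
    using z unfolding n_def by (intro mult_right_mono) auto
  finally have "n powr (2 * c) * 1 \<le> n powr (2 * c) * (2 * n powr (- 2 * c) * real (card Y))"
    by (intro mult_left_mono) auto
  also have "\<dots> = 2 * real (card Y)"
    using card_V_pos by (simp add: n_def powr_minus)
  finally have 1: "n powr (2 * c) \<le> 2 * real (card Y)" by simp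
  have "2 * n powr c \<le> n powr c * n powr c"
    using card_V_powr_gt unfolding n_def by (intro mult_right_mono) auto
  also have "\<dots> = n powr (2 * c)" by (rule powr_mult_eq) simp
  finally have "n powr c \<le> real (card Y)" using 1 by linarith
  moreover have "clique_in E Y \<or> clique_in (co E) Y" using R(1) Y(2) co_co[OF irr] by auto
  ultimately show False using clique_in_less[of Y] Y(1) U unfolding n_def by fastforce
qed

lemma no_critical:
  assumes "\<forall>F\<in>\<F>. simple_graph F" "leaf_reducible \<F>" "wonderful \<F>" "generalized_nice \<F>"
  shows "\<exists>c>0. \<forall>G :: nat graph. simple_graph G \<longrightarrow> free (complement ` \<F>) G \<longrightarrow>
    \<not> critical (adj G) (verts G) c"
proof -
  let ?P = "\<lambda>G y S. sparse_in (adj G) y S" and ?Q = "\<lambda>G y S. sparse_in (co (adj G)) y S"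
  obtain y1 D1 where y1: "0 < y1" and D1: "\<forall>D\<ge>D1. \<exists>e \<kappa>. 0 < \<kappa> \<and> step_at \<F> ?P y1 D e \<kappa>"
    using sparse_step[OF assms(3,4)] by blast
  obtain y2 D2 where y2: "0 < y2" and D2: "\<forall>D\<ge>D2. \<exists>e \<kappa>. 0 < \<kappa> \<and> step_at \<F> ?Q y2 D e \<kappa>"
    using cosparse_step[OF assms(1,2)] by blast
  define y0 where "y0 = min (min y1 y2) (1/4)"
  have y0: "0 < y0" "y0 \<le> y1" "y0 \<le> y2" "y0 \<le> 1/4" using y1 y2 by (auto simp: y0_def)
  \<comment> \<open>Starting at \<open>y0 / 4\<close> yields a set that is restricted with parameter
    exactly \<open>y0\<close>.\<close>
  have \<epsilon>: "0 < y0 / 4" "y0 / 4 \<le> 1/16" using y0 by auto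
  obtain D3 where D3: "\<forall>D\<ge>D3. \<exists>e \<kappa>. 0 < \<kappa> \<and> start_at \<F> (y0 / 4) D e \<kappa>"
    using sparse_start[OF assms(4) \<epsilon>] by blast
  define D where "D = max (max D1 D2) (max D3 0)"
  have D: "D1 \<le> D" "D2 \<le> D" "D3 \<le> D" "0 \<le> D" by (auto simp: D_def)
  obtain e1 \<kappa>1 where \<kappa>1: "0 < \<kappa>1" and step1: "step_at \<F> ?P y1 D e1 \<kappa>1"
    using D1 D(1) by blast
  obtain e2 \<kappa>2 where \<kappa>2: "0 < \<kappa>2" and step2: "step_at \<F> ?Q y2 D e2 \<kappa>2"
    using D2 D(2) by blast
  obtain e3 \<kappa>3 where \<kappa>3: "0 < \<kappa>3" and step3: "start_at \<F> (y0 / 4) D e3 \<kappa>3"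
    using D3 D(3) by blast
  \<comment> \<open>\<open>2 * (D + 1)\<close> is for the last round, where the size condition at
    the square of a parameter is derived from that parameter.\<close>
  define e where "e = max (max e1 e2) (max e3 (2 * (D + 1)))"
  have e: "e1 \<le> e" "e2 \<le> e" "e3 \<le> e" "2 * (D + 1) \<le> e" by (auto simp: e_def)
  have e0: "0 < e"
  proof -
    have "0 < 2 * (D + 1)" using D(4) by simp
    then show ?thesis using e(4) by (rule less_le_trans)
  qed
  obtain \<kappa>4 where \<kappa>4: "0 < \<kappa>4" and large: "\<And>c n. 0 < c \<Longrightarrow> c \<le> \<kappa>4 \<Longrightarrow> 1 \<le> n \<Longrightarrow> 2 < n powr c \<Longrightarrow>
      1 \<le> (y0 / 4) powr e * n powr (1/2)"
    using large_order[of "y0 / 4" e] y0 e0 by auto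
  \<comment> \<open>\<open>1 / (4 * e)\<close> turns \<open>y \<ge> n powr (- 2 * c)\<close> into
    \<open>y powr e \<ge> n powr (-1/2)\<close>.\<close>
  define c where "c = min (min \<kappa>1 \<kappa>2) (min (min \<kappa>3 \<kappa>4) (1 / (4 * e)))"
  have c: "0 < c" "c \<le> \<kappa>1" "c \<le> \<kappa>2" "c \<le> \<kappa>3" "c \<le> \<kappa>4" "c \<le> 1 / (4 * e)"
    using \<kappa>1 \<kappa>2 \<kappa>3 \<kappa>4 e0 by (auto simp: c_def)
  have False if simp: "simple_graph G" and free: "free (complement ` \<F>) G"
    and crit: "critical (adj G) (verts G) c" for G :: "nat graph"
  proof -
    interpret critical "adj G" "verts G" c by (rule crit)
    define n where "n = real (order G)"
    have n: "n = real (card (verts G))" by (simp add: n_def order_def)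
    have n1: "1 \<le> n" using card_V_pos n by linarith
    have nc: "2 < n powr c" using card_V_powr_gt n by simp
    have start: "1 \<le> (y0 / 4) powr e * n powr (1/2)" by (rule large[OF c(1,5) n1 nc])
    define y where "y j = y0 ^ (2 ^ j)" for j :: nat
    have ypos: "0 < y j" "y j \<le> y0" for j
      using y0 power_decreasing[of 1 "2 ^ j" y0] by (auto simp: y_def)
    have ysq: "y (Suc j) = (y j)\<^sup>2" for j by (simp add: y_def power_mult[symmetric] mult.commute)
    \<comment> \<open>Index 0 is separate because \<open>y0\<close> may already lie below the
      threshold; there largeness of \<open>n\<close> is used instead.\<close>
    have big: "1 \<le> y j powr e * n powr (1/2)" if "n powr (- 2 * c) \<le> y j \<or> j = 0" for j
      using that
    proof
      assume ge: "n powr (- 2 * c) \<le> y j"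
      have "n powr (- 1/2) \<le> n powr (- 2 * c * e)"
        using n1 c(6) e0 by (intro powr_mono_exp) (auto simp: field_simps)
      also have "\<dots> = (n powr (- 2 * c)) powr e" by (simp add: powr_powr)
      also have "\<dots> \<le> y j powr e" using ge e0 by (intro powr_mono2) auto
      finally have "n powr (- 1/2) * n powr (1/2) \<le> y j powr e * n powr (1/2)"
        by (intro mult_right_mono) auto
      moreover have "n powr (- 1/2) * n powr (1/2) = 1"
        using powr_mult_eq[of "- 1/2" "1/2" 0 n] n1 by simp
      ultimately show ?thesis by linarith
    next
      assume "j = 0"
      then have "y j = y0" by (simp add: y_def)
      moreover have "(y0 / 4) powr e \<le> y0 powr e" using y0 e0 by (intro powr_mono2) auto
      then have "(y0 / 4) powr e * n powr (1/2) \<le> y0 powr e * n powr (1/2)" by (intro mult_right_mono) auto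
      ultimately show ?thesis using start by simp
    qed
    define P where "P j \<longleftrightarrow> (\<exists>U\<subseteq>verts G. restricted_in (adj G) (y j) U \<and> y j powr D * n \<le> card U)" for j
    have P0: "P 0"
    proof -
      have "1 \<le> (y0 / 4) powr e3 * real (order G) powr (1/2)"
        using big_power(1)[OF _ _ n1 start e(3)] y0 unfolding n_def by simp
      then have "\<exists>U\<subseteq>verts G. restricted_in (adj G) (4 * (y0 / 4)) U \<and> (4 * (y0 / 4)) powr D * order G \<le> card U"
        by (rule step3[unfolded start_at_def, rule_format, OF simp free crit c(4)])
      moreover have "4 * (y0 / 4) = y 0" by (simp add: y_def)
      ultimately show ?thesis unfolding P_def n_def by (simp only:)
    qed
    have PSuc: "P (Suc j)" if Pj: "P j" and nj: "n powr (- 2 * c) \<le> y j" for j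
    proof -
      obtain S where S: "S \<subseteq> verts G" "restricted_in (adj G) (y j) S" "y j powr D * n \<le> card S"
        using Pj unfolding P_def by blast
      have yj: "0 < y j" "y j \<le> y1" "y j \<le> y2" "y j \<le> 1" using ypos[of j] y0 by linarith+
      have bg: "1 \<le> y j powr e1 * real (order G) powr (1/2)" "1 \<le> y j powr e2 * real (order G) powr (1/2)"
        using big_power(1)[OF yj(1,4) n1 big[OF disjI1[OF nj]] e(1)]
          big_power(1)[OF yj(1,4) n1 big[OF disjI1[OF nj]] e(2)] unfolding n_def .
      have "\<exists>U\<subseteq>verts G. restricted_in (adj G) ((y j)\<^sup>2) U \<and> y j powr (2 * D) * order G \<le> card U"
        using S(2)[unfolded restricted_in_def]
      proof
        assume "sparse_in (adj G) (y j) S"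
        then show ?thesis
          by (rule step1[unfolded step_at_def, rule_format, OF simp free crit c(2) yj(1,2) bg(1) S(1)]) (use S(3) n_def in simp)
      next
        assume "sparse_in (co (adj G)) (y j) S"
        then show ?thesis
          by (rule step2[unfolded step_at_def, rule_format, OF simp free crit c(3) yj(1,3) bg(2) S(1)]) (use S(3) n_def in simp)
      qed
      moreover have "(y j)\<^sup>2 powr D = y j powr (2 * D)"
        using yj(1) powr_powr[of "y j" 2 D] by simp
      ultimately show ?thesis unfolding P_def ysq n_def by simp
    qed
    have "\<exists>j. y j < n powr (- 2 * c)"
    proof -
      obtain j where "y0 ^ j < n powr (- 2 * c)"
        using real_arch_pow_inv[of "n powr (- 2 * c)" y0] n1 y0 by auto
      moreover have "y j \<le> y0 ^ j"
        unfolding y_def using y0 by (intro power_decreasing) (auto intro: less_imp_le)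
      ultimately show ?thesis by (intro exI[of _ j]) linarith
    qed
    then obtain J where J: "y J < n powr (- 2 * c)" and least: "\<And>i. i < J \<Longrightarrow> \<not> y i < n powr (- 2 * c)"
      using exists_least_iff[of "\<lambda>j. y j < n powr (- 2 * c)"] by blast
    have "j \<le> J \<Longrightarrow> P j" for j
    proof (induction j)
      case 0
      show ?case by (rule P0)
    next
      case (Suc j)
      then show ?case using PSuc[of j] least[of j] by simp
    qed
    from this[of J] obtain U where U: "U \<subseteq> verts G" "restricted_in (adj G) (y J) U" "y J powr D * n \<le> card U"
      unfolding P_def by blast
    \<comment> \<open>\<open>y J\<close> lies below the threshold, so for \<open>J > 0\<close> the
      bound is taken at its predecessor, the square root of \<open>y J\<close>.\<close>
    have "1 \<le> y J powr (D + 1) * n"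
    proof (cases J)
      case 0
      show ?thesis
        by (rule big_power(2)[OF _ _ n1 big[of J]]) (use 0 ypos[of J] y0 e(4) D(4) in auto)
    next
      case (Suc i)
      have "y J powr (D + 1) = y i powr (2 * (D + 1))"
        using ypos[of i] powr_powr[of "y i" 2 "D + 1"] unfolding Suc ysq by simp
      moreover have "1 \<le> y i powr (2 * (D + 1)) * n"
        by (rule big_power(2)[OF _ _ n1 big[of i]]) (use Suc ypos[of i] y0 e(4) least[of i] in auto)
      ultimately show ?thesis by simp
    qed
    also have "y J powr (D + 1) * n = y J * (y J powr D * n)"
      using powr_mult_eq[of 1 D "D + 1" "y J"] ypos[of J] by (simp add: add.commute)
    also have "\<dots> \<le> y J * real (card U)" using U(3) ypos[of J] by (intro mult_left_mono) auto
    finally show False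
      using no_very_restricted_subset[OF U(1) ypos(1) _ U(2)] J n by simp
  qed
  then show ?thesis using c(1) by blast
qed

text \<open>The bound on \<open>homog\<close> concerns graphs free of the complemented class and is
  applied to the complement of an \<open>\<F>\<close>-free graph. Replacing the product by one
  homogeneous set halves the exponent.\<close>

theorem lemma1p12:
  fixes \<F> :: "nat graph set"
  assumes "finite \<F>"
    and "\<forall>F\<in>\<F>. simple_graph F"
    and "leaf_reducible \<F>"
    and "wonderful \<F>"
    and "generalized_nice \<F>"
  shows "erdos_hajnal \<F>"
proof -
  obtain c where c: "0 < c" and nocrit: "\<And>G :: nat graph. simple_graph G \<Longrightarrow>
      free (complement ` \<F>) G \<Longrightarrow> \<not> critical (adj G) (verts G) c"
    using no_critical[OF assms(2-5)] by blast
  have homog: "real (order G) powr c \<le> real (homog (adj G) (verts G))"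
    if "simple_graph G" "free (complement ` \<F>) G" for G :: "nat graph"
    using that
  proof (induction "order G" arbitrary: G rule: less_induct)
    case less
    show ?case
    proof (rule ccontr)
      assume neg: "\<not> ?thesis"
      have finV: "finite (verts G)" using less.prems by (simp add: simple_graph_def)
      \<comment> \<open>Strong induction on the order provides the bound for proper induced
        subgraphs, so a failure at \<open>G\<close> is a minimal one.\<close>
      have "critical (adj G) (verts G) c"
      proof
        fix S assume S: "S \<subset> verts G"
        then have SV: "S \<subseteq> verts G" by blast
        have "order (induced G S) < order G"
          unfolding order_def using psubset_card_mono[OF finV S] by simp
        then have "real (order (induced G S)) powr c \<le> real (homog (adj (induced G S)) S)"
          using less.hyps[of "induced G S"] simple_induced[OF less.prems(1) SV]
            free_induced[OF less.prems(2) SV] by simp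
        moreover have "homog (adj (induced G S)) S = homog (adj G) S"
        proof -
          have "clique_in (adj (induced G S)) X \<longleftrightarrow> clique_in (adj G) X"
            "clique_in (co (adj (induced G S))) X \<longleftrightarrow> clique_in (co (adj G)) X" if "X \<subseteq> S" for X
            using that by (auto intro!: clique_in_cong simp: adj_induced co_def)
          then have "{X. X \<subseteq> S \<and> clique_in (adj (induced G S)) X} = {X. X \<subseteq> S \<and> clique_in (adj G) X}"
            "{X. X \<subseteq> S \<and> clique_in (co (adj (induced G S))) X} = {X. X \<subseteq> S \<and> clique_in (co (adj G)) X}" by blast+
          then show ?thesis unfolding homog_def clique_num_def by simp
        qed
        ultimately show "real (card S) powr c \<le> real (homog (adj G) S)" by (simp add: order_def)
      qed (use neg finV c symp_adj irreflp_adj less.prems in \<open>auto simp: order_def\<close>)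
      then show False using nocrit less.prems by blast
    qed
  qed
  have "\<exists>X. (clique J X \<or> stable J X) \<and> real (order J) powr (c / 2) \<le> real (card X)"
    if J: "simple_graph J" "free \<F> J" for J :: "nat graph"
  proof -
    let ?G = "complement J"
    have G: "simple_graph ?G" by (rule simple_complement[OF J(1)])
    have "complement ?G = J"
      using J(1) unfolding complement_def simple_graph_def by (auto intro!: graph.equality)
    then have "free (complement ` \<F>) ?G"
      using free_complement_iff[OF G assms(2)] J(2) by simp
    from homog[OF G this] have ge: "real (order J) powr c \<le> real (homog (adj ?G) (verts J))"
      by (simp add: order_def)
    have "finite (verts J)" using J(1) by (simp add: simple_graph_def)
    from clique_in_ge_homog[OF this, of "adj ?G"] obtain X where
      X: "X \<subseteq> verts J" "clique_in (adj ?G) X \<or> clique_in (co (adj ?G)) X" "homog (adj ?G) (verts J) \<le> card X ^ 2"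
      by blast
    have "real (order J) powr (c / 2) \<le> real (card X)"
    proof (rule power2_le_imp_le)
      have "(real (order J) powr (c / 2))\<^sup>2 = real (order J) powr c"
        unfolding power2_eq_square by (rule powr_mult_eq) simp
      also have "\<dots> \<le> real (card X ^ 2)" using ge X(3) by linarith
      finally show "(real (order J) powr (c / 2))\<^sup>2 \<le> (real (card X))\<^sup>2" by simp
    qed simp
    moreover have "clique_in (co (adj J)) X \<or> clique_in (adj J) X"
      using X(1,2) unfolding clique_in_def by (auto simp: adj_complement co_def subset_iff)
    ultimately show ?thesis using X(1) by (auto simp: clique_iff stable_iff)
  qed
  moreover have "\<F> \<noteq> {}" using assms(3) unfolding leaf_reducible_def by blast
  ultimately show ?thesis
    unfolding erdos_hajnal_def using c by (intro conjI exI[of _ "c / 2"]) auto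
qed

end
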